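(* Let $n\ge 2$, $G=S_n$ acting on $V=\mathbb{C}^n$ by permutation of coordinates, and let $m\ge1$ be an integer. Apart from the constants (degree $0$), the $m$-harmonic polynomials of lowest degree are of degree $nm+1$. The space of homogeneous $m$-harmonic polynomials of degree $nm+1$ is an $(n-1)$-dimensional simple $S_n$-module, isomorphic to $\{x\in\mathbb{C}^n\mid\sum_i x_i=0\}$ with the permutation action, and the polynomials \[ \phi^{(j)}(x)=\frac{1}{1+nm}\int_{x_1}^{x_j}\sum_{i=1}^n\frac{x_i\,dt}{t-x_i}\prod_{k=1}^n(t-x_k)^m,\qquad j=2,\dots,n, \] form a basis of it.
   Context: Here the reflections of $S_n$ are the transpositions $s_{jk}$, $j<k$, with reflection hyperplanes $x_j=x_k$, all with the same multiplicity $m$. For $\xi\in\mathbb{C}^n$, the Dunkl operators \[ D_\xi u(x)=\partial_\xi u(x)+m\sum_{j<k}\frac{\xi_j-\xi_k}{x_j-x_k}\,(u(s_{jk}x)-u(x)) \] commute. Let $\sigma_1,\dots,\sigma_n$ be homogeneous free generators of the algebra of symmetric polynomials in $n$ variables, and let $\sigma_i(D)$ be obtained by substituting $D_{e_1},\dots,D_{e_n}$ for the variables ($e_1,\dots,e_n$ is the standard basis). $\mathcal{L}_i$ is the differential operator with highest symbol $\sigma_i$ whose restriction to $S_n$-invariant functions coincides with that of $\sigma_i(D)$. The $m$-harmonic polynomials are the solutions $\phi$ of $\mathcal{L}_i\phi=0$, $i=1,\dots,n$; all solutions are known to be polynomial and they form an $n!$-dimensional space, graded by degree. $S_n$ acts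 on functions by $(g\phi)(x)=\phi(g^{-1}x)$. *)

theory Defs
  imports
    "HOL-Complex_Analysis.Contour_Integration"
    "HOL-Library.Poly_Mapping"
    "HOL-Library.Function_Algebras"
begin

text \<open>
  Vectors of \<open>\<complex>\<^sup>n\<close> are elements of \<open>complex ^ 'n\<close> with \<open>n = CARD('n)\<close>; the linear order on the
  index type plays the role of the order on \<open>{1, \<dots>, n}\<close>, so that the index \<open>1\<close> is \<open>Min UNIV\<close>.
\<close>

type_synonym 'n cvec = "complex ^ 'n"


section \<open>Polynomials\<close>

abbreviation lookup where "lookup \<equiv> Poly_Mapping.lookup"
abbreviation keys where "keys \<equiv> Poly_Mapping.keys"

type_synonym 'n mpoly = "('n \<Rightarrow>\<^sub>0 nat) \<Rightarrow>\<^sub>0 complex"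

definition mdeg :: "('n::finite \<Rightarrow>\<^sub>0 nat) \<Rightarrow> nat" where
  "mdeg \<alpha> = (\<Sum>i\<in>UNIV. lookup \<alpha> i)"

definition peval :: "'n::finite mpoly \<Rightarrow> 'n cvec \<Rightarrow> complex" where
  "peval p x = (\<Sum>\<alpha>\<in>keys p. lookup p \<alpha> * (\<Prod>i\<in>UNIV. (x $ i) ^ lookup \<alpha> i))"

definition total_deg :: "'n::finite mpoly \<Rightarrow> nat" where
  "total_deg p = Max (insert 0 (mdeg ` keys p))"

definition homogeneous :: "nat \<Rightarrow> 'n::finite mpoly \<Rightarrow> bool" where
  "homogeneous d p \<longleftrightarrow> (\<forall>\<alpha>\<in>keys p. mdeg \<alpha> = d)"


section \<open>The action of the symmetric group\<close>

text \<open>\<open>(g x)\<^sub>i = x\<^bsub>g\<^sup>-\<^sup>1 i\<^esub>\<close>, so that \<open>g e\<^sub>i = e\<^bsub>g i\<^esub>\<close>.\<close>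

definition perm_vec :: "('n::finite \<Rightarrow> 'n) \<Rightarrow> 'n cvec \<Rightarrow> 'n cvec" where
  "perm_vec g x = (\<chi> i. x $ inv g i)"

definition perm_fun ::
    "('n::finite \<Rightarrow> 'n) \<Rightarrow> ('n cvec \<Rightarrow> complex) \<Rightarrow> ('n cvec \<Rightarrow> complex)" where
  "perm_fun g \<phi> = (\<lambda>x. \<phi> (perm_vec (inv g) x))"

definition symmetric_polys :: "('n::finite cvec \<Rightarrow> complex) set" where
  "symmetric_polys = {f \<in> range peval. \<forall>g. g permutes UNIV \<longrightarrow> perm_fun g f = f}"

text \<open>
  Polynomial functions on \<open>\<complex>\<^sup>n\<close> and formal polynomials are the same thing, so generation and
  algebraic independence are expressed with functions.
\<close>

definition free_generators :: "('n::finite \<Rightarrow> 'n mpoly) \<Rightarrow> bool" where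
  "free_generators \<sigma> \<longleftrightarrow>
     (\<forall>i. peval (\<sigma> i) \<in> symmetric_polys) \<and>
     (\<forall>f\<in>symmetric_polys. \<exists>q. f = (\<lambda>x. peval q (\<chi> i. peval (\<sigma> i) x))) \<and>
     (\<forall>q. (\<lambda>x. peval q (\<chi> i. peval (\<sigma> i) x)) = (\<lambda>x. 0) \<longrightarrow> q = 0)"


section \<open>Dunkl operators\<close>

definition dir_deriv ::
    "'n::finite cvec \<Rightarrow> ('n cvec \<Rightarrow> complex) \<Rightarrow> ('n cvec \<Rightarrow> complex)" where
  "dir_deriv \<xi> u = (\<lambda>x. deriv (\<lambda>t. u (x + t *s \<xi>)) 0)"

definition reg_set :: "('n::finite cvec) set" where
  "reg_set = {x. \<forall>j k. j \<noteq> k \<longrightarrow> x $ j \<noteq> x $ k}"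

text \<open>
  Only values on \<^const>\<open>reg_set\<close> are meaningful; there \<open>D\<^sub>\<xi> u\<close> depends only on \<open>u\<close> restricted to the
  (open, permutation invariant) set \<^const>\<open>reg_set\<close>.
\<close>

definition dunkl ::
    "nat \<Rightarrow> 'n::{finite,linorder} cvec \<Rightarrow> ('n cvec \<Rightarrow> complex) \<Rightarrow> ('n cvec \<Rightarrow> complex)"
  where
  "dunkl m \<xi> u = (\<lambda>x. dir_deriv \<xi> u x +
     of_nat m * (\<Sum>(j, k)\<in>{(j, k). j < k}.
       (\<xi> $ j - \<xi> $ k) / (x $ j - x $ k) *
         (u (perm_vec (Transposition.transpose j k) x) - u x)))"

text \<open>
  \<open>A\<^sup>\<alpha>\<close> for a family of operators \<open>A\<close>. It is used for the partial derivatives and for the operators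
  \<open>D\<^bsub>e\<^sub>i\<^esub>\<close>, which commute on the functions considered, so that the order of the factors is immaterial.
\<close>

definition op_monom ::
    "('n::{finite,linorder} \<Rightarrow> 'f \<Rightarrow> 'f) \<Rightarrow> ('n \<Rightarrow>\<^sub>0 nat) \<Rightarrow> 'f \<Rightarrow> 'f" where
  "op_monom A \<alpha> = foldr (\<lambda>i F. (A i ^^ lookup \<alpha> i) \<circ> F) (sorted_list_of_set UNIV) id"

definition dunkl_subst ::
    "nat \<Rightarrow> 'n::{finite,linorder} mpoly \<Rightarrow> ('n cvec \<Rightarrow> complex) \<Rightarrow> ('n cvec \<Rightarrow> complex)"
  where
  "dunkl_subst m p u = (\<lambda>x.
     \<Sum>\<alpha>\<in>keys p. lookup p \<alpha> * op_monom (\<lambda>i. dunkl m (axis i 1)) \<alpha> u x)"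


section \<open>Differential operators and m-harmonic polynomials\<close>

text \<open>The algebra \<open>\<complex>[V\<^sub>r\<^sub>e\<^sub>g]\<close> of rational functions with poles on the reflection hyperplanes only.\<close>

definition regular_fun :: "('n::{finite,linorder} cvec \<Rightarrow> complex) \<Rightarrow> bool" where
  "regular_fun u \<longleftrightarrow> (\<exists>q N. \<forall>x\<in>reg_set.
     u x = peval q x / (\<Prod>(j, k)\<in>{(j, k). j < k}. x $ j - x $ k) ^ N)"

text \<open>\<open>\<Sum>\<^sub>\<alpha> a\<^sub>\<alpha>(x) \<partial>\<^sup>\<alpha>\<close>, given by the finitely supported family of its coefficients.\<close>

type_synonym 'n diffop = "('n \<Rightarrow>\<^sub>0 nat) \<Rightarrow>\<^sub>0 ('n cvec \<Rightarrow> complex)"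

definition diffop_apply ::
    "'n::{finite,linorder} diffop \<Rightarrow> ('n cvec \<Rightarrow> complex) \<Rightarrow> ('n cvec \<Rightarrow> complex)" where
  "diffop_apply a u = (\<lambda>x.
     \<Sum>\<alpha>\<in>keys a. lookup a \<alpha> x * op_monom (\<lambda>i. dir_deriv (axis i 1)) \<alpha> u x)"

definition highest_symbol :: "'n::{finite,linorder} diffop \<Rightarrow> 'n mpoly \<Rightarrow> bool" where
  "highest_symbol a p \<longleftrightarrow> p \<noteq> 0 \<and> (\<exists>d. homogeneous d p \<and>
     (\<forall>\<alpha>. d < mdeg \<alpha> \<longrightarrow> lookup a \<alpha> = 0) \<and>
     (\<forall>\<alpha>. mdeg \<alpha> = d \<longrightarrow> (\<forall>x\<in>reg_set. lookup a \<alpha> x = lookup p \<alpha>)))"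

text \<open>
  The coefficients are functions on \<^const>\<open>reg_set\<close>, extended by \<open>0\<close>. The last condition determines
  the coefficients uniquely, since the jets of symmetric polynomials at a point of \<^const>\<open>reg_set\<close>
  are arbitrary.
\<close>

definition is_calogero_op :: "nat \<Rightarrow> 'n::{finite,linorder} mpoly \<Rightarrow> 'n diffop \<Rightarrow> bool" where
  "is_calogero_op m p a \<longleftrightarrow>
     (\<forall>\<alpha>. regular_fun (lookup a \<alpha>) \<and> (\<forall>x. x \<notin> reg_set \<longrightarrow> lookup a \<alpha> x = 0)) \<and>
     highest_symbol a p \<and>
     (\<forall>u. regular_fun u \<and> (\<forall>g x. g permutes UNIV \<and> x \<in> reg_set \<longrightarrow> perm_fun g u x = u x) \<longrightarrow>
        (\<forall>x\<in>reg_set. diffop_apply a u x = dunkl_subst m p u x))"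

definition calogero_op :: "nat \<Rightarrow> 'n::{finite,linorder} mpoly \<Rightarrow> 'n diffop" where
  "calogero_op m p = (THE a. is_calogero_op m p a)"

definition harmonic_polys ::
    "nat \<Rightarrow> ('n::{finite,linorder} \<Rightarrow> 'n mpoly) \<Rightarrow> ('n cvec \<Rightarrow> complex) set" where
  "harmonic_polys m \<sigma> =
     {\<phi> \<in> range peval. \<forall>i. \<forall>x\<in>reg_set. diffop_apply (calogero_op m (\<sigma> i)) \<phi> x = 0}"

definition harmonic_polys_deg ::
    "nat \<Rightarrow> ('n::{finite,linorder} \<Rightarrow> 'n mpoly) \<Rightarrow> nat \<Rightarrow> ('n cvec \<Rightarrow> complex) set" where
  "harmonic_polys_deg m \<sigma> d = harmonic_polys m \<sigma> \<inter> peval ` {p. homogeneous d p}"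


section \<open>Representations of the symmetric group\<close>

definition fscale :: "complex \<Rightarrow> ('a \<Rightarrow> complex) \<Rightarrow> ('a \<Rightarrow> complex)" where
  "fscale c f = (\<lambda>x. c * f x)"

interpretation fun_vs: vector_space fscale
  by unfold_locales (auto simp: fscale_def fun_eq_iff algebra_simps)

definition Sn_submodule ::
    "(complex \<Rightarrow> 'v::ab_group_add \<Rightarrow> 'v) \<Rightarrow> (('n \<Rightarrow> 'n) \<Rightarrow> 'v \<Rightarrow> 'v) \<Rightarrow> 'v set \<Rightarrow> bool" where
  "Sn_submodule scl act W \<longleftrightarrow>
     module.subspace scl W \<and> (\<forall>g. g permutes UNIV \<longrightarrow> (\<forall>v\<in>W. act g v \<in> W))"

definition simple_Sn_module ::
    "(complex \<Rightarrow> 'v::ab_group_add \<Rightarrow> 'v) \<Rightarrow> (('n \<Rightarrow> 'n) \<Rightarrow> 'v \<Rightarrow> 'v) \<Rightarrow> 'v set \<Rightarrow> bool" where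
  "simple_Sn_module scl act W \<longleftrightarrow>
     Sn_submodule scl act W \<and> W \<noteq> {0} \<and>
     (\<forall>U. U \<subseteq> W \<and> Sn_submodule scl act U \<longrightarrow> U = {0} \<or> U = W)"

definition Sn_isomorphic ::
    "(complex \<Rightarrow> 'v::ab_group_add \<Rightarrow> 'v) \<Rightarrow> (('n \<Rightarrow> 'n) \<Rightarrow> 'v \<Rightarrow> 'v) \<Rightarrow> 'v set \<Rightarrow>
     (complex \<Rightarrow> 'w::ab_group_add \<Rightarrow> 'w) \<Rightarrow> (('n \<Rightarrow> 'n) \<Rightarrow> 'w \<Rightarrow> 'w) \<Rightarrow> 'w set \<Rightarrow> bool" where
  "Sn_isomorphic scl act V scl' act' W \<longleftrightarrow>
     Sn_submodule scl act V \<and> Sn_submodule scl' act' W \<and>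
     (\<exists>T. bij_betw T V W \<and>
       (\<forall>u\<in>V. \<forall>v\<in>V. T (u + v) = T u + T v) \<and>
       (\<forall>c. \<forall>v\<in>V. T (scl c v) = scl' c (T v)) \<and>
       (\<forall>g. g permutes UNIV \<longrightarrow> (\<forall>v\<in>V. T (act g v) = act' g (T v))))"


section \<open>The polynomials of lowest degree\<close>

text \<open>
  The integrand is a polynomial in \<open>t\<close> (as \<open>m \<ge> 1\<close>) except that it is totalised to \<open>0\<close> at the
  points \<open>t = x\<^sub>i\<close>; this does not affect the integral along the segment.
\<close>

definition phi :: "nat \<Rightarrow> 'n::{finite,linorder} \<Rightarrow> 'n cvec \<Rightarrow> complex" where
  "phi m j x = 1 / (1 + of_nat CARD('n) * of_nat m) *
     contour_integral (linepath (x $ Min UNIV) (x $ j))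
       (\<lambda>t. (\<Sum>i\<in>UNIV. x $ i / (t - x $ i)) * (\<Prod>k\<in>UNIV. (t - x $ k) ^ m))"

end

theory Submission
  imports Defs "HOL-Computational_Algebra.Polynomial" "HOL-Combinatorics.Permutations"
begin

text \<open>
  The operators \<open>L\<^sub>i\<close> are studied through the Dunkl operators. A polynomial \<open>\<phi>\<close> is not invariant, but
  prescribed on one chamber and extended invariantly to the other chambers it becomes an invariant
  function on a disconnected domain, that is an invariant family of rational functions indexed by
  permutations (\<open>orb\<close>). Dunkl operators act on such families and still commute
  (\<open>dunkl_tup_commute\<close>). Rewriting \<open>\<sigma>\<^sub>i(D)\<close> on invariants as a differential operator proves that the
  Calogero operator exists, applying it to powers of symmetric functions with prescribed
  differential at a point proves that it is unique, and the same rewriting on families shows that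
  \<open>L\<^sub>i \<phi> = 0\<close> holds iff \<open>\<sigma>\<^sub>i(D)\<close> kills the family of \<open>\<phi>\<close> (\<open>calogero_op_apply\<close>, \<open>harmonic_iff\<close>).

  For the degree bound (\<open>degree_bound\<close>) let \<open>\<phi>\<close> be harmonic, homogeneous of degree \<open>d > 0\<close>, with
  family \<open>F\<close>. The ideal of symmetric polynomials without constant term contains \<open>x\<^sub>i\<^sup>n\<close>, so there is a
  largest \<open>k\<close> such that some product \<open>f\<close> of \<open>k\<close> Dunkl operators, applied to \<open>F\<close>, is not zero. All
  Dunkl operators kill \<open>f\<close>, and \<open>\<Sum>\<^sub>i x\<^sub>i D\<^sub>i = E - m \<Sum>\<^sub>i\<^sub><\<^sub>j (1 - s\<^sub>i\<^sub>j)\<close> with the Euler operator \<open>E\<close> shows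
  that \<open>(d - k) / m\<close> is an eigenvalue of the Laplacian \<open>\<Sum>\<^sub>i\<^sub><\<^sub>j (1 - s\<^sub>i\<^sub>j)\<close>. The spectral gap of the
  transpositions is \<open>n\<close> (\<open>spectral_gap\<close>, by a sum of squares). So either \<open>d \<ge> n m + k\<close> with \<open>k \<ge> 1\<close>,
  or \<open>f\<close> is invariant and averaging exhibits it as a symmetric polynomial of Dunkl operators applied
  to \<open>F\<close>, which is zero. In degree \<open>n m + 1\<close> this forces \<open>k = 1\<close>: all products of two Dunkl operators
  kill \<open>F\<close>. This is a holonomic system for the gradient of \<open>\<phi>\<close>, so \<open>\<phi>\<close> is determined by its gradient
  at one regular point (\<open>flat_gradient_inj\<close>), whose coordinate sum is \<open>0\<close>.

  Conversely, integration by parts turns the given integrals into multiples of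
  \<open>\<integral> \<Prod>\<^sub>k (t - x\<^sub>k)\<^sup>m dt\<close> from \<open>x\<^sub>1\<close> to \<open>x\<^sub>j\<close> (\<open>phi_eq_phi_poly\<close>), and differentiating under the integral
  shows that these solve the system (\<open>phi_poly_flat\<close>). They are linearly independent, since all but
  one vanish at each unit vector. Combinations with coefficient sum \<open>0\<close> give an equivariant
  isomorphism from the reflection representation (\<open>psi_equivariant\<close>, \<open>harmonic_polys_deg_eq\<close>), from
  which the remaining claims follow.
\<close>

section \<open>Exponents and monomials in commuting operators\<close>

abbreviation tr :: "'n \<Rightarrow> 'n \<Rightarrow> 'n \<Rightarrow> 'n" where
  "tr \<equiv> Transposition.transpose"

definition unit_exp :: "'n \<Rightarrow> ('n \<Rightarrow>\<^sub>0 nat)" where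
  "unit_exp i = Poly_Mapping.single i 1"

lemma lookup_unit_exp: "lookup (unit_exp i) j = (if j = i then 1 else 0)"
  by (simp add: unit_exp_def lookup_single when_def)

lemma mdeg_zero [simp]: "mdeg (0 :: 'n::finite \<Rightarrow>\<^sub>0 nat) = 0"
  by (simp add: mdeg_def)

lemma mdeg_add: "mdeg (\<alpha> + \<beta>) = mdeg \<alpha> + mdeg (\<beta> :: 'n::finite \<Rightarrow>\<^sub>0 nat)"
  by (simp add: mdeg_def lookup_add sum.distrib)

lemma mdeg_unit_exp [simp]: "mdeg (unit_exp (i :: 'n::finite)) = 1"
  by (simp add: mdeg_def lookup_unit_exp)

lemma mdeg_eq_0_iff: "mdeg \<alpha> = 0 \<longleftrightarrow> \<alpha> = (0 :: 'n::finite \<Rightarrow>\<^sub>0 nat)"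
  by (auto simp: mdeg_def intro!: poly_mapping_eqI)

lemma unit_exp_add_neq_0 [simp]: "unit_exp i + \<alpha> \<noteq> (0 :: 'n::finite \<Rightarrow>\<^sub>0 nat)"
  using mdeg_eq_0_iff[of "unit_exp i + \<alpha>"] by (simp add: mdeg_add)

lemma lookup_le_mdeg: "lookup \<alpha> i \<le> mdeg (\<alpha> :: 'n::finite \<Rightarrow>\<^sub>0 nat)"
  unfolding mdeg_def by (rule member_le_sum) auto

lemma split_unit_exp:
  assumes "lookup \<alpha> i > 0"
  shows "\<alpha> = unit_exp i + (\<alpha> - unit_exp i)"
  using assms by (intro poly_mapping_eqI) (auto simp: lookup_add lookup_minus lookup_unit_exp)

lemma exp_induct [case_names zero add]:
  fixes \<alpha> :: "'n::finite \<Rightarrow>\<^sub>0 nat"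
  assumes "P 0" "\<And>i \<alpha>. P \<alpha> \<Longrightarrow> P (unit_exp i + \<alpha>)"
  shows "P \<alpha>"
proof (induction "mdeg \<alpha>" arbitrary: \<alpha>)
  case 0
  then show ?case using assms(1) mdeg_eq_0_iff by metis
next
  case (Suc d)
  then have "\<exists>i. lookup \<alpha> i > 0"
    by (metis Suc_neq_Zero gr0I mdeg_def sum.neutral)
  then obtain i where "lookup \<alpha> i > 0" ..
  from split_unit_exp[OF this] obtain \<beta> where \<beta>: "\<alpha> = unit_exp i + \<beta>" by blast
  with Suc(2) have "d = mdeg \<beta>" by (simp add: mdeg_add)
  from assms(2)[OF Suc(1)[OF this]] show ?case using \<beta> by simp
qed

lemma finite_mdeg_le: "finite {\<alpha> :: 'n::finite \<Rightarrow>\<^sub>0 nat. mdeg \<alpha> \<le> k}"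
proof (rule finite_imageD)
  have "lookup ` {\<alpha> :: 'n \<Rightarrow>\<^sub>0 nat. mdeg \<alpha> \<le> k} \<subseteq> (UNIV \<rightarrow>\<^sub>E {..k})"
    by (auto simp: PiE_def intro: le_trans[OF lookup_le_mdeg])
  then show "finite (lookup ` {\<alpha> :: 'n \<Rightarrow>\<^sub>0 nat. mdeg \<alpha> \<le> k})"
    by (rule finite_subset) (auto intro: finite_PiE)
  show "inj_on lookup {\<alpha> :: 'n \<Rightarrow>\<^sub>0 nat. mdeg \<alpha> \<le> k}"
    by (rule inj_onI) (simp add: poly_mapping_eqI)
qed

definition perm_exp :: "('n::finite \<Rightarrow> 'n) \<Rightarrow> ('n \<Rightarrow>\<^sub>0 nat) \<Rightarrow> ('n \<Rightarrow>\<^sub>0 nat)" where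
  "perm_exp w \<alpha> = Abs_poly_mapping (\<lambda>i. lookup \<alpha> (inv w i))"

lemma lookup_perm_exp: "lookup (perm_exp w \<alpha>) i = lookup \<alpha> (inv w i)"
  unfolding perm_exp_def by (subst lookup_Abs_poly_mapping) auto

lemma perm_exp_zero [simp]: "perm_exp w 0 = 0"
  by (rule poly_mapping_eqI) (simp add: lookup_perm_exp)

lemma perm_exp_add: "perm_exp w (\<alpha> + \<beta>) = perm_exp w \<alpha> + perm_exp w \<beta>"
  by (rule poly_mapping_eqI) (simp add: lookup_perm_exp lookup_add)

lemma perm_exp_unit: "bij w \<Longrightarrow> perm_exp w (unit_exp i) = unit_exp (w i)"
  by (rule poly_mapping_eqI) (metis lookup_perm_exp lookup_unit_exp bij_inv_eq_iff)

lemma perm_exp_comp: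
  "bij v \<Longrightarrow> bij w \<Longrightarrow> perm_exp v (perm_exp w \<alpha>) = perm_exp (v \<circ> w) \<alpha>"
  by (rule poly_mapping_eqI) (auto simp: lookup_perm_exp o_inv_distrib)

lemma perm_exp_id [simp]: "perm_exp id \<alpha> = \<alpha>"
  by (rule poly_mapping_eqI) (auto simp: lookup_perm_exp inv_id)

lemma perm_exp_inv:
  assumes "bij w"
  shows "perm_exp w (perm_exp (inv w) \<alpha>) = \<alpha>" "perm_exp (inv w) (perm_exp w \<alpha>) = \<alpha>"
  using assms by (simp_all add: perm_exp_comp bij_imp_bij_inv bij_is_inj surj_iff[THEN iffD1] bij_is_surj)

lemma mdeg_perm_exp: "bij w \<Longrightarrow> mdeg (perm_exp w \<alpha>) = mdeg \<alpha>"
  unfolding mdeg_def lookup_perm_exp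
  by (rule sum.reindex_bij_betw[of "inv w" UNIV UNIV "lookup \<alpha>"]) (simp add: bij_imp_bij_inv)

lemma op_monom_zero [simp]: "op_monom A 0 = id"
proof -
  have "foldr (\<lambda>i F. (A i ^^ lookup 0 i) \<circ> F) xs id = id" for xs
    by (induction xs) auto
  then show ?thesis by (simp add: op_monom_def)
qed

lemma op_monom_unit:
  assumes comm: "\<And>i j u. A i (A j u) = A j (A i u)"
  shows "op_monom A (unit_exp i + \<alpha>) u = A i (op_monom A \<alpha> u)"
proof -
  let ?f = "\<lambda>\<alpha> xs. foldr (\<lambda>i F. (A i ^^ lookup \<alpha> i) \<circ> F) xs id"
  have pow: "(A j ^^ k) (A i u) = A i ((A j ^^ k) u)" for j k u
    by (induction k) (auto simp: comm[of j i])
  have 1: "?f (unit_exp i + \<alpha>) xs = ?f \<alpha> xs" if "i \<notin> set xs" for xs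
    using that by (induction xs) (auto simp: lookup_add lookup_unit_exp)
  have 2: "?f (unit_exp i + \<alpha>) xs u = A i (?f \<alpha> xs u)" if "i \<in> set xs" "distinct xs" for xs
    using that
  proof (induction xs)
    case (Cons x xs)
    show ?case
    proof (cases "x = i")
      case True
      moreover have "lookup (unit_exp i + \<alpha>) i = Suc (lookup \<alpha> i)"
        by (simp add: lookup_add lookup_unit_exp)
      ultimately show ?thesis using Cons.prems 1[of xs] by (simp add: comp_def id_def)
    next
      case False
      with Cons show ?thesis by (simp add: lookup_add lookup_unit_exp pow)
    qed
  qed simp
  show ?thesis unfolding op_monom_def by (rule 2) auto
qed

lemma op_monom_add:
  fixes \<alpha> :: "'n::{finite,linorder} \<Rightarrow>\<^sub>0 nat"
  assumes comm: "\<And>i j u. A i (A j u) = A j (A i u)"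
  shows "op_monom A (\<alpha> + \<beta>) u = op_monom A \<alpha> (op_monom A \<beta> u)"
  by (induction \<alpha> rule: exp_induct) (auto simp: add.assoc op_monom_unit[of A, OF comm])

text \<open>
  This compares operators on functions, whose values off the regular set are arbitrary, with
  operators on rings of regular functions.
\<close>

lemma op_monom_rel:
  assumes "\<And>i u u'. R u u' \<Longrightarrow> R (A i u) (A' i u')" and "R u u'"
  shows "R (op_monom A \<alpha> u) (op_monom A' \<alpha> u')"
proof -
  have pow: "R ((A i ^^ k) u) ((A' i ^^ k) u')" if "R u u'" for i k u u'
    using that by (induction k) (auto intro: assms(1))
  have "R (foldr (\<lambda>i F. (A i ^^ lookup \<alpha> i) \<circ> F) xs id u) (foldr (\<lambda>i F. (A' i ^^ lookup \<alpha> i) \<circ> F) xs id u')" for xs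
    by (induction xs) (auto intro: pow assms(2))
  then show ?thesis by (simp add: op_monom_def)
qed

section \<open>Polynomials\<close>

abbreviation mconst :: "complex \<Rightarrow> 'n mpoly" where
  "mconst c \<equiv> Poly_Mapping.single 0 c"

abbreviation mvar :: "'n \<Rightarrow> 'n mpoly" where
  "mvar i \<equiv> Poly_Mapping.single (unit_exp i) 1"

lemma mpoly_sum_singles: "p = (\<Sum>\<alpha>\<in>keys p. Poly_Mapping.single \<alpha> (lookup p \<alpha>))"
proof (rule poly_mapping_eqI)
  fix \<beta>
  show "lookup p \<beta> = lookup (\<Sum>\<alpha>\<in>keys p. Poly_Mapping.single \<alpha> (lookup p \<alpha>)) \<beta>"
    by (auto simp: lookup_sum lookup_single when_def in_keys_iff)
qed

lemma mpoly_induct_single [case_names single add]: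
  assumes single: "\<And>\<alpha> c. P (Poly_Mapping.single \<alpha> c)"
    and add: "\<And>p q. P p \<Longrightarrow> P q \<Longrightarrow> P (p + q)"
  shows "P (p :: 'n mpoly)"
proof -
  have "P (\<Sum>\<alpha>\<in>A. Poly_Mapping.single \<alpha> (f \<alpha>))" if "finite A" for A and f :: "('n \<Rightarrow>\<^sub>0 nat) \<Rightarrow> complex"
    using that by (induction A) (use single[of 0 0] in \<open>auto intro: single add\<close>)
  then show ?thesis using mpoly_sum_singles[of p] by (metis finite_keys)
qed

text \<open>
  The same evaluation gives the value of a polynomial at a point, the polynomial as a rational
  function, and the substitution of the generators \<open>\<sigma>\<^sub>i\<close> into a polynomial.
\<close>

definition mono_at :: "('n::finite \<Rightarrow> 'b::comm_ring_1) \<Rightarrow> ('n \<Rightarrow>\<^sub>0 nat) \<Rightarrow> 'b" where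
  "mono_at X \<alpha> = (\<Prod>i\<in>UNIV. X i ^ lookup \<alpha> i)"

lemma mono_at_zero [simp]: "mono_at X 0 = 1"
  by (simp add: mono_at_def)

lemma mono_at_add: "mono_at X (\<alpha> + \<beta>) = mono_at X \<alpha> * mono_at X \<beta>"
  by (simp add: mono_at_def lookup_add power_add prod.distrib)

lemma mono_at_unit [simp]: "mono_at X (unit_exp i) = X i"
proof -
  have "mono_at X (unit_exp i) = (\<Prod>j\<in>UNIV. if j = i then X i else 1)"
    unfolding mono_at_def by (rule prod.cong) (auto simp: lookup_unit_exp)
  then show ?thesis by simp
qed

locale ring_eval =
  fixes K :: "complex \<Rightarrow> 'b::comm_ring_1" and X :: "'n::finite \<Rightarrow> 'b"
  assumes K_add: "K (a + b) = K a + K b" and K_mult: "K (a * b) = K a * K b" and K_1: "K 1 = 1"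
begin

definition mev :: "'n mpoly \<Rightarrow> 'b" where
  "mev p = (\<Sum>\<alpha>\<in>keys p. K (lookup p \<alpha>) * mono_at X \<alpha>)"

lemma K_0: "K 0 = 0"
  using K_add[of 0 0] by simp

lemma mev_add: "mev (p + q) = mev p + mev q"
  unfolding mev_def
  by (rule setsum_keys_plus_distrib) (simp_all add: K_0 K_add algebra_simps)

lemma mev_single: "mev (Poly_Mapping.single \<alpha> c) = K c * mono_at X \<alpha>"
  by (simp add: mev_def K_0)

lemma mev_zero: "mev 0 = 0"
  by (simp add: mev_def)

lemma mev_const: "mev (mconst c) = K c"
  by (simp add: mev_single)

lemma mev_var: "mev (mvar i) = X i"
  by (simp add: mev_single K_1)

lemma mev_mult: "mev (p * q) = mev p * mev q"
proof (induction p rule: mpoly_induct_single)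
  case (single \<alpha> c)
  show ?case
    by (induction q rule: mpoly_induct_single)
      (simp_all add: mult_single mev_single mev_add mono_at_add K_mult algebra_simps)
next
  case (add p q)
  then show ?case by (simp add: distrib_right mev_add)
qed

lemma mev_one: "mev 1 = 1"
  using mev_const[of 1] by (simp add: K_1)

lemma mev_uminus: "mev (- p) = - mev p"
  using mev_add[of p "- p"] by (simp add: mev_zero eq_neg_iff_add_eq_0 add.commute)

lemma mev_diff: "mev (p - q) = mev p - mev q"
  using mev_add[of p "- q"] by (simp add: mev_uminus)

lemma mev_sum: "mev (sum f A) = (\<Sum>a\<in>A. mev (f a))"
  by (induction A rule: infinite_finite_induct) (auto simp: mev_add mev_zero)

lemma mev_prod: "mev (prod f A) = (\<Prod>a\<in>A. mev (f a))"
  by (induction A rule: infinite_finite_induct) (auto simp: mev_mult mev_one)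

lemma mev_power: "mev (p ^ k) = mev p ^ k"
  by (induction k) (auto simp: mev_mult mev_one)

end

interpretation pev: ring_eval "\<lambda>c. c" "\<lambda>i. x $ i"
  rewrites "ring_eval.mev (\<lambda>c. c) (\<lambda>i. x $ i) p = peval p x"
  for x :: "'n::finite cvec"
proof -
  show i: "ring_eval (\<lambda>c::complex. c)" by unfold_locales auto
  show "ring_eval.mev (\<lambda>c. c) (\<lambda>i. x $ i) p = peval p x"
    by (simp add: ring_eval.mev_def[OF i] peval_def mono_at_def)
qed

text \<open>The map on exponents picks the coefficient of \<open>x\<^sub>i x\<^sup>\<beta>\<close>, whose \<open>i\<close>-th derivative is a multiple of \<open>x\<^sup>\<beta>\<close>.\<close>

definition mpartial :: "'n \<Rightarrow> 'n mpoly \<Rightarrow> 'n mpoly" where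
  "mpartial i p = Poly_Mapping.mapp (\<lambda>\<beta> c. of_nat (Suc (lookup \<beta> i)) * c)
     (Poly_Mapping.map_key (\<lambda>\<beta>. unit_exp i + \<beta>) p)"

lemma lookup_mpartial:
  "lookup (mpartial i p) \<beta> = of_nat (Suc (lookup \<beta> i)) * lookup p (unit_exp i + \<beta>)"
proof -
  have "lookup (Poly_Mapping.map_key (\<lambda>\<beta>. unit_exp i + \<beta>) p) \<beta> = lookup p (unit_exp i + \<beta>)" for \<beta>
    by (subst map_key.rep_eq) (auto simp: inj_def)
  then show ?thesis
    by (simp add: mpartial_def lookup_mapp when_def in_keys_iff)
qed

lemma mpartial_add: "mpartial i (p + q) = mpartial i p + mpartial i q"
  by (rule poly_mapping_eqI) (simp add: lookup_mpartial lookup_add algebra_simps)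

lemma mpartial_single:
  "mpartial i (Poly_Mapping.single \<alpha> c) = Poly_Mapping.single (\<alpha> - unit_exp i) (of_nat (lookup \<alpha> i) * c)"
proof (rule poly_mapping_eqI)
  fix \<beta>
  show "lookup (mpartial i (Poly_Mapping.single \<alpha> c)) \<beta>
    = lookup (Poly_Mapping.single (\<alpha> - unit_exp i) (of_nat (lookup \<alpha> i) * c)) \<beta>"
  proof (cases "lookup \<alpha> i = 0")
    case True
    then have "\<alpha> \<noteq> unit_exp i + \<beta>" by (auto simp: lookup_add lookup_unit_exp)
    with True show ?thesis by (simp add: lookup_mpartial lookup_single_not_eq)
  next
    case False
    then have "\<alpha> = unit_exp i + (\<alpha> - unit_exp i)" by (intro split_unit_exp) auto
    then obtain \<gamma> where "\<alpha> = unit_exp i + \<gamma>" by blast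
    then show ?thesis
      by (auto simp: lookup_mpartial lookup_single when_def lookup_add lookup_unit_exp)
  qed
qed

lemma mpartial_all_zero_imp_const:
  fixes p :: "'n::finite mpoly"
  assumes "\<And>i. mpartial i p = 0"
  shows "p = mconst (lookup p 0)"
proof (rule poly_mapping_eqI)
  fix \<beta>
  have z: "lookup p (unit_exp i + \<beta>) = 0" for i \<beta>
    using lookup_mpartial[of i p \<beta>] assms[of i] by (simp del: of_nat_Suc)
  show "lookup p \<beta> = lookup (mconst (lookup p 0)) \<beta>"
    by (induction \<beta> rule: exp_induct) (auto simp: z lookup_single when_def)
qed

text \<open>
  A set of polynomials that is closed under partial derivatives and vanishes at one point contains
  only \<open>0\<close>: a polynomial of least degree in it would have zero derivatives, hence be constant.
  This serves both as the identity theorem and as Taylor's theorem for polynomials.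
\<close>

lemma zero_if_derivatives_vanish:
  fixes p :: "'n::finite mpoly"
  assumes "p \<in> M" and partial: "\<And>p i. p \<in> M \<Longrightarrow> mpartial i p \<in> M"
    and zero: "\<And>p. p \<in> M \<Longrightarrow> peval p x = 0"
  shows "p = 0"
proof -
  have "\<forall>p\<in>M. (\<forall>\<alpha>\<in>keys p. mdeg \<alpha> < d) \<longrightarrow> p = 0" for d
  proof (induction d)
    case 0
    then show ?case using keys_eq_empty by (metis all_not_in_conv not_less0 poly_mapping_eqI in_keys_iff lookup_zero)
  next
    case (Suc d)
    show ?case
    proof safe
      fix p assume p: "p \<in> M" "\<forall>\<alpha>\<in>keys p. mdeg \<alpha> < Suc d"
      have "mpartial i p = 0" for i
      proof -
        have "\<forall>\<alpha>\<in>keys (mpartial i p). mdeg \<alpha> < d"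
          using p(2) by (force simp: in_keys_iff lookup_mpartial mdeg_add simp del: of_nat_Suc)
        with Suc partial[OF p(1)] show ?thesis by blast
      qed
      then have "p = mconst (lookup p 0)" by (rule mpartial_all_zero_imp_const)
      with zero[OF p(1)] show "p = 0" by (metis pev.mev_const single_zero)
    qed
  qed
  moreover have "\<forall>\<alpha>\<in>keys p. mdeg \<alpha> < Suc (Max (mdeg ` keys p))"
    by (simp add: le_imp_less_Suc)
  ultimately show ?thesis using assms(1) by blast
qed

section \<open>The ring of rational functions regular off the reflection hyperplanes\<close>

lemma open_reg_set: "open (reg_set :: 'n::finite cvec set)"
proof -
  have "reg_set = (\<Inter>j. \<Inter>k. {x :: 'n cvec. j \<noteq> k \<longrightarrow> x $ j \<noteq> x $ k})"
    by (auto simp: reg_set_def)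
  moreover have "open {x :: 'n cvec. j \<noteq> k \<longrightarrow> x $ j \<noteq> x $ k}" for j k
    by (cases "j = k") (auto intro!: open_Collect_neq continuous_intros)
  ultimately show ?thesis by (metis (no_types, lifting) open_INT finite_class.finite_UNIV)
qed

lemma ex_reg_set: "\<exists>x. x \<in> (reg_set :: 'n::finite cvec set)"
proof -
  obtain f :: "'n \<Rightarrow> nat" where "inj f"
    using finite_imp_inj_to_nat_seg[of "UNIV :: 'n set"] by auto
  then have "(\<chi> i. of_nat (f i)) \<in> reg_set"
    by (auto simp: reg_set_def inj_def)
  then show ?thesis ..
qed

lemma reg_set_line:
  assumes "x \<in> reg_set"
  shows "\<forall>\<^sub>F t in nhds 0. x + t *s \<xi> \<in> (reg_set :: 'n::finite cvec set)"
proof -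
  have c: "continuous_on UNIV (\<lambda>t. x + t *s \<xi>)"
    by (auto simp: vec_eq_iff intro!: continuous_on_vec_lambda continuous_intros
        simp: vector_scalar_mult_def plus_vec_def)
  have "open ((\<lambda>t. x + t *s \<xi>) -` reg_set)"
    by (rule open_vimage[OF open_reg_set c])
  with assms show ?thesis
    by (simp add: eventually_nhds) (rule exI[of _ "(\<lambda>t. x + t *s \<xi>) -` reg_set"], auto)
qed

lemma perm_reg_set:
  assumes "bij w" shows "(\<chi> i. x $ w i) \<in> reg_set \<longleftrightarrow> x \<in> (reg_set :: 'n::finite cvec set)"
proof
  assume "(\<chi> i. x $ w i) \<in> reg_set"
  then have "j \<noteq> k \<Longrightarrow> x $ w j \<noteq> x $ w k" for j k by (auto simp: reg_set_def)
  from this[of "inv w _" "inv w _"] show "x \<in> reg_set" using assms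
    by (auto simp: reg_set_def bij_is_surj surj_f_inv_f) (metis assms bij_inv_eq_iff)
qed (use assms in \<open>auto simp: reg_set_def bij_def inj_eq\<close>)

text \<open>
  Generators and operations describe \<open>\<complex>[V\<^sub>r\<^sub>e\<^sub>g]\<close> in a form suited to induction: two derivations, or
  two automorphisms, that agree on the generators are equal. The functions are extended by \<open>0\<close>, so
  that equality means equality on the regular set.
\<close>

inductive_set RF :: "('n::{finite,linorder} cvec \<Rightarrow> complex) set" where
  const: "(\<lambda>x. if x \<in> reg_set then c else 0) \<in> RF"
| coord: "(\<lambda>x. if x \<in> reg_set then x $ i else 0) \<in> RF"
| recip: "(\<lambda>x. if x \<in> reg_set then 1 / (x $ j - x $ k) else 0) \<in> RF"
| add: "u \<in> RF \<Longrightarrow> v \<in> RF \<Longrightarrow> (\<lambda>x. u x + v x) \<in> RF"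
| mult: "u \<in> RF \<Longrightarrow> v \<in> RF \<Longrightarrow> (\<lambda>x. u x * v x) \<in> RF"

typedef (overloaded) 'n rfun = "RF :: ('n::{finite,linorder} cvec \<Rightarrow> complex) set"
  morphisms ev Abs_rfun
  using RF.const by blast

setup_lifting type_definition_rfun

lemma RF_off: "u \<in> RF \<Longrightarrow> x \<notin> reg_set \<Longrightarrow> u x = 0"
  by (induction rule: RF.induct) auto

lemma ev_off [simp]: "x \<notin> reg_set \<Longrightarrow> ev u x = 0"
  using RF_off ev by blast

lemma rfun_eqI: "(\<And>x. x \<in> reg_set \<Longrightarrow> ev u x = ev v x) \<Longrightarrow> u = v"
  by (metis ev_inject ev_off ext)

instantiation rfun :: ("{finite,linorder}") comm_ring_1
begin

lift_definition zero_rfun :: "'a rfun" is "\<lambda>x. 0"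
  using RF.const[of 0] by simp
lift_definition one_rfun :: "'a rfun" is "\<lambda>x. if x \<in> reg_set then 1 else 0"
  by (rule RF.const)
lift_definition plus_rfun :: "'a rfun \<Rightarrow> 'a rfun \<Rightarrow> 'a rfun" is "\<lambda>u v x. u x + v x"
  by (rule RF.add)
lift_definition times_rfun :: "'a rfun \<Rightarrow> 'a rfun \<Rightarrow> 'a rfun" is "\<lambda>u v x. u x * v x"
  by (rule RF.mult)
lift_definition uminus_rfun :: "'a rfun \<Rightarrow> 'a rfun" is "\<lambda>u x. - u x"
proof -
  fix u :: "'a cvec \<Rightarrow> complex" assume u: "u \<in> RF"
  have "(\<lambda>x. - u x) = (\<lambda>x. (if x \<in> reg_set then -1 else 0) * u x)"
    using RF_off[OF u] by auto
  then show "(\<lambda>x. - u x) \<in> RF" using RF.mult[OF RF.const u] by simp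
qed
definition minus_rfun :: "'a rfun \<Rightarrow> 'a rfun \<Rightarrow> 'a rfun" where
  "minus_rfun u v = u + - v"

instance
proof
  fix u v w :: "'a rfun"
  show "(0 :: 'a rfun) \<noteq> 1"
  proof
    assume "(0 :: 'a rfun) = 1"
    then have "ev (0 :: 'a rfun) x = ev 1 x" for x by simp
    then show False
      using ex_reg_set[where 'n = 'a] unfolding zero_rfun.rep_eq one_rfun.rep_eq
      by (metis zero_neq_one)
  qed
qed (rule rfun_eqI, simp add: minus_rfun_def zero_rfun.rep_eq one_rfun.rep_eq plus_rfun.rep_eq
      times_rfun.rep_eq uminus_rfun.rep_eq algebra_simps)+

end

lift_definition rconst :: "complex \<Rightarrow> 'n::{finite,linorder} rfun"
  is "\<lambda>c x. if x \<in> reg_set then c else 0" by (rule RF.const)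
lift_definition rvar :: "'n \<Rightarrow> 'n::{finite,linorder} rfun"
  is "\<lambda>i x. if x \<in> reg_set then x $ i else 0" by (rule RF.coord)
lift_definition rinv :: "'n \<Rightarrow> 'n \<Rightarrow> 'n::{finite,linorder} rfun"
  is "\<lambda>j k x. if x \<in> reg_set then 1 / (x $ j - x $ k) else 0" by (rule RF.recip)

lemma ev_plus [simp]: "ev (u + v) x = ev u x + ev v x" by transfer simp
lemma ev_times [simp]: "ev (u * v) x = ev u x * ev v x" by transfer simp
lemma ev_zero [simp]: "ev 0 x = 0" by transfer simp
lemma ev_uminus [simp]: "ev (- u) x = - ev u x" by transfer simp
lemma ev_minus [simp]: "ev (u - v) x = ev u x - ev v x"
  by (simp only: minus_rfun_def ev_plus ev_uminus) simp
lemma ev_one [simp]: "x \<in> reg_set \<Longrightarrow> ev 1 x = 1" by transfer simp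
lemma ev_rconst [simp]: "x \<in> reg_set \<Longrightarrow> ev (rconst c) x = c" by transfer simp
lemma ev_rvar [simp]: "x \<in> reg_set \<Longrightarrow> ev (rvar i) x = x $ i" by transfer simp
lemma ev_rinv [simp]: "x \<in> reg_set \<Longrightarrow> ev (rinv j k) x = 1 / (x $ j - x $ k)" by transfer simp
lemma ev_sum [simp]: "ev (sum f A) x = (\<Sum>a\<in>A. ev (f a) x)"
  by (induction A rule: infinite_finite_induct) auto
lemma ev_prod [simp]: "x \<in> reg_set \<Longrightarrow> ev (prod f A) x = (\<Prod>a\<in>A. ev (f a) x)"
  by (induction A rule: infinite_finite_induct) auto
lemma ev_power [simp]: "x \<in> reg_set \<Longrightarrow> ev (u ^ k) x = ev u x ^ k"
  by (induction k) auto
lemma ev_of_nat [simp]: "x \<in> reg_set \<Longrightarrow> ev (of_nat k) x = of_nat k"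
  by (induction k) auto

lemma rfun_induct [case_names const var inv add mult]:
  assumes "\<And>c. P (rconst c)" "\<And>i. P (rvar i)" "\<And>j k. P (rinv j k)"
    and "\<And>u v. P u \<Longrightarrow> P v \<Longrightarrow> P (u + v)" "\<And>u v. P u \<Longrightarrow> P v \<Longrightarrow> P (u * v)"
  shows "P (u :: 'n::{finite,linorder} rfun)"
proof -
  have "P u" if "f \<in> RF" "ev u = f" for f u
    using that
  proof (induction arbitrary: u rule: RF.induct)
    case (const c)
    then have "u = rconst c" by (intro rfun_eqI) simp
    then show ?case using assms(1) by simp
  next
    case (coord i)
    then have "u = rvar i" by (intro rfun_eqI) simp
    then show ?case using assms(2) by simp
  next
    case (recip j k)
    then have "u = rinv j k" by (intro rfun_eqI) simp
    then show ?case using assms(3) by simp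
  next
    case (add f g)
    then have "u = Abs_rfun f + Abs_rfun g"
      by (intro rfun_eqI) (simp add: Abs_rfun_inverse)
    then show ?case
      using assms(4)[OF add.IH(1)[OF Abs_rfun_inverse[OF add.hyps(1)]] add.IH(2)[OF Abs_rfun_inverse[OF add.hyps(2)]]]
      by simp
  next
    case (mult f g)
    then have "u = Abs_rfun f * Abs_rfun g"
      by (intro rfun_eqI) (simp add: Abs_rfun_inverse)
    then show ?case
      using assms(5)[OF mult.IH(1)[OF Abs_rfun_inverse[OF mult.hyps(1)]] mult.IH(2)[OF Abs_rfun_inverse[OF mult.hyps(2)]]]
      by simp
  qed
  from this[OF ev refl] show ?thesis .
qed

lemma rconst_add: "rconst (a + b) = rconst a + rconst b" by (rule rfun_eqI) simp
lemma rconst_mult: "rconst (a * b) = rconst a * rconst b" by (rule rfun_eqI) simp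
lemma rconst_one [simp]: "rconst 1 = 1" by (rule rfun_eqI) simp
lemma rconst_zero [simp]: "rconst 0 = 0" by (rule rfun_eqI) simp
lemma rconst_of_nat: "rconst (of_nat k) = of_nat k" by (rule rfun_eqI) simp
lemma rinv_same [simp]: "rinv j j = 0" by (rule rfun_eqI) simp
lemma rinv_swap: "rinv k j = - rinv j k"
proof (rule rfun_eqI)
  fix x :: "'a cvec" assume x: "x \<in> reg_set"
  have "x $ k - x $ j = - (x $ j - x $ k)" by simp
  then have "1 / (x $ k - x $ j) = - (1 / (x $ j - x $ k))" by (simp only: minus_divide_right)
  with x show "ev (rinv k j) x = ev (- rinv j k) x" by simp
qed

lemma rinv_cancel:
  assumes "j \<noteq> k" shows "rinv j k * (rvar j - rvar k) = 1"
proof (rule rfun_eqI)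
  fix x :: "'a cvec" assume x: "x \<in> reg_set"
  then have "x $ j \<noteq> x $ k" using assms unfolding reg_set_def by blast
  with x show "ev (rinv j k * (rvar j - rvar k)) x = ev 1 x" by simp
qed

lemma rinv_triangle:
  assumes "i \<noteq> j" "j \<noteq> k" "i \<noteq> k"
  shows "rinv i j * rinv j k = rinv i k * (rinv i j + rinv j k)"
proof -
  have "rinv i j * rinv j k = (rinv i k * (rvar i - rvar k)) * (rinv i j * rinv j k)"
    using rinv_cancel[OF assms(3)] by simp
  also have "\<dots> = rinv i k * (rinv j k * (rinv i j * (rvar i - rvar j)) + rinv i j * (rinv j k * (rvar j - rvar k)))"
    by (simp add: algebra_simps)
  finally show ?thesis
    by (simp only: rinv_cancel[OF assms(1)] rinv_cancel[OF assms(2)]) (simp add: algebra_simps)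
qed

interpretation rev: ring_eval rconst rvar
  by unfold_locales (simp_all add: rconst_add rconst_mult)

abbreviation rpoly :: "'n::{finite,linorder} mpoly \<Rightarrow> 'n rfun" where
  "rpoly \<equiv> rev.mev"

lemma ev_rpoly: "x \<in> reg_set \<Longrightarrow> ev (rpoly p) x = peval p x"
  by (simp add: rev.mev_def peval_def mono_at_def)

subsection \<open>Partial derivatives\<close>

lemma RF_has_derivative:
  assumes "u \<in> RF"
  shows "\<exists>v\<in>RF. \<forall>x\<in>reg_set. ((\<lambda>t. u (x + t *s axis i 1)) has_field_derivative v x) (at 0)"
proof -
  have tr: "((\<lambda>t. (if x + t *s axis i 1 \<in> reg_set then f (x + t *s axis i 1) else 0)) has_field_derivative d) (at 0)"
    if x: "x \<in> reg_set" and d: "((\<lambda>t. f (x + t *s axis i 1)) has_field_derivative d) (at 0)"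
    for f d and x :: "'a cvec"
  proof -
    have "\<forall>\<^sub>F t in nhds 0. (if x + t *s axis i 1 \<in> reg_set then f (x + t *s axis i 1) else 0)
        = f (x + t *s axis i 1)"
      using reg_set_line[OF x, of "axis i 1"] by (rule eventually_mono) simp
    from DERIV_cong_ev[OF refl this refl] show ?thesis using d by simp
  qed
  show ?thesis
    using assms
  proof (induction rule: RF.induct)
    case (const c)
    have "\<forall>x\<in>reg_set. ((\<lambda>t. (if x + t *s axis i 1 \<in> reg_set then c else 0)) has_field_derivative
        (if x \<in> reg_set then 0 else 0)) (at 0)"
      using tr[of _ "\<lambda>x. c" 0] by simp
    then show ?case using RF.const[of 0] by (intro bexI)
  next
    case (coord j)
    have "((\<lambda>t. (x + t *s axis i 1) $ j) has_field_derivative (if j = i then 1 else 0)) (at 0)" for x :: "'a cvec"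
      by (auto intro!: derivative_eq_intros simp: axis_def)
    then have "\<forall>x\<in>reg_set. ((\<lambda>t. (if x + t *s axis i 1 \<in> reg_set then (x + t *s axis i 1) $ j else 0)) has_field_derivative
        (if x \<in> reg_set then (if j = i then 1 else 0) else 0)) (at 0)"
      using tr[of _ "\<lambda>x. x $ j"] by simp
    then show ?case
      by (intro bexI[of _ "\<lambda>x. if x \<in> reg_set then (if j = i then 1 else 0) else 0"] RF.const)
  next
    case (recip j k)
    let ?r = "\<lambda>x. if x \<in> reg_set then 1 / (x $ j - x $ k) else 0"
    let ?c = "\<lambda>x. if x \<in> reg_set then (if k = i then 1 else 0) - (if j = i then 1 else 0) else (0 :: complex)"
    have r: "(\<lambda>x. ?c x * (?r x * ?r x)) \<in> RF"
      by (intro RF.mult RF.recip RF.const)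
    have "((\<lambda>t. 1 / ((x + t *s axis i 1) $ j - (x + t *s axis i 1) $ k)) has_field_derivative ?c x * (?r x * ?r x)) (at 0)"
      if x: "x \<in> reg_set" for x :: "'a cvec"
    proof (cases "j = k")
      case False
      then have "x $ j - x $ k \<noteq> 0" using x by (auto simp: reg_set_def)
      with x False show ?thesis
        by (auto intro!: derivative_eq_intros simp: axis_def divide_simps)
    qed simp
    then have "\<forall>x\<in>reg_set. ((\<lambda>t. ?r (x + t *s axis i 1)) has_field_derivative ?c x * (?r x * ?r x)) (at 0)"
      using tr[of _ "\<lambda>x. 1 / (x $ j - x $ k)"] by simp
    with r show ?case by (intro bexI[of _ "\<lambda>x. ?c x * (?r x * ?r x)"])
  next
    case (add u v)
    then obtain u' v' where "u' \<in> RF" "v' \<in> RF"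
      "\<forall>x\<in>reg_set. ((\<lambda>t. u (x + t *s axis i 1)) has_field_derivative u' x) (at 0)"
      "\<forall>x\<in>reg_set. ((\<lambda>t. v (x + t *s axis i 1)) has_field_derivative v' x) (at 0)" by blast
    then show ?case
      by (intro bexI[of _ "\<lambda>x. u' x + v' x"] RF.add) (auto intro: DERIV_add)
  next
    case (mult u v)
    then obtain u' v' where d: "u' \<in> RF" "v' \<in> RF"
      "\<forall>x\<in>reg_set. ((\<lambda>t. u (x + t *s axis i 1)) has_field_derivative u' x) (at 0)"
      "\<forall>x\<in>reg_set. ((\<lambda>t. v (x + t *s axis i 1)) has_field_derivative v' x) (at 0)" by blast
    have "((\<lambda>t. u (x + t *s axis i 1) * v (x + t *s axis i 1)) has_field_derivative u' x * v x + v' x * u x) (at 0)"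
      if "x \<in> reg_set" for x
      using DERIV_mult[OF d(3)[rule_format, OF that] d(4)[rule_format, OF that]] by simp
    then show ?case using mult.hyps d(1,2)
      by (intro bexI[of _ "\<lambda>x. u' x * v x + v' x * u x"] RF.add RF.mult) auto
  qed
qed

definition pd :: "'n \<Rightarrow> 'n::{finite,linorder} rfun \<Rightarrow> 'n rfun" where
  "pd i u = (SOME v. \<forall>x\<in>reg_set. ((\<lambda>t. ev u (x + t *s axis i 1)) has_field_derivative ev v x) (at 0))"

lemma pd_DERIV:
  assumes "x \<in> reg_set"
  shows "((\<lambda>t. ev u (x + t *s axis i 1)) has_field_derivative ev (pd i u) x) (at 0)"
proof -
  obtain v where "v \<in> RF" "\<forall>x\<in>reg_set. ((\<lambda>t. ev u (x + t *s axis i 1)) has_field_derivative v x) (at 0)"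
    using RF_has_derivative[OF ev] by blast
  then have "\<exists>v. \<forall>x\<in>reg_set. ((\<lambda>t. ev u (x + t *s axis i 1)) has_field_derivative ev v x) (at 0)"
    by (intro exI[of _ "Abs_rfun v"]) (simp add: Abs_rfun_inverse)
  from someI_ex[OF this] assms show ?thesis unfolding pd_def by blast
qed

lemma pd_eqI:
  assumes "\<And>x. x \<in> reg_set \<Longrightarrow> ((\<lambda>t. ev u (x + t *s axis i 1)) has_field_derivative ev v x) (at 0)"
  shows "pd i u = v"
  using assms pd_DERIV DERIV_unique by (intro rfun_eqI) blast

lemma DERIV_line_cong:
  assumes "x \<in> reg_set" "\<And>y. y \<in> reg_set \<Longrightarrow> f y = g y"
    and "((\<lambda>t. g (x + t *s \<xi>)) has_field_derivative d) (at 0)"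
  shows "((\<lambda>t. f (x + t *s \<xi>)) has_field_derivative d) (at 0)"
proof -
  have "\<forall>\<^sub>F t in nhds 0. f (x + t *s \<xi>) = g (x + t *s \<xi>)"
    using reg_set_line[OF assms(1)] by (rule eventually_mono) (rule assms(2))
  from DERIV_cong_ev[OF refl this refl] show ?thesis using assms(3) by simp
qed

text \<open>The regular set is open, so the values of \<open>u\<close> elsewhere do not enter its derivatives.\<close>

lemma dir_deriv_eq_pd:
  assumes "x \<in> reg_set" "\<And>y. y \<in> reg_set \<Longrightarrow> u y = ev r y"
  shows "dir_deriv (axis i 1) u x = ev (pd i r) x"
  unfolding dir_deriv_def
  by (rule DERIV_imp_deriv) (rule DERIV_line_cong[OF assms pd_DERIV[OF assms(1)]])

lemma pd_add: "pd i (u + v) = pd i u + pd i v"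
  by (rule pd_eqI) (simp add: DERIV_add pd_DERIV)

lemma pd_mult: "pd i (u * v) = pd i u * v + u * pd i v"
proof (rule pd_eqI)
  fix x :: "'a cvec" assume "x \<in> reg_set"
  from DERIV_mult[OF pd_DERIV[OF this, of u i] pd_DERIV[OF this, of v i]]
  show "((\<lambda>t. ev (u * v) (x + t *s axis i 1)) has_field_derivative ev (pd i u * v + u * pd i v) x) (at 0)"
    by (simp add: mult.commute)
qed

lemma pd_const [simp]: "pd i (rconst c) = 0"
proof (rule pd_eqI)
  fix x :: "'a cvec" assume "x \<in> reg_set"
  then show "((\<lambda>t. ev (rconst c) (x + t *s axis i 1)) has_field_derivative ev 0 x) (at 0)"
    by (rule DERIV_line_cong[of _ _ "\<lambda>_. c"]) simp_all
qed

lemma pd_var: "pd i (rvar j) = (if i = j then 1 else 0)"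
proof (rule pd_eqI)
  fix x :: "'a cvec" assume x: "x \<in> reg_set"
  then show "((\<lambda>t. ev (rvar j) (x + t *s axis i 1)) has_field_derivative ev (if i = j then 1 else 0) x) (at 0)"
    by (rule DERIV_line_cong[of _ _ "\<lambda>y. y $ j"])
      (use x in \<open>auto intro!: derivative_eq_intros simp: axis_def\<close>)
qed

lemma pd_zero [simp]: "pd i 0 = 0"
  using pd_const[of i 0] by simp

lemma pd_one [simp]: "pd i 1 = 0"
  using pd_const[of i 1] by simp

lemma pd_of_nat [simp]: "pd i (of_nat k) = 0"
  using pd_const[of i "of_nat k"] by (simp add: rconst_of_nat)

lemma pd_uminus: "pd i (- u) = - pd i u"
  using pd_add[of i u "- u"] by (simp add: eq_neg_iff_add_eq_0 add.commute)

lemma pd_diff: "pd i (u - v) = pd i u - pd i v"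
  using pd_add[of i u "- v"] by (simp add: pd_uminus)

lemma pd_sum: "pd i (sum f A) = (\<Sum>a\<in>A. pd i (f a))"
  by (induction A rule: infinite_finite_induct) (auto simp: pd_add)

lemma pd_inv: "pd i (rinv j k) = ((if i = k then 1 else 0) - (if i = j then 1 else 0)) * (rinv j k * rinv j k)"
proof (cases "j = k")
  case False
  note c = rinv_cancel[OF False]
  define e :: "'a rfun" where "e = (if i = j then 1 else 0) - (if i = k then 1 else 0)"
  have "0 = pd i (rinv j k * (rvar j - rvar k))" by (simp add: c)
  also have "\<dots> = pd i (rinv j k) * (rvar j - rvar k) + rinv j k * e"
    by (simp only: pd_mult pd_diff pd_var e_def)
  finally have "pd i (rinv j k) * (rvar j - rvar k) = - (rinv j k * e)"
    by (simp add: eq_neg_iff_add_eq_0)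
  then have "rinv j k * (pd i (rinv j k) * (rvar j - rvar k)) = rinv j k * - (rinv j k * e)"
    by (simp only:)
  moreover have "rinv j k * (pd i (rinv j k) * (rvar j - rvar k)) = pd i (rinv j k) * (rinv j k * (rvar j - rvar k))"
    by (simp only: mult.left_commute)
  ultimately have "pd i (rinv j k) = rinv j k * - (rinv j k * e)" by (simp only: c mult_1_right)
  then show ?thesis by (simp add: e_def algebra_simps)
qed simp

text \<open>Partial derivatives commute because their commutator is a derivation that kills the generators.\<close>

lemma pd_commute: "pd i (pd j u) = pd j (pd i u)"
proof (induction u rule: rfun_induct)
  case (inv k l)
  show ?case
    by (simp add: pd_inv pd_mult pd_add pd_diff pd_uminus algebra_simps)
qed (auto simp: pd_var pd_add pd_mult algebra_simps)

lemma pd_rpoly: "pd i (rpoly p) = rpoly (mpartial i p)"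
proof (induction p rule: mpoly_induct_single)
  case (add p q)
  then show ?case by (simp add: mpartial_add rev.mev_add pd_add)
next
  case (single \<alpha> c)
  have "pd i (mono_at rvar \<alpha>) = of_nat (lookup \<alpha> i) * mono_at rvar (\<alpha> - unit_exp i)"
  proof (induction \<alpha> rule: exp_induct)
    case (add j \<alpha>)
    show ?case
    proof (cases "i = j")
      case True
      have "rvar i * mono_at rvar (\<alpha> - unit_exp i) = mono_at rvar \<alpha>" if "lookup \<alpha> i \<noteq> 0"
        using split_unit_exp[of \<alpha> i] that mono_at_add[of rvar "unit_exp i" "\<alpha> - unit_exp i"] by simp
      then have "of_nat (lookup \<alpha> i) * (rvar i * mono_at rvar (\<alpha> - unit_exp i)) = of_nat (lookup \<alpha> i) * mono_at rvar \<alpha>"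
        by (cases "lookup \<alpha> i = 0") simp_all
      moreover have "unit_exp i + \<alpha> - unit_exp i = \<alpha>" by simp
      ultimately show ?thesis using True add
        by (simp add: mono_at_add pd_mult pd_var lookup_add lookup_unit_exp distrib_right mult.left_commute)
    next
      case False
      then have "unit_exp j + \<alpha> - unit_exp i = unit_exp j + (\<alpha> - unit_exp i)"
        by (intro poly_mapping_eqI) (simp add: lookup_add lookup_minus lookup_unit_exp)
      with False add show ?thesis
        by (simp add: mono_at_add pd_mult pd_var lookup_add lookup_unit_exp mult.left_commute)
    qed
  qed simp
  then show ?case
    by (simp add: mpartial_single rev.mev_single pd_mult rconst_mult rconst_of_nat mult.left_commute mult.assoc)
qed

lemma rpoly_inj: "rpoly p = rpoly q \<Longrightarrow> p = q"
proof -
  assume "rpoly p = rpoly q"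
  obtain x :: "'a cvec" where x: "x \<in> reg_set" using ex_reg_set by blast
  have "p - q = 0"
  proof (rule zero_if_derivatives_vanish[where M = "{p. rpoly p = 0}" and x = x])
    fix p :: "'a mpoly" assume "p \<in> {p. rpoly p = 0}"
    then show "mpartial i p \<in> {p. rpoly p = 0}" for i using pd_rpoly[of i p] by simp
    show "peval p x = 0" using ev_rpoly[OF x, of p] \<open>p \<in> _\<close> by simp
  qed (use \<open>rpoly p = rpoly q\<close> in \<open>simp add: rev.mev_diff\<close>)
  then show "p = q" by simp
qed

lemma peval_eq_on_reg_imp_eq:
  "(\<And>x. x \<in> reg_set \<Longrightarrow> peval p x = peval q x) \<Longrightarrow> p = (q :: 'n::{finite,linorder} mpoly)"
  by (rule rpoly_inj, rule rfun_eqI) (simp add: ev_rpoly)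

lemma peval_inj: "peval p = peval q \<longleftrightarrow> p = (q :: 'n::{finite,linorder} mpoly)"
  using peval_eq_on_reg_imp_eq[of p q] by auto

subsection \<open>The action of the symmetric group\<close>

lemma RF_perm:
  assumes "bij w" "u \<in> RF" shows "(\<lambda>x. u (\<chi> i. x $ w i)) \<in> RF"
  using assms(2)
proof (induction rule: RF.induct)
  case (coord j)
  then show ?case using RF.coord[of "w j"] by (simp add: perm_reg_set[OF assms(1)] cong: if_cong)
next
  case (recip j k)
  then show ?case using RF.recip[of "w j" "w k"] by (simp add: perm_reg_set[OF assms(1)] cong: if_cong)
qed (auto simp: perm_reg_set assms(1) intro: RF.intros)

text \<open>Non-bijective \<open>w\<close> act as the identity, which makes \<open>ract w\<close> a ring homomorphism for every \<open>w\<close>.\<close>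

lift_definition ract :: "('n \<Rightarrow> 'n) \<Rightarrow> 'n::{finite,linorder} rfun \<Rightarrow> 'n rfun"
  is "\<lambda>w u. if bij w then (\<lambda>x. u (\<chi> i. x $ w i)) else u"
  by (simp add: RF_perm)

lemma ev_ract: "bij w \<Longrightarrow> ev (ract w u) x = ev u (\<chi> i. x $ w i)"
  by transfer simp

lemma ract_not_bij: "\<not> bij w \<Longrightarrow> ract w u = u"
  by transfer simp

lemma ract_add: "ract w (u + v) = ract w u + ract w v" by transfer auto
lemma ract_mult: "ract w (u * v) = ract w u * ract w v" by transfer auto
lemma ract_uminus: "ract w (- u) = - ract w u" by transfer auto
lemma ract_diff: "ract w (u - v) = ract w u - ract w v"
  by (simp only: minus_rfun_def ract_add ract_uminus)
lemma ract_zero [simp]: "ract w 0 = 0" by transfer auto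
lemma ract_const [simp]: "ract w (rconst c) = rconst c"
  by (cases "bij w") (auto intro!: rfun_eqI simp: ev_ract ract_not_bij perm_reg_set)
lemma ract_of_nat [simp]: "ract w (of_nat k) = of_nat k"
  by (metis ract_const rconst_of_nat)
lemma ract_one [simp]: "ract w 1 = 1"
  using ract_const[of w 1] by simp
lemma ract_var: "bij w \<Longrightarrow> ract w (rvar i) = rvar (w i)"
  by (rule rfun_eqI) (simp add: ev_ract perm_reg_set)
lemma ract_inv: "bij w \<Longrightarrow> ract w (rinv j k) = rinv (w j) (w k)"
  by (rule rfun_eqI) (simp add: ev_ract perm_reg_set)
lemma ract_comp: "bij v \<Longrightarrow> bij w \<Longrightarrow> ract v (ract w u) = ract (v \<circ> w) u"
  by (rule rfun_eqI) (simp add: ev_ract perm_reg_set bij_comp)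
lemma ract_id [simp]: "ract id u = u"
  by (rule rfun_eqI) (simp add: ev_ract)
lemma ract_sum: "ract w (sum f A) = (\<Sum>a\<in>A. ract w (f a))"
  by (induction A rule: infinite_finite_induct) (auto simp: ract_add)

lemma ract_pd: "bij w \<Longrightarrow> ract w (pd i u) = pd (w i) (ract w u)"
proof (induction u rule: rfun_induct)
  case (var j)
  then have "(i = j) = (w i = w j)" by (auto simp: bij_def inj_eq)
  with var show ?case by (auto simp: pd_var ract_var)
next
  case (inv j k)
  then have "(i = j) = (w i = w j)" "(i = k) = (w i = w k)" by (auto simp: bij_def inj_eq)
  with inv show ?case 
    by (auto simp: pd_inv ract_inv ract_mult ract_uminus)
qed (auto simp: pd_add pd_mult ract_add ract_mult)

subsection \<open>Comparison with regular functions\<close>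

lemma regular_fun_iff: "regular_fun u \<longleftrightarrow> (\<exists>r. \<forall>x\<in>reg_set. u x = ev r x)"
proof
  assume "regular_fun u"
  then obtain q N where *: "\<And>x. x \<in> reg_set \<Longrightarrow>
      u x = peval q x / (\<Prod>(j, k)\<in>{(j, k). j < k}. x $ j - x $ k) ^ N"
    unfolding regular_fun_def by blast
  have "u x = ev (rpoly q * (\<Prod>(j, k)\<in>{(j, k). j < k}. rinv j k) ^ N) x" if "x \<in> reg_set" for x
    using that
    by (simp add: * ev_rpoly case_prod_unfold prod_dividef power_one_over)
  then show "\<exists>r. \<forall>x\<in>reg_set. u x = ev r x" by blast
next
  let ?D = "\<Prod>(j, k)\<in>{(j, k). j < k}. mvar j - mvar k :: 'a mpoly"
  have D: "peval ?D x = (\<Prod>(j, k)\<in>{(j, k). j < k}. x $ j - x $ k)" for x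
    by (simp add: pev.mev_prod case_prod_unfold pev.mev_diff pev.mev_var)
  have D0: "peval ?D x \<noteq> 0" if "x \<in> reg_set" for x
    using that by (auto simp: D reg_set_def)
  have "\<exists>q N. \<forall>x\<in>reg_set. ev r x = peval q x / peval ?D x ^ N" for r
  proof (induction r rule: rfun_induct)
    case (const c)
    show ?case by (rule exI[of _ "mconst c"], rule exI[of _ 0]) (simp add: pev.mev_const)
  next
    case (var i)
    show ?case by (rule exI[of _ "mvar i"], rule exI[of _ 0]) (simp add: pev.mev_var)
  next
    case (inv j k)
    have main: "\<exists>q. \<forall>x\<in>reg_set. ev (rinv j k) x = peval q x / peval ?D x" if "j < k" for j k :: 'a
    proof -
      have "?D = (mvar j - mvar k) * (\<Prod>(j, k)\<in>{(j, k). j < k} - {(j, k)}. mvar j - mvar k)"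
        using that by (subst prod.remove[of _ "(j, k)"]) auto
      then obtain q where q: "?D = (mvar j - mvar k) * q" by blast
      have "ev (rinv j k) x = peval q x / peval ?D x" if x: "x \<in> reg_set" for x
      proof -
        have "peval ?D x = (x $ j - x $ k) * peval q x"
          by (subst q) (simp add: pev.mev_mult pev.mev_diff pev.mev_var)
        with D0[OF x] have "peval q x / peval ?D x = 1 / (x $ j - x $ k)"
          by (metis nonzero_divide_mult_cancel_right mult_eq_0_iff)
        with x show ?thesis by simp
      qed
      then show ?thesis by blast
    qed
    consider "j = k" | "j < k" | "k < j" by fastforce
    then have "\<exists>q. \<forall>x\<in>reg_set. ev (rinv j k) x = peval q x / peval ?D x"
    proof cases
      case 1
      then show ?thesis by (intro exI[of _ 0]) (simp add: pev.mev_zero)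
    next
      case 2
      then show ?thesis by (rule main)
    next
      case 3
      from main[OF 3] obtain q where "\<forall>x\<in>reg_set. ev (rinv k j) x = peval q x / peval ?D x" by blast
      then show ?thesis by (intro exI[of _ "- q"]) (subst rinv_swap, simp add: pev.mev_uminus)
    qed
    then obtain q where "\<forall>x\<in>reg_set. ev (rinv j k) x = peval q x / peval ?D x" by blast
    then show ?case by (intro exI[of _ q] exI[of _ 1]) simp
  next
    case (add u v)
    then obtain q N q' N' where *: "\<forall>x\<in>reg_set. ev u x = peval q x / peval ?D x ^ N"
      "\<forall>x\<in>reg_set. ev v x = peval q' x / peval ?D x ^ N'" by blast
    have frac: "a / d ^ N + b / d ^ N' = (a * d ^ N' + b * d ^ N) / d ^ (N + N')" if "d \<noteq> 0" for a b d :: complex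
      using that by (simp add: power_add divide_simps)
    have "ev (u + v) x = peval (q * ?D ^ N' + q' * ?D ^ N) x / peval ?D x ^ (N + N')" if "x \<in> reg_set" for x
      using that * frac[OF D0[OF that]]
      by (simp only: ev_plus pev.mev_add pev.mev_mult pev.mev_power)
    then show ?case by blast
  next
    case (mult u v)
    then obtain q N q' N' where *: "\<forall>x\<in>reg_set. ev u x = peval q x / peval ?D x ^ N"
      "\<forall>x\<in>reg_set. ev v x = peval q' x / peval ?D x ^ N'" by blast
    have "ev (u * v) x = peval (q * q') x / peval ?D x ^ (N + N')" if "x \<in> reg_set" for x
      using that * D0[OF that]
      by (simp add: pev.mev_mult power_add)
    then show ?case by blast
  qed
  moreover assume "\<exists>r. \<forall>x\<in>reg_set. u x = ev r x"
  ultimately show "regular_fun u" unfolding regular_fun_def D[symmetric] by metis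
qed

section \<open>Dunkl operators on families of functions\<close>

text \<open>
  The entry of a family at \<open>v\<close> stands for a function on the chamber \<open>v U\<close>, for a fixed chamber \<open>U\<close>.
  A reflection moves the chambers as well as the points, so it permutes the entries; a function on
  the whole regular set is a constant family.
\<close>

type_synonym 'n tup = "('n \<Rightarrow> 'n) \<Rightarrow> 'n rfun"

definition cst :: "'n::{finite,linorder} rfun \<Rightarrow> 'n tup" where
  "cst r = (\<lambda>_. r)"

definition pdt :: "'n \<Rightarrow> 'n::{finite,linorder} tup \<Rightarrow> 'n tup" where
  "pdt i F = (\<lambda>v. pd i (F v))"

definition act :: "('n \<Rightarrow> 'n) \<Rightarrow> 'n::{finite,linorder} tup \<Rightarrow> 'n tup" where
  "act w F = (\<lambda>v. ract w (F (inv w \<circ> v)))"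

lemma cst_apply: "cst r v = r" by (simp add: cst_def)

text \<open>
  Identities between families are proved as identities in a commutative ring, so pointwise
  evaluation must not interfere with the simplification of ring expressions.
\<close>

lemmas tup_apply = cst_apply plus_fun_apply times_fun_apply zero_fun_apply one_fun_apply minus_apply uminus_apply
  of_nat_fun_apply

declare plus_fun_apply [simp del] times_fun_apply [simp del] zero_fun_apply [simp del]
  one_fun_apply [simp del] minus_apply [simp del] uminus_apply [simp del] of_nat_fun_apply [simp del]
  numeral_fun_apply [simp del]

lemma cst_add: "cst (r + s) = cst r + cst s" by (simp add: cst_def fun_eq_iff tup_apply)
lemma cst_mult: "cst (r * s) = cst r * cst s" by (simp add: cst_def fun_eq_iff tup_apply)
lemma cst_uminus: "cst (- r) = - cst r" by (simp add: cst_def fun_eq_iff tup_apply)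
lemma cst_diff: "cst (r - s) = cst r - cst s" by (simp add: cst_def fun_eq_iff tup_apply)
lemma cst_zero [simp]: "cst 0 = 0" by (simp add: cst_def fun_eq_iff tup_apply)
lemma cst_one [simp]: "cst 1 = 1" by (simp add: cst_def fun_eq_iff tup_apply)
lemma cst_of_nat [simp]: "cst (of_nat k) = of_nat k" by (simp add: cst_def fun_eq_iff tup_apply)

lemma sum_fun_apply: "(sum f A) v = (\<Sum>a\<in>A. f a v)"
  by (induction A rule: infinite_finite_induct) (auto simp: tup_apply)

lemma pdt_add: "pdt i (F + G) = pdt i F + pdt i G" by (simp add: pdt_def fun_eq_iff tup_apply pd_add)
lemma pdt_mult: "pdt i (F * G) = pdt i F * G + F * pdt i G" by (simp add: pdt_def fun_eq_iff tup_apply pd_mult)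
lemma pdt_uminus: "pdt i (- F) = - pdt i F" by (simp add: pdt_def fun_eq_iff tup_apply pd_uminus)
lemma pdt_diff: "pdt i (F - G) = pdt i F - pdt i G" by (simp add: pdt_def fun_eq_iff tup_apply pd_diff)
lemma pdt_cst: "pdt i (cst r) = cst (pd i r)" by (simp add: pdt_def fun_eq_iff tup_apply)
lemma pdt_zero [simp]: "pdt i 0 = 0" by (simp add: pdt_def fun_eq_iff tup_apply)
lemma pdt_of_nat [simp]: "pdt i (of_nat k) = 0" by (simp add: pdt_def fun_eq_iff tup_apply)
lemma pdt_sum: "pdt i (sum f A) = (\<Sum>a\<in>A. pdt i (f a))"
  by (induction A rule: infinite_finite_induct) (auto simp: pdt_add)
lemma pdt_commute: "pdt i (pdt j F) = pdt j (pdt i F)" by (simp add: pdt_def fun_eq_iff tup_apply pd_commute)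

lemma act_add: "act w (F + G) = act w F + act w G" by (simp add: act_def fun_eq_iff tup_apply ract_add)
lemma act_mult: "act w (F * G) = act w F * act w G" by (simp add: act_def fun_eq_iff tup_apply ract_mult)
lemma act_uminus: "act w (- F) = - act w F" by (simp add: act_def fun_eq_iff tup_apply ract_uminus)
lemma act_diff: "act w (F - G) = act w F - act w G" by (simp add: act_def fun_eq_iff tup_apply ract_diff)
lemma act_cst: "act w (cst r) = cst (ract w r)" by (simp add: act_def fun_eq_iff tup_apply)
lemma act_zero [simp]: "act w 0 = 0" by (simp add: act_def fun_eq_iff tup_apply)
lemma act_of_nat [simp]: "act w (of_nat k) = of_nat k" by (simp add: act_def fun_eq_iff tup_apply)
lemma act_sum: "act w (sum f A) = (\<Sum>a\<in>A. act w (f a))"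
  by (induction A rule: infinite_finite_induct) (auto simp: act_add)
lemma act_comp: "bij v \<Longrightarrow> bij w \<Longrightarrow> act v (act w F) = act (v \<circ> w) F"
  by (simp add: act_def fun_eq_iff tup_apply ract_comp o_inv_distrib comp_assoc)
lemma act_id [simp]: "act id F = F" by (simp add: act_def fun_eq_iff tup_apply inv_id)
lemma act_pdt: "bij w \<Longrightarrow> act w (pdt i F) = pdt (w i) (act w F)"
  by (simp add: act_def pdt_def fun_eq_iff tup_apply ract_pd)

abbreviation scal :: "complex \<Rightarrow> 'n::{finite,linorder} tup" where "scal c \<equiv> cst (rconst c)"
abbreviation xvar :: "'n \<Rightarrow> 'n::{finite,linorder} tup" where "xvar i \<equiv> cst (rvar i)"
abbreviation dinv :: "'n \<Rightarrow> 'n \<Rightarrow> 'n::{finite,linorder} tup" where "dinv i k \<equiv> cst (rinv i k)"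
abbreviation sw :: "'n \<Rightarrow> 'n \<Rightarrow> 'n::{finite,linorder} tup \<Rightarrow> 'n tup" where "sw i k \<equiv> act (tr i k)"

lemma dinv_swap: "dinv k i = - dinv i k"
  using rinv_swap[of k i] by (simp add: cst_uminus)

lemma sw_commute: "sw k i = sw i k"
  by (simp add: transpose_commute)

lemma sw_same [simp]: "sw i i F = F"
  by simp

lemma sw_dinv: "sw i k (dinv j l) = dinv (tr i k j) (tr i k l)"
  by (simp add: act_cst ract_inv)

text \<open>The divided difference \<open>(s\<^sub>i\<^sub>k F - F) / (x\<^sub>i - x\<^sub>k)\<close>, which is \<open>0\<close> for \<open>i = k\<close>.\<close>

definition ddiff :: "'n \<Rightarrow> 'n \<Rightarrow> 'n::{finite,linorder} tup \<Rightarrow> 'n tup" where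
  "ddiff i k F = dinv i k * (sw i k F - F)"

lemma ddiff_same [simp]: "ddiff i i F = 0" by (simp add: ddiff_def)
lemma ddiff_zero [simp]: "ddiff i k 0 = 0" by (simp add: ddiff_def)
lemma ddiff_add: "ddiff i k (F + G) = ddiff i k F + ddiff i k G" by (simp add: ddiff_def act_add algebra_simps)
lemma ddiff_uminus: "ddiff i k (- F) = - ddiff i k F" by (simp add: ddiff_def act_uminus algebra_simps)
lemma ddiff_sum: "ddiff i k (sum f A) = (\<Sum>a\<in>A. ddiff i k (f a))"
  by (induction A rule: infinite_finite_induct) (auto simp: ddiff_add)
lemma ddiff_scal: "ddiff i k (scal c * F) = scal c * ddiff i k F"
  by (simp add: ddiff_def act_mult act_cst algebra_simps)
lemma ddiff_of_nat: "ddiff i k (of_nat c * F) = of_nat c * ddiff i k F"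
  using ddiff_scal[of i k "of_nat c" F] by (simp add: rconst_of_nat)
lemma ddiff_swap: "ddiff k i F = - ddiff i k F"
  by (subst ddiff_def, subst dinv_swap, subst sw_commute) (simp add: ddiff_def)

definition dunkl_tup :: "nat \<Rightarrow> 'n \<Rightarrow> 'n::{finite,linorder} tup \<Rightarrow> 'n tup" where
  "dunkl_tup m i F = pdt i F + of_nat m * (\<Sum>k\<in>UNIV. ddiff i k F)"

lemma dunkl_tup_add: "dunkl_tup m i (F + G) = dunkl_tup m i F + dunkl_tup m i G"
  by (simp add: dunkl_tup_def pdt_add ddiff_add sum.distrib algebra_simps)
lemma dunkl_tup_scal: "dunkl_tup m i (scal c * F) = scal c * dunkl_tup m i F"
  by (simp add: dunkl_tup_def pdt_mult pdt_cst ddiff_scal sum_distrib_left[symmetric] distrib_left mult.left_commute)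
lemma dunkl_tup_zero [simp]: "dunkl_tup m i 0 = 0"
  by (simp add: dunkl_tup_def)

subsection \<open>Commutativity\<close>

text \<open>
  The right-hand side for \<open>k = i\<close> is symmetric in \<open>i\<close> and \<open>j\<close>, so the mixed terms of the commutator
  of two Dunkl operators cancel.
\<close>

lemma pdt_ddiff_commutator:
  assumes "i \<noteq> j"
  shows "pdt i (ddiff j k F) - ddiff j k (pdt i F) =
    (if k = i then dinv i j * dinv i j * (sw i j F - F) + dinv i j * (sw i j (pdt i F) - sw i j (pdt j F)) else 0)"
proof -
  consider "k = i" | "k = j" | "k \<noteq> i" "k \<noteq> j" by blast
  then show ?thesis
  proof cases
    case 1
    have "pdt i (dinv i j) = - (dinv i j * dinv i j)"
      using assms by (simp add: pdt_cst pd_inv cst_mult cst_uminus)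
    moreover have "pdt i (sw j i F) = sw i j (pdt j F)"
      by (simp add: act_pdt sw_commute)
    ultimately show ?thesis
      using 1 by (simp add: ddiff_def pdt_mult pdt_diff pdt_uminus sw_commute[of j i] dinv_swap[of j i] algebra_simps)
  next
    case 2
    then show ?thesis using assms by simp
  next
    case 3
    have "pdt i (dinv j k) = 0"
      using assms 3 by (simp add: pdt_cst pd_inv)
    moreover have "pdt i (sw j k F) = sw j k (pdt i F)"
      using assms 3 by (simp add: act_pdt)
    ultimately show ?thesis
      using 3 by (simp add: ddiff_def pdt_mult pdt_diff)
  qed
qed

lemma triangle_identity:
  fixes a b c :: "'a::comm_ring_1"
  assumes "a * b = c * (a + b)"
  shows "(a * (c * (P - sij) - b * (sjl - F)) - b * (c * (Q - sjl) - a * (sij - F)))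
    + (c * (b * (P - sil) + a * (sij - F)) + a * (b * (Q - sij) - c * (sil - F)))
    + (c * (- a * (Q - sil) - b * (sjl - F)) - b * (a * (P - sjl) - c * (sil - F))) = 0" (is "?L = 0")
proof -
  have "?L = (a * b - c * (a + b)) * (Q - P)" by (simp add: algebra_simps)
  then show ?thesis using assms by simp
qed

lemma ddiff_ddiff: "ddiff i k (ddiff j l F) =
  dinv i k * (sw i k (dinv j l) * (sw i k (sw j l F) - sw i k F) - dinv j l * (sw j l F - F))"
  by (simp add: ddiff_def act_mult act_diff algebra_simps)

text \<open>
  The three reflections in \<open>{i, j, l}\<close> have only two different products of length two; their
  coefficients cancel by
  \<open>1 / ((x\<^sub>i - x\<^sub>j) (x\<^sub>j - x\<^sub>l)) = (1 / (x\<^sub>i - x\<^sub>j) + 1 / (x\<^sub>j - x\<^sub>l)) / (x\<^sub>i - x\<^sub>l)\<close>.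
\<close>

lemma ddiff_triangle:
  fixes F :: "'n::{finite,linorder} tup"
  assumes "i \<noteq> j" "l \<noteq> i" "l \<noteq> j"
  defines "G \<equiv> \<lambda>k l. ddiff i k (ddiff j l F) - ddiff j l (ddiff i k F)"
  shows "G j l + (G l i + G l l) = 0"
proof -
  have tri: "dinv i j * dinv j l = dinv i l * (dinv i j + dinv j l)"
    using rinv_triangle[of i j l] assms by (simp add: cst_mult[symmetric] cst_add[symmetric])
  have P: "sw j l (sw i l F) = sw i j (sw j l F)" "sw i l (sw i j F) = sw i j (sw j l F)"
    and Q: "sw i l (sw j l F) = sw j l (sw i j F)" "sw i j (sw i l F) = sw j l (sw i j F)"
  proof -
    have "tr j l \<circ> tr i l = tr i j \<circ> tr j l" "tr i l \<circ> tr i j = tr i j \<circ> tr j l"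
      "tr i l \<circ> tr j l = tr j l \<circ> tr i j" "tr i j \<circ> tr i l = tr j l \<circ> tr i j"
      using assms(1-3) by (auto simp: fun_eq_iff Transposition.transpose_def)
    then show "sw j l (sw i l F) = sw i j (sw j l F)" "sw i l (sw i j F) = sw i j (sw j l F)"
      "sw i l (sw j l F) = sw j l (sw i j F)" "sw i j (sw i l F) = sw j l (sw i j F)"
      by (simp_all only: act_comp bij_transpose)
  qed
  have G1: "G j l = dinv i j * (dinv i l * (sw i j (sw j l F) - sw i j F) - dinv j l * (sw j l F - F))
      - dinv j l * (dinv i l * (sw j l (sw i j F) - sw j l F) - dinv i j * (sw i j F - F))"
    using assms by (simp add: G_def ddiff_ddiff sw_dinv)
  have G2: "G l i = dinv i l * (dinv j l * (sw i j (sw j l F) - sw i l F) + dinv i j * (sw i j F - F))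
      + dinv i j * (dinv j l * (sw j l (sw i j F) - sw i j F) - dinv i l * (sw i l F - F))"
    using assms by (simp add: G_def ddiff_ddiff sw_dinv sw_commute[of j i] P Q dinv_swap[of j i] dinv_swap[of l j])
  have G3: "G l l = dinv i l * (- dinv i j * (sw j l (sw i j F) - sw i l F) - dinv j l * (sw j l F - F))
      - dinv j l * (dinv i j * (sw i j (sw j l F) - sw j l F) - dinv i l * (sw i l F - F))"
    using assms by (simp add: G_def ddiff_ddiff sw_dinv P Q dinv_swap[of j i])
  show ?thesis
    using triangle_identity[OF tri, of "sw i j (sw j l F)" "sw i j F" "sw j l F" F "sw j l (sw i j F)" "sw i l F"]
    unfolding G1 G2 G3 by (simp add: add.assoc)
qed

text \<open>
  Divided differences for disjoint pairs commute, and the other pairs of divided differences are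
  grouped into triangles \<open>{i, j, l}\<close>.
\<close>

lemma sum_ddiff_commute:
  assumes "i \<noteq> j"
  shows "(\<Sum>k\<in>UNIV. ddiff i k (\<Sum>l\<in>UNIV. ddiff j l F)) = (\<Sum>l\<in>UNIV. ddiff j l (\<Sum>k\<in>UNIV. ddiff i k F))"
proof -
  define G where "G = (\<lambda>k l. ddiff i k (ddiff j l F) - ddiff j l (ddiff i k F))"
  let ?R = "UNIV - {i, j}"
  have Gi: "G i l = 0" for l by (simp add: G_def)
  have Gj: "G k j = 0" for k by (simp add: G_def)
  have Gji: "G j i = 0" by (simp add: G_def ddiff_swap[of j i] ddiff_uminus)
  have Gkl: "G k l = 0" if "k \<in> ?R" "l \<in> ?R" "k \<noteq> l" for k l
  proof -
    have "tr i k \<circ> tr j l = tr j l \<circ> tr i k"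
      using that assms by (auto simp: fun_eq_iff Transposition.transpose_def)
    then have "sw i k (sw j l F) = sw j l (sw i k F)"
      by (simp only: act_comp bij_transpose)
    moreover have "tr i k j = j" "tr i k l = l" "tr j l i = i" "tr j l k = k"
      using that assms by (auto simp: Transposition.transpose_def)
    ultimately show ?thesis
      by (simp add: G_def ddiff_ddiff sw_dinv) (simp add: algebra_simps)
  qed
  have split: "sum f UNIV = f i + (f j + sum f ?R)" for f :: "'a \<Rightarrow> 'a tup"
  proof -
    have "sum f UNIV = f i + sum f (UNIV - {i})" by (rule sum.remove) auto
    also have "sum f (UNIV - {i}) = f j + sum f (UNIV - {i} - {j})" using assms by (intro sum.remove) auto
    also have "UNIV - {i} - {j} = ?R" by auto
    finally show ?thesis .
  qed
  have "(\<Sum>k\<in>UNIV. ddiff i k (\<Sum>l\<in>UNIV. ddiff j l F)) - (\<Sum>l\<in>UNIV. ddiff j l (\<Sum>k\<in>UNIV. ddiff i k F))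
      = (\<Sum>k\<in>UNIV. \<Sum>l\<in>UNIV. G k l)"
    unfolding ddiff_sum G_def sum_subtractf by (subst (3) sum.swap) simp
  also have "\<dots> = (\<Sum>l\<in>?R. G j l) + (\<Sum>k\<in>?R. \<Sum>l\<in>UNIV. G k l)"
    unfolding split[of "\<lambda>k. \<Sum>l\<in>UNIV. G k l"] split[of "G j"] by (simp add: Gi Gj Gji)
  also have "(\<Sum>k\<in>?R. \<Sum>l\<in>UNIV. G k l) = (\<Sum>k\<in>?R. G k i + G k k)"
  proof (rule sum.cong[OF refl])
    fix k assume k: "k \<in> ?R"
    have "(\<Sum>l\<in>?R. G k l) = (\<Sum>l\<in>?R. if l = k then G k k else 0)"
      using Gkl[OF k] by (intro sum.cong) auto
    also have "\<dots> = G k k" using k by simp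
    finally show "(\<Sum>l\<in>UNIV. G k l) = G k i + G k k"
      by (subst split[of "G k"]) (simp add: Gj)
  qed
  also have "(\<Sum>l\<in>?R. G j l) + (\<Sum>k\<in>?R. G k i + G k k) = (\<Sum>l\<in>?R. G j l + (G l i + G l l))"
    by (simp add: sum.distrib)
  also have "\<dots> = 0"
    using ddiff_triangle[OF assms] by (intro sum.neutral) (auto simp: G_def)
  finally show ?thesis by simp
qed

theorem dunkl_tup_commute: "dunkl_tup m i (dunkl_tup m j F) = dunkl_tup m j (dunkl_tup m i F)"
proof (cases "i = j")
  case False
  have expand: "dunkl_tup m i (dunkl_tup m j F) = pdt i (pdt j F)
      + of_nat m * ((\<Sum>k\<in>UNIV. pdt i (ddiff j k F)) + (\<Sum>k\<in>UNIV. ddiff i k (pdt j F)))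
      + of_nat m * (of_nat m * (\<Sum>k\<in>UNIV. ddiff i k (\<Sum>l\<in>UNIV. ddiff j l F)))" for i j
    by (simp add: dunkl_tup_def pdt_add pdt_mult pdt_sum ddiff_add ddiff_of_nat sum.distrib
        sum_distrib_left[symmetric] distrib_left add.assoc)
  have comm: "(\<Sum>k\<in>UNIV. pdt i (ddiff j k F)) - (\<Sum>k\<in>UNIV. ddiff j k (pdt i F)) =
      dinv i j * dinv i j * (sw i j F - F) + dinv i j * (sw i j (pdt i F) - sw i j (pdt j F))" if "i \<noteq> j" for i j
    unfolding sum_subtractf[symmetric] pdt_ddiff_commutator[OF that] by simp
  have "dinv j i * dinv j i * (sw j i F - F) + dinv j i * (sw j i (pdt j F) - sw j i (pdt i F)) =
      dinv i j * dinv i j * (sw i j F - F) + dinv i j * (sw i j (pdt i F) - sw i j (pdt j F))"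
    unfolding dinv_swap[of j i] sw_commute[of j i] by (simp add: algebra_simps)
  with comm[OF False] comm[OF False[symmetric]]
  have "(\<Sum>k\<in>UNIV. pdt i (ddiff j k F)) - (\<Sum>k\<in>UNIV. ddiff j k (pdt i F)) =
      (\<Sum>k\<in>UNIV. pdt j (ddiff i k F)) - (\<Sum>k\<in>UNIV. ddiff i k (pdt j F))" by simp
  then have "(\<Sum>k\<in>UNIV. pdt i (ddiff j k F)) + (\<Sum>k\<in>UNIV. ddiff i k (pdt j F)) =
      (\<Sum>k\<in>UNIV. pdt j (ddiff i k F)) + (\<Sum>k\<in>UNIV. ddiff j k (pdt i F))"
    by (simp add: algebra_simps)
  then show ?thesis
    unfolding expand[of i j] expand[of j i] sum_ddiff_commute[OF False] pdt_commute[of i j] by simp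
qed simp

subsection \<open>Equivariance and the Euler operator\<close>

lemma act_ddiff:
  assumes "bij w" shows "act w (ddiff i k F) = ddiff (w i) (w k) (act w F)"
proof -
  have "w \<circ> tr i k = tr (w i) (w k) \<circ> w"
    using assms by (auto simp: fun_eq_iff Transposition.transpose_def bij_def inj_eq)
  then have "act w (sw i k F) = sw (w i) (w k) (act w F)"
    using assms by (simp add: act_comp)
  then show ?thesis
    using assms by (simp add: ddiff_def act_mult act_diff act_cst ract_inv)
qed

lemma act_dunkl_tup:
  assumes "bij w" shows "act w (dunkl_tup m i F) = dunkl_tup m (w i) (act w F)"
proof -
  have "(\<Sum>k\<in>UNIV. ddiff (w i) (w k) (act w F)) = (\<Sum>k\<in>UNIV. ddiff (w i) k (act w F))"
    by (rule sum.reindex_bij_betw[OF assms])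
  then show ?thesis
    using assms by (simp add: dunkl_tup_def act_add act_mult act_sum act_ddiff act_pdt)
qed

definition euler :: "'n::{finite,linorder} tup \<Rightarrow> 'n tup" where
  "euler F = (\<Sum>i\<in>UNIV. xvar i * pdt i F)"

lemma euler_add: "euler (F + G) = euler F + euler G"
  by (simp add: euler_def pdt_add distrib_left sum.distrib)
lemma euler_diff: "euler (F - G) = euler F - euler G"
  by (simp add: euler_def pdt_diff right_diff_distrib sum_subtractf)
lemma euler_mult: "euler (F * G) = euler F * G + F * euler G"
  by (simp add: euler_def pdt_mult distrib_left sum.distrib sum_distrib_left sum_distrib_right algebra_simps)
lemma euler_zero [simp]: "euler 0 = 0"
  by (simp add: euler_def)
lemma euler_sum: "euler (sum f A) = (\<Sum>a\<in>A. euler (f a))"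
  by (induction A rule: infinite_finite_induct) (auto simp: euler_add)
lemma euler_of_nat [simp]: "euler (of_nat k) = 0"
  by (simp add: euler_def)
lemma euler_scal: "euler (scal c * F) = scal c * euler F"
  by (simp add: euler_mult) (simp add: euler_def pdt_cst)

lemma euler_dinv: "euler (dinv i k) = - dinv i k"
proof (cases "i = k")
  case False
  have "euler (dinv i k) = (\<Sum>l\<in>UNIV. (if l = k then xvar k else 0) * (dinv i k * dinv i k))
      - (\<Sum>l\<in>UNIV. (if l = i then xvar i else 0) * (dinv i k * dinv i k))"
    unfolding euler_def sum_subtractf[symmetric]
    by (rule sum.cong) (auto simp: pdt_cst pd_inv cst_mult cst_uminus algebra_simps False)
  also have "\<dots> = xvar k * (dinv i k * dinv i k) - xvar i * (dinv i k * dinv i k)"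
    by (simp add: sum_distrib_right[symmetric])
  also have "\<dots> = - (dinv i k * (dinv i k * (xvar i - xvar k)))"
    by (simp add: algebra_simps)
  also have "dinv i k * (xvar i - xvar k) = 1"
    using rinv_cancel[OF False] by (simp add: cst_mult[symmetric] cst_diff[symmetric])
  finally show ?thesis by (simp only: mult_1_right)
qed simp

lemma euler_act:
  assumes "bij w" shows "euler (act w F) = act w (euler F)"
proof -
  have "act w (euler F) = (\<Sum>i\<in>UNIV. xvar (w i) * pdt (w i) (act w F))"
    using assms by (simp add: euler_def act_sum act_mult act_cst act_pdt ract_var)
  also have "\<dots> = euler (act w F)"
    unfolding euler_def by (rule sum.reindex_bij_betw[OF assms])
  finally show ?thesis by simp
qed

lemma euler_pdt: "euler (pdt i F) = pdt i (euler F) - pdt i F"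
proof -
  have "pdt i (euler F) = (\<Sum>j\<in>UNIV. (if j = i then pdt j F else 0) + xvar j * pdt i (pdt j F))"
    unfolding euler_def pdt_sum
    by (rule sum.cong) (auto simp: pdt_mult pdt_cst pd_var)
  then show ?thesis
    by (simp add: euler_def sum.distrib pdt_commute[of i])
qed

lemma euler_ddiff: "euler (ddiff i k F) = ddiff i k (euler F) - ddiff i k F"
  by (simp add: ddiff_def euler_mult euler_dinv euler_diff euler_act algebra_simps)

lemma euler_dunkl_tup: "euler (dunkl_tup m i F) = dunkl_tup m i (euler F) - dunkl_tup m i F"
  by (simp add: dunkl_tup_def euler_add euler_mult euler_pdt euler_sum euler_ddiff sum_subtractf algebra_simps)

text \<open>Twice the Laplacian \<open>\<Sum>\<^sub>j\<^sub><\<^sub>k (1 - s\<^sub>j\<^sub>k)\<close> of the transpositions.\<close>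

definition lapl :: "'n::{finite,linorder} tup \<Rightarrow> 'n tup" where
  "lapl F = (\<Sum>j\<in>UNIV. \<Sum>k\<in>UNIV. F - sw j k F)"

text \<open>
  Pairing the terms \<open>(i, k)\<close> and \<open>(k, i)\<close> of \<open>\<Sum>\<^sub>i x\<^sub>i D\<^sub>i\<close> cancels the denominators \<open>x\<^sub>i - x\<^sub>k\<close>.
\<close>

lemma sum_xvar_dunkl_tup:
  "2 * (\<Sum>i\<in>UNIV. xvar i * dunkl_tup m i F) = 2 * euler F - of_nat m * lapl F"
proof -
  let ?S = "\<Sum>i\<in>UNIV. \<Sum>k\<in>UNIV. xvar i * ddiff i k F"
  have "?S = (\<Sum>i\<in>UNIV. \<Sum>k\<in>UNIV. xvar k * ddiff k i F)" by (rule sum.swap)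
  also have "\<dots> = (\<Sum>i\<in>UNIV. \<Sum>k\<in>UNIV. - (xvar k * ddiff i k F))"
    by (intro sum.cong refl) (subst ddiff_swap, simp)
  finally have "2 * ?S = (\<Sum>i\<in>UNIV. \<Sum>k\<in>UNIV. xvar i * ddiff i k F) + (\<Sum>i\<in>UNIV. \<Sum>k\<in>UNIV. - (xvar k * ddiff i k F))"
    by simp
  also have "\<dots> = (\<Sum>i\<in>UNIV. \<Sum>k\<in>UNIV. (xvar i - xvar k) * ddiff i k F)"
    by (simp add: sum.distrib[symmetric] algebra_simps)
  also have "\<dots> = (\<Sum>i\<in>UNIV. \<Sum>k\<in>UNIV. - (F - sw i k F))"
  proof (intro sum.cong refl)
    fix i k :: 'a
    have "dinv i k * (xvar i - xvar k) = 1" if "i \<noteq> k"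
      using rinv_cancel[OF that] by (simp add: cst_mult[symmetric] cst_diff[symmetric])
    then have "(xvar i - xvar k) * ddiff i k F = sw i k F - F" if "i \<noteq> k"
      using that by (simp add: ddiff_def mult.assoc[symmetric] mult.commute[of "xvar i - xvar k"])
    then show "(xvar i - xvar k) * ddiff i k F = - (F - sw i k F)" by (cases "i = k") auto
  qed
  also have "\<dots> = - lapl F" by (simp add: lapl_def sum_negf[symmetric])
  finally have S: "2 * ?S = - lapl F" .
  have "2 * (\<Sum>i\<in>UNIV. xvar i * dunkl_tup m i F) = 2 * euler F + of_nat m * (2 * ?S)"
    by (simp add: dunkl_tup_def euler_def sum.distrib sum_distrib_left algebra_simps)
  then show ?thesis unfolding S by simp
qed

section \<open>The spectral gap of the transpositions\<close>

text \<open>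
  An orthogonal representation of the symmetric group, given by the images \<open>R j k\<close> of the
  transpositions.
\<close>

locale transposition_rep =
  fixes R :: "'n::finite \<Rightarrow> 'n \<Rightarrow> 'e::real_inner \<Rightarrow> 'e"
  assumes R_add: "R j k (u + v) = R j k u + R j k v"
    and R_uminus: "R j k (- u) = - R j k u"
    and R_sym: "R j k u = R k j u"
    and R_same: "R j j u = u"
    and R_adj: "inner (R j k u) v = inner u (R j k v)"
    and R_invol: "R j k (R j k u) = u"
    and R_disjoint: "{j, k} \<inter> {l, p} = {} \<Longrightarrow> R j k (R l p u) = R l p (R j k u)"
    and R_triangle: "j \<noteq> k \<Longrightarrow> k \<noteq> l \<Longrightarrow> j \<noteq> l \<Longrightarrow> R j k (R k l u) = R k l (R l j u)"
begin

lemma R_diff: "R j k (u - v) = R j k u - R j k v"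
  using R_add[of j k u "- v"] by (simp add: R_uminus)

definition D :: "'n \<Rightarrow> 'n \<Rightarrow> 'e \<Rightarrow> 'e" where
  "D j k u = u - R j k u"

definition Lap :: "'e \<Rightarrow> 'e" where
  "Lap u = (\<Sum>j\<in>UNIV. \<Sum>k\<in>UNIV. D j k u)"

lemma D_same: "D j j u = 0"
  by (simp add: D_def R_same)

lemma D_sym: "D j k u = D k j u"
  by (simp add: D_def R_sym[of j k])

lemma D_adj: "inner (D j k u) v = inner u (D j k v)"
  by (simp add: D_def inner_diff_left inner_diff_right R_adj)

lemma D_D: "D j k (D j k u) = 2 *\<^sub>R D j k u"
  by (simp add: D_def R_diff R_invol scaleR_2)

lemma inner_D: "inner u (D j k u) = (norm (D j k u))\<^sup>2 / 2"
proof -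
  have "(norm (D j k u))\<^sup>2 = inner u (D j k (D j k u))"
    by (simp add: power2_norm_eq_inner D_adj)
  then show ?thesis by (simp add: D_D)
qed

lemma D_disjoint_nonneg:
  assumes "{j, k} \<inter> {l, p} = {}"
  shows "inner (D j k u) (D l p u) \<ge> 0"
proof -
  have comm: "D j k (D l p v) = D l p (D j k v)" for v
    by (simp add: D_def R_diff R_disjoint[OF assms])
  have "(norm (D j k (D l p u)))\<^sup>2 = inner (D l p u) (D j k (D j k (D l p u)))"
    by (simp add: power2_norm_eq_inner D_adj)
  also have "\<dots> = 2 * inner (D l p u) (D l p (D j k u))"
    by (subst D_D) (simp only: inner_scaleR_right comm)
  also have "\<dots> = 2 * inner (D l p (D l p u)) (D j k u)"
    by (simp add: D_adj)
  also have "\<dots> = 4 * inner (D j k u) (D l p u)"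
    by (simp add: D_D inner_commute)
  finally show ?thesis by (smt (verit) zero_le_power2)
qed

text \<open>
  For three indices this is the gap of \<open>S\<^sub>3\<close>: the difference of the two sides is a multiple of the
  squared length of the projection of \<open>u\<close> to the sign component.
\<close>

lemma D_triangle:
  assumes "j \<noteq> k" "k \<noteq> p" "j \<noteq> p"
  shows "2 * (inner (D j k u) (D j p u) + inner (D j k u) (D k p u) + inner (D j p u) (D k p u))
    \<ge> ((norm (D j k u))\<^sup>2 + (norm (D j p u))\<^sup>2 + (norm (D k p u))\<^sup>2) / 2"
proof -
  define P where "P = R j k (R k p u)"
  define Q where "Q = R k p (R j k u)"
  have P2: "R k p (R j p u) = P"
    using R_triangle[of j k p u] assms by (simp add: P_def R_sym[of p j])
  have P3: "R j p (R j k u) = P"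
    using R_triangle[of k p j u] assms P2 by (simp add: R_sym[of p j] R_sym[of j k])
  have Q2: "R j k (R j p u) = Q"
    using R_triangle[of p k j u] assms by (simp add: Q_def R_sym[of p k] R_sym[of k j])
  have Q3: "R j p (R k p u) = Q"
    using R_triangle[of k j p u] assms Q2 by (simp add: R_sym[of p k] R_sym[of k j])
  define A where "A = u - R j k u - R k p u - R j p u + P + Q"
  have RP: "R j k P = R k p u" "R k p P = R j p u" "R j p P = R j k u"
    using P_def P2 P3 R_invol by metis+
  have RQ: "R j k Q = R j p u" "R k p Q = R j k u" "R j p Q = R k p u"
    using Q_def Q2 Q3 R_invol by metis+
  have RA: "R j k A = - A" "R k p A = - A" "R j p A = - A"
    by (simp_all add: A_def R_add R_diff RP RQ R_invol P2 P3 Q2 Q3 P_def[symmetric] Q_def[symmetric])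
  have PA: "inner P A = inner u A" "inner Q A = inner u A"
    by (simp_all add: P_def Q_def R_adj RA R_uminus)
  have "inner A A = inner u A - inner (R j k u) A - inner (R k p u) A - inner (R j p u) A + inner P A + inner Q A"
    by (subst (1) A_def) (simp add: inner_diff_left inner_add_left)
  also have "\<dots> = 6 * inner u A"
    by (simp add: R_adj RA PA)
  finally have A6: "0 \<le> inner u A" by (smt (verit) inner_ge_zero)
  have PQ: "inner u Q = inner u P"
    unfolding P_def Q_def by (metis R_adj inner_commute)
  have uA: "inner u A = inner u u - inner u (R j k u) - inner u (R k p u) - inner u (R j p u) + 2 * inner u P"
    by (simp add: A_def inner_diff_right inner_add_right PQ)
  have n: "(norm (D a b u))\<^sup>2 = 2 * inner u u - 2 * inner u (R a b u)" for a b
    using inner_D[of u a b] by (simp add: D_def inner_diff_right)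
  have c: "inner (D j k u) (D j p u) = inner u u - inner u (R j k u) - inner u (R j p u) + inner u P"
    "inner (D j k u) (D k p u) = inner u u - inner u (R j k u) - inner u (R k p u) + inner u P"
    "inner (D j p u) (D k p u) = inner u u - inner u (R j p u) - inner u (R k p u) + inner u P"
    by (simp_all add: D_def inner_diff_left inner_diff_right R_adj R_invol Q2 Q3 P_def[symmetric] PQ)
  show ?thesis unfolding n c using A6 uA by simp
qed

definition Tri :: "('n \<times> 'n \<times> 'n) set" where
  "Tri = {(j, k, p). j \<noteq> k \<and> k \<noteq> p \<and> j \<noteq> p}"

lemma sum_Tri: "sum f Tri = (\<Sum>j\<in>UNIV. \<Sum>k\<in>UNIV - {j}. \<Sum>p\<in>UNIV - {j, k}. f (j, k, p))"
proof -
  have "Tri = (SIGMA j:UNIV. SIGMA k:UNIV - {j}. UNIV - {j, k})"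
    by (auto simp: Tri_def)
  then show ?thesis by (simp add: sum.Sigma)
qed

lemma inner_Lap: "inner u (Lap u) = (\<Sum>j\<in>UNIV. \<Sum>k\<in>UNIV. (norm (D j k u))\<^sup>2) / 2"
  by (simp add: Lap_def inner_sum_right inner_D sum_divide_distrib)

text \<open>
  The square of the Laplacian is expanded into pairs of transpositions. Disjoint pairs commute and
  contribute a nonnegative amount; overlapping pairs are collected into triangles.
\<close>

lemma spectral_gap: "inner (Lap u) (Lap u) \<ge> 2 * real CARD('n) * inner u (Lap u)"
proof (cases "CARD('n) \<ge> 2")
  case True
  define a where "a = (\<lambda>j k l p. inner (D j k u) (D l p u))"
  define N where "N = (\<Sum>j\<in>UNIV. \<Sum>k\<in>UNIV. (norm (D j k u))\<^sup>2)"
  have N': "N = (\<Sum>j\<in>UNIV. \<Sum>k\<in>UNIV - {j}. (norm (D j k u))\<^sup>2)"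
    unfolding N_def by (rule sum.cong[OF refl], rule sum.mono_neutral_right) (auto simp: D_same)
  have split: "sum f UNIV = f j + (f k + sum f (UNIV - {j, k}))" if "j \<noteq> k" for f :: "'n \<Rightarrow> real" and j k
  proof -
    have "sum f UNIV = f j + sum f (UNIV - {j})" by (rule sum.remove) auto
    also have "sum f (UNIV - {j}) = f k + sum f (UNIV - {j} - {k})" using that by (intro sum.remove) auto
    also have "UNIV - {j} - {k} = UNIV - {j, k}" by auto
    finally show ?thesis .
  qed
  have a_same: "a j k l l = 0" for j k l by (simp add: a_def D_same)
  have a_sym: "a j k l p = a j k p l" for j k l p by (simp add: a_def D_sym[of l p])
  have a_diag: "a j k j k = (norm (D j k u))\<^sup>2" for j k by (simp add: a_def power2_norm_eq_inner)
  have row: "(\<Sum>l\<in>UNIV. \<Sum>p\<in>UNIV. a j k l p) \<ge>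
      2 * (norm (D j k u))\<^sup>2 + 2 * (\<Sum>p\<in>UNIV - {j, k}. a j k j p + a j k k p)" if jk: "j \<noteq> k" for j k
  proof -
    have l: "(\<Sum>p\<in>UNIV. a j k l p) \<ge> a j k j l + a j k k l" if "l \<in> UNIV - {j, k}" for l
    proof -
      have "(\<Sum>p\<in>UNIV - {j, k}. a j k l p) \<ge> 0"
        using that by (intro sum_nonneg) (auto simp: a_def intro!: D_disjoint_nonneg)
      then show ?thesis by (subst split[OF jk]) (simp add: a_sym[of j k l])
    qed
    have "(\<Sum>l\<in>UNIV - {j, k}. \<Sum>p\<in>UNIV. a j k l p) \<ge> (\<Sum>l\<in>UNIV - {j, k}. a j k j l + a j k k l)"
      by (rule sum_mono) (rule l)
    moreover have "(\<Sum>p\<in>UNIV. a j k j p) = (norm (D j k u))\<^sup>2 + (\<Sum>p\<in>UNIV - {j, k}. a j k j p)"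
      by (subst split[OF jk]) (simp add: a_same a_diag)
    moreover have "(\<Sum>p\<in>UNIV. a j k k p) = (norm (D j k u))\<^sup>2 + (\<Sum>p\<in>UNIV - {j, k}. a j k k p)"
      by (subst split[OF jk]) (simp add: a_same a_diag a_sym[of j k k j])
    ultimately show ?thesis
      by (subst split[OF jk]) (simp add: sum.distrib)
  qed
  have "inner (Lap u) (Lap u) = (\<Sum>j\<in>UNIV. \<Sum>k\<in>UNIV. \<Sum>l\<in>UNIV. \<Sum>p\<in>UNIV. a j k l p)"
    by (simp only: Lap_def inner_sum_left) (simp only: inner_sum_right a_def)
  also have "\<dots> = (\<Sum>j\<in>UNIV. \<Sum>k\<in>UNIV - {j}. \<Sum>l\<in>UNIV. \<Sum>p\<in>UNIV. a j k l p)"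
    by (rule sum.cong[OF refl], rule sum.mono_neutral_right) (auto simp: a_def D_same)
  also have "\<dots> \<ge> (\<Sum>j\<in>UNIV. \<Sum>k\<in>UNIV - {j}. 2 * (norm (D j k u))\<^sup>2 + 2 * (\<Sum>p\<in>UNIV - {j, k}. a j k j p + a j k k p))"
    by (intro sum_mono row) auto
  also have "(\<Sum>j\<in>UNIV. \<Sum>k\<in>UNIV - {j}. 2 * (norm (D j k u))\<^sup>2 + 2 * (\<Sum>p\<in>UNIV - {j, k}. a j k j p + a j k k p))
      = 2 * N + 2 * ((\<Sum>(j, k, p)\<in>Tri. a j k j p) + (\<Sum>(j, k, p)\<in>Tri. a j k k p))"
    unfolding sum_Tri N' by (simp add: sum.distrib sum_distrib_left)
  finally have 1: "inner (Lap u) (Lap u) \<ge> 2 * N + 2 * ((\<Sum>(j, k, p)\<in>Tri. a j k j p) + (\<Sum>(j, k, p)\<in>Tri. a j k k p))" .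
  have T2: "(\<Sum>(j, k, p)\<in>Tri. a j k k p) = (\<Sum>(j, k, p)\<in>Tri. a j k j p)"
    by (rule sum.reindex_bij_witness[where i = "\<lambda>(j, k, p). (k, j, p)" and j = "\<lambda>(j, k, p). (k, j, p)"])
      (auto simp: Tri_def a_def D_sym)
  have T3: "(\<Sum>(j, k, p)\<in>Tri. a j p k p) = (\<Sum>(j, k, p)\<in>Tri. a j k j p)"
    by (rule sum.reindex_bij_witness[where i = "\<lambda>(j, k, p). (k, p, j)" and j = "\<lambda>(j, k, p). (p, j, k)"])
      (auto simp: Tri_def a_def D_sym)
  have N1: "(\<Sum>(j, k, p)\<in>Tri. (norm (D j k u))\<^sup>2) = (real CARD('n) - 2) * N"
  proof -
    have row: "(\<Sum>p\<in>UNIV - {j, k}. (norm (D j k u))\<^sup>2) = (real CARD('n) - 2) * (norm (D j k u))\<^sup>2"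
      if "k \<in> UNIV - {j}" for j k
    proof -
      have "card (UNIV - {j, k}) = CARD('n) - 2" using that by (subst card_Diff_subset) auto
      moreover have "real (CARD('n) - 2) = real CARD('n) - 2" using True by (subst of_nat_diff) auto
      ultimately show ?thesis by simp
    qed
    show ?thesis unfolding sum_Tri N' sum_distrib_left
      by (intro sum.cong refl) (simp only: prod.case row)
  qed
  have N2: "(\<Sum>(j, k, p)\<in>Tri. (norm (D j p u))\<^sup>2) = (\<Sum>(j, k, p)\<in>Tri. (norm (D j k u))\<^sup>2)"
    by (rule sum.reindex_bij_witness[where i = "\<lambda>(j, k, p). (j, p, k)" and j = "\<lambda>(j, k, p). (j, p, k)"])
      (auto simp: Tri_def)
  have N3: "(\<Sum>(j, k, p)\<in>Tri. (norm (D k p u))\<^sup>2) = (\<Sum>(j, k, p)\<in>Tri. (norm (D j k u))\<^sup>2)"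
    by (rule sum.reindex_bij_witness[where i = "\<lambda>(j, k, p). (p, j, k)" and j = "\<lambda>(j, k, p). (k, p, j)"])
      (auto simp: Tri_def)
  have "(\<Sum>(j, k, p)\<in>Tri. ((norm (D j k u))\<^sup>2 + (norm (D j p u))\<^sup>2 + (norm (D k p u))\<^sup>2) / 2)
      \<le> (\<Sum>(j, k, p)\<in>Tri. 2 * (a j k j p + a j k k p + a j p k p))"
  proof (rule sum_mono)
    fix t assume "t \<in> Tri"
    then obtain j k p where t: "t = (j, k, p)" "j \<noteq> k" "k \<noteq> p" "j \<noteq> p" by (auto simp: Tri_def)
    show "(case t of (j, k, p) \<Rightarrow> ((norm (D j k u))\<^sup>2 + (norm (D j p u))\<^sup>2 + (norm (D k p u))\<^sup>2) / 2)
        \<le> (case t of (j, k, p) \<Rightarrow> 2 * (a j k j p + a j k k p + a j p k p))"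
      unfolding t(1) prod.case a_def by (rule D_triangle[OF t(2-4)])
  qed
  moreover have "(\<Sum>(j, k, p)\<in>Tri. 2 * (a j k j p + a j k k p + a j p k p)) = 6 * (\<Sum>(j, k, p)\<in>Tri. a j k j p)"
    using T2 T3 by (simp add: case_prod_unfold sum.distrib sum_distrib_left[symmetric])
  moreover have "(\<Sum>(j, k, p)\<in>Tri. ((norm (D j k u))\<^sup>2 + (norm (D j p u))\<^sup>2 + (norm (D k p u))\<^sup>2) / 2)
      = 3 / 2 * ((real CARD('n) - 2) * N)"
    using N1 N2 N3 by (simp add: case_prod_unfold sum.distrib sum_divide_distrib[symmetric])
  moreover have "M \<le> 4 * t" if "x \<le> y" "y = 6 * t" "x = 3 / 2 * M" for x y t M :: real
    using that by simp
  ultimately have 2: "4 * (\<Sum>(j, k, p)\<in>Tri. a j k j p) \<ge> (real CARD('n) - 2) * N"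
    by blast
  have "2 * N + M \<le> y" if "2 * N + 2 * (t + t') \<le> y" "t' = t" "M \<le> 4 * t" for y t t' M
    using that by simp
  from this[OF 1 T2 2] have "inner (Lap u) (Lap u) \<ge> 2 * N + (real CARD('n) - 2) * N" .
  then show ?thesis by (simp add: inner_Lap N_def[symmetric] algebra_simps)
next
  case False
  then have "CARD('n) = 1" using zero_less_card_finite[where 'a = 'n] by linarith
  then have "j = k" for j k :: 'n by (metis card_1_singletonE UNIV_I singletonD)
  then have "Lap u = 0" unfolding Lap_def using D_same by (metis sum.neutral)
  then show ?thesis by simp
qed

end

text \<open>
  The index set consists of all maps rather than all permutations because it has to be a type.
\<close>

definition shift_vec :: "'n::finite \<Rightarrow> 'n \<Rightarrow> complex ^ ('n \<Rightarrow> 'n) \<Rightarrow> complex ^ ('n \<Rightarrow> 'n)" where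
  "shift_vec j k g = (\<chi> w. g $ (w \<circ> tr j k))"

interpretation shift: transposition_rep "shift_vec :: 'n::finite \<Rightarrow> _"
proof
  fix j k l p :: 'n and u v :: "complex ^ ('n \<Rightarrow> 'n)"
  have b: "bij (\<lambda>w. w \<circ> tr j k)"
    by (rule involuntory_imp_bij) (simp add: comp_assoc)
  have "inner (shift_vec j k u) v = (\<Sum>w\<in>UNIV. inner (u $ (w \<circ> tr j k)) (v $ (w \<circ> tr j k \<circ> tr j k)))"
    by (simp add: inner_vec_def shift_vec_def comp_assoc)
  also have "\<dots> = (\<Sum>w\<in>UNIV. inner (u $ w) (v $ (w \<circ> tr j k)))"
    by (rule sum.reindex_bij_betw[OF b])
  finally show "inner (shift_vec j k u) v = inner u (shift_vec j k v)"
    by (simp add: inner_vec_def shift_vec_def)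
  show "shift_vec j k (shift_vec l p u) = shift_vec l p (shift_vec j k u)" if "{j, k} \<inter> {l, p} = {}"
  proof -
    have "tr j k \<circ> tr l p = tr l p \<circ> tr j k"
      using that by (auto simp: fun_eq_iff Transposition.transpose_def)
    then show ?thesis by (simp add: shift_vec_def vec_eq_iff comp_assoc)
  qed
  show "shift_vec j k (shift_vec k l u) = shift_vec k l (shift_vec l j u)" if "j \<noteq> k" "k \<noteq> l" "j \<noteq> l"
  proof -
    have "tr j k \<circ> tr k l = tr k l \<circ> tr l j"
      using that by (auto simp: fun_eq_iff Transposition.transpose_def)
    then show ?thesis by (simp add: shift_vec_def vec_eq_iff comp_assoc)
  qed
qed (simp_all add: shift_vec_def vec_eq_iff comp_assoc transpose_commute)

text \<open>
  Composing the orbit of \<open>F\<close> with a point evaluation turns an eigenfamily of the Laplacian into an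
  eigenvector of the right regular representation.
\<close>

lemma lapl_eigenvalue:
  fixes F :: "'n::{finite,linorder} tup" and c :: real
  assumes eig: "lapl F = scal (complex_of_real (2 * c)) * F"
  shows "F = 0 \<or> c \<ge> real CARD('n) \<or> (c = 0 \<and> (\<forall>j k. sw j k F = F))"
proof -
  define g where "g = (\<lambda>v x. \<chi> w :: 'n \<Rightarrow> 'n. if bij w then ev (act w F v) x else 0)"
  have g_shift: "shift_vec j k (g v x) $ w = (if bij w then ev (act w (sw j k F) v) x else 0)" for j k v x w
  proof -
    have "bij (w \<circ> tr j k) \<longleftrightarrow> bij w"
      by (metis bij_comp bij_transpose comp_assoc comp_id transpose_comp_involutory)
    then show ?thesis by (simp add: shift_vec_def g_def act_comp)
  qed
  have Lap: "shift.Lap (g v x) = (2 * c) *\<^sub>R g v x" if x: "x \<in> reg_set" for v x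
  proof -
    have "shift.Lap (g v x) $ w = (2 * c) *\<^sub>R g v x $ w" for w
    proof (cases "bij w")
      case True
      have "shift.Lap (g v x) $ w = (\<Sum>j\<in>UNIV. \<Sum>k\<in>UNIV. ev (act w F v) x - ev (act w (sw j k F) v) x)"
        unfolding shift.Lap_def shift.D_def by (simp add: g_shift True) (simp add: g_def True)
      also have "\<dots> = ev (act w (lapl F) v) x"
        by (simp add: lapl_def act_sum act_diff sum_fun_apply tup_apply)
      also have "\<dots> = complex_of_real (2 * c) * ev (act w F v) x"
        using x by (simp add: eig act_mult act_cst tup_apply)
      finally show ?thesis using True by (simp add: g_def scaleR_conv_of_real)
    next
      case False
      then have "shift.Lap (g v x) $ w = 0"
        unfolding shift.Lap_def shift.D_def by (simp add: g_shift) (simp add: g_def)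
      then show ?thesis using False by (simp add: g_def)
    qed
    then show ?thesis by (simp add: vec_eq_iff)
  qed
  have gid: "g v x $ id = ev (F v) x" for v x by (simp add: g_def)
  have case_g: "c \<ge> real CARD('n) \<or> c = 0" if "x \<in> reg_set" "g v x \<noteq> 0" for v x
  proof -
    have pos: "inner (g v x) (g v x) > 0" using that by simp
    have "2 * real CARD('n) * (2 * c * inner (g v x) (g v x)) \<le> 2 * c * (2 * c * inner (g v x) (g v x))"
      using shift.spectral_gap[of "g v x"] Lap[OF that(1), of v] by simp
    then have "real CARD('n) * c * inner (g v x) (g v x) \<le> c * c * inner (g v x) (g v x)"
      by (simp add: mult_ac)
    then have "real CARD('n) * c \<le> c * c" using pos by (rule mult_right_le_imp_le)
    moreover have "0 \<le> inner (g v x) (shift.Lap (g v x))"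
      unfolding shift.inner_Lap by (intro divide_nonneg_nonneg sum_nonneg) auto
    then have "0 \<le> 2 * c * inner (g v x) (g v x)"
      using Lap[OF that(1), of v] by simp
    then have "0 \<le> c" using pos by (simp add: zero_le_mult_iff)
    ultimately show ?thesis
      by (metis mult_right_le_imp_le order_le_less)
  qed
  show ?thesis
  proof (cases "c = 0")
    case False
    show ?thesis
    proof (cases "c \<ge> real CARD('n)")
      case nc: False
      have "F v = 0" for v
      proof (rule rfun_eqI)
        fix x :: "'n cvec" assume "x \<in> reg_set"
        then have "g v x = 0" using case_g False nc by blast
        then show "ev (F v) x = ev 0 x" using gid[of v x] by simp
      qed
      then have "F = 0" by (simp add: fun_eq_iff tup_apply)
      then show ?thesis by simp
    qed simp
  next
    case True
    have "sw j k F = F" for j k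
    proof (rule ext, rule rfun_eqI)
      fix v :: "'n \<Rightarrow> 'n" and x :: "'n cvec" assume x: "x \<in> reg_set"
      have "(\<Sum>j\<in>UNIV. \<Sum>k\<in>UNIV. (norm (shift.D j k (g v x)))\<^sup>2) = 0"
        using shift.inner_Lap[of "g v x"] Lap[OF x, of v] True by simp
      then have "(norm (shift.D j k (g v x)))\<^sup>2 = 0"
        by (simp add: sum_nonneg_eq_0_iff sum_nonneg)
      then have "shift_vec j k (g v x) $ id = g v x $ id"
        by (simp add: shift.D_def)
      then show "ev (sw j k F v) x = ev (F v) x"
        by (simp add: g_shift gid)
    qed
    then have "\<forall>j k. sw j k F = F" by (intro allI)
    with True show ?thesis by (intro disjI2 conjI)
  qed
qed

section \<open>The Calogero operators\<close>

definition invariant :: "'n::{finite,linorder} tup \<Rightarrow> bool" where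
  "invariant F \<longleftrightarrow> (\<forall>w. bij w \<longrightarrow> act w F = F)"

lemma op_dunkl_add: "op_monom (dunkl_tup m) (\<alpha> + \<beta>) F = op_monom (dunkl_tup m) \<alpha> (op_monom (dunkl_tup m) \<beta> F)"
  by (rule op_monom_add) (rule dunkl_tup_commute)

lemma op_dunkl_unit: "op_monom (dunkl_tup m) (unit_exp i + \<alpha>) F = dunkl_tup m i (op_monom (dunkl_tup m) \<alpha> F)"
  by (rule op_monom_unit) (rule dunkl_tup_commute)

lemma op_dunkl_zero_arg [simp]: "op_monom (dunkl_tup m) \<alpha> 0 = 0"
  by (induction \<alpha> rule: exp_induct) (simp_all add: op_dunkl_unit)

lemma op_dunkl_plus: "op_monom (dunkl_tup m) \<alpha> (F + G) = op_monom (dunkl_tup m) \<alpha> F + op_monom (dunkl_tup m) \<alpha> G"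
  by (induction \<alpha> rule: exp_induct) (simp_all add: op_dunkl_unit dunkl_tup_add)

lemma op_dunkl_scal: "op_monom (dunkl_tup m) \<alpha> (scal c * F) = scal c * op_monom (dunkl_tup m) \<alpha> F"
  by (induction \<alpha> rule: exp_induct) (simp_all add: op_dunkl_unit dunkl_tup_scal)

lemma act_op_dunkl:
  "bij w \<Longrightarrow> act w (op_monom (dunkl_tup m) \<alpha> F) = op_monom (dunkl_tup m) (perm_exp w \<alpha>) (act w F)"
  by (induction \<alpha> rule: exp_induct)
    (simp_all add: op_dunkl_unit act_dunkl_tup perm_exp_add perm_exp_unit)

text \<open>The operator \<open>p(D)\<close>; as the Dunkl operators commute, \<open>p \<mapsto> p(D)\<close> is multiplicative.\<close>

definition psub :: "nat \<Rightarrow> 'n::{finite,linorder} mpoly \<Rightarrow> 'n tup \<Rightarrow> 'n tup" where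
  "psub m p F = (\<Sum>\<alpha>\<in>keys p. scal (lookup p \<alpha>) * op_monom (dunkl_tup m) \<alpha> F)"

lemma cst_sum: "cst (sum f A) = (\<Sum>k\<in>A. cst (f k))"
  by (induction A rule: infinite_finite_induct) (simp_all add: cst_add)
lemma ract_power: "ract w (u ^ k) = ract w u ^ k"
  by (induction k) (simp_all add: ract_mult)
lemma scal_add: "scal (a + b) = scal a + scal b" by (simp add: rconst_add cst_add)
lemma scal_mult: "scal (a * b) = scal a * scal b" by (simp add: rconst_mult cst_mult)
lemma psub_add: "psub m (p + q) F = psub m p F + psub m q F"
  unfolding psub_def by (rule setsum_keys_plus_distrib) (simp_all add: scal_add distrib_right)

lemma psub_single: "psub m (Poly_Mapping.single \<alpha> c) F = scal c * op_monom (dunkl_tup m) \<alpha> F"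
  by (simp add: psub_def)

lemma psub_zero [simp]: "psub m 0 F = 0"
  by (simp add: psub_def)

lemma psub_sum: "psub m (sum f A) F = (\<Sum>a\<in>A. psub m (f a) F)"
  by (induction A rule: infinite_finite_induct) (simp_all add: psub_add)

lemma psub_zero_arg [simp]: "psub m p 0 = 0"
  by (simp add: psub_def)

lemma psub_plus: "psub m p (F + G) = psub m p F + psub m p G"
  by (simp add: psub_def op_dunkl_plus distrib_left sum.distrib)

lemma psub_scal: "psub m p (scal c * F) = scal c * psub m p F"
  by (simp add: psub_def op_dunkl_scal sum_distrib_left mult.left_commute)

lemma psub_mult: "psub m (p * q) F = psub m p (psub m q F)"
proof (induction p rule: mpoly_induct_single)
  case (single \<alpha> c)
  show ?case
  proof (induction q rule: mpoly_induct_single)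
    case (single \<beta> d)
    show ?case
      by (simp add: mult_single psub_single op_dunkl_add op_dunkl_scal scal_mult mult.assoc)
  next
    case (add p q)
    then show ?case by (simp add: distrib_left psub_add psub_plus)
  qed
next
  case (add p q)
  then show ?case by (simp add: distrib_right psub_add)
qed

subsection \<open>Comparison with the operators on functions\<close>

lemma sum_pairs_axis:
  fixes h :: "'n::{finite,linorder} \<Rightarrow> 'n \<Rightarrow> complex" and x :: "'n cvec"
  assumes "\<And>j k. h j k = h k j"
  shows "(\<Sum>(j, k)\<in>{(j, k). j < k}. (axis i 1 $ j - axis i 1 $ k) / (x $ j - x $ k) * h j k)
    = (\<Sum>k\<in>UNIV. 1 / (x $ i - x $ k) * h i k)"
proof -
  define g where "g = (\<lambda>k. 1 / (x $ i - x $ k) * h i k)"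
  have eq: "(axis i 1 $ j - axis i 1 $ k) / (x $ j - x $ k) * h j k
      = (if j = i then g k else 0) + (if k = i then g j else 0)" if "j < k" for j k
  proof -
    have "- (h i j / (x $ j - x $ i)) = h i j / (x $ i - x $ j)"
      using minus_divide_divide[of "h i j" "x $ i - x $ j"] by simp
    with that assms[of j i] show ?thesis by (auto simp: axis_def g_def)
  qed
  have "(\<Sum>(j, k)\<in>{(j, k). j < k}. (axis i 1 $ j - axis i 1 $ k) / (x $ j - x $ k) * h j k)
      = (\<Sum>(j, k)\<in>{(j, k). j < k}. (if j = i then g k else 0) + (if k = i then g j else 0))"
    by (rule sum.cong[OF refl]) (use eq in \<open>auto simp: case_prod_unfold\<close>)
  also have "\<dots> = (\<Sum>(j, k)\<in>{(j, k). j < k}. if j = i then g k else 0)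
      + (\<Sum>(j, k)\<in>{(j, k). j < k}. if k = i then g j else 0)"
    by (simp add: case_prod_unfold sum.distrib)
  also have "(\<Sum>(j, k)\<in>{(j, k). j < k}. if j = i then g k else 0) = (\<Sum>k\<in>{i<..}. g k)"
  proof -
    have "(\<Sum>(j, k)\<in>{(j, k). j < k}. if j = i then g k else 0) = (\<Sum>(j, k)\<in>{i} \<times> {i<..}. g k)"
      by (rule sum.mono_neutral_cong_right) (auto simp: case_prod_unfold)
    then show ?thesis by (simp add: sum.cartesian_product[symmetric])
  qed
  also have "(\<Sum>(j, k)\<in>{(j, k). j < k}. if k = i then g j else 0) = (\<Sum>k\<in>{..<i}. g k)"
  proof -
    have "(\<Sum>(j, k)\<in>{(j, k). j < k}. if k = i then g j else 0) = (\<Sum>(j, k)\<in>{..<i} \<times> {i}. g j)"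
      by (rule sum.mono_neutral_cong_right) (auto simp: case_prod_unfold)
    then show ?thesis by (simp add: sum.cartesian_product[symmetric])
  qed
  also have "(\<Sum>k\<in>{i<..}. g k) + (\<Sum>k\<in>{..<i}. g k) = (\<Sum>k\<in>UNIV - {i}. g k)"
    by (subst sum.union_disjoint[symmetric]) (auto intro!: sum.cong)
  also have "\<dots> = (\<Sum>k\<in>UNIV. g k)"
    by (rule sum.mono_neutral_left) (auto simp: g_def)
  finally show ?thesis by (simp add: g_def)
qed

lemma dunkl_eq_dunkl_tup:
  assumes "\<And>v y. y \<in> reg_set \<Longrightarrow> u y = ev (F v) y" and x: "x \<in> reg_set"
  shows "dunkl m (axis i 1) u x = ev (dunkl_tup m i F v) x"
proof -
  have pv: "perm_vec (tr j k) x = (\<chi> l. x $ tr j k l)" for j k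
    by (simp add: perm_vec_def)
  have h: "(u (perm_vec (tr j k) x) - u x) = ev (sw j k F v - F v) x" for j k
    using assms(1)[OF x, of v] assms(1)[of "\<chi> l. x $ tr j k l" "inv (tr j k) \<circ> v"] x
    by (simp add: pv act_def ev_ract perm_reg_set)
  have "(\<Sum>(j, k)\<in>{(j, k). j < k}. (axis i 1 $ j - axis i 1 $ k) / (x $ j - x $ k) * (u (perm_vec (tr j k) x) - u x))
      = (\<Sum>k\<in>UNIV. 1 / (x $ i - x $ k) * (u (perm_vec (tr i k) x) - u x))"
    by (rule sum_pairs_axis) (simp add: transpose_commute)
  also have "\<dots> = ev ((\<Sum>k\<in>UNIV. ddiff i k F) v) x"
    unfolding h using x by (simp add: sum_fun_apply ddiff_def tup_apply)
  finally show ?thesis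
    using dir_deriv_eq_pd[of x u "F v" i] assms(1) x
    by (simp add: dunkl_def dunkl_tup_def tup_apply pdt_def)
qed

lemma dunkl_subst_eq_psub:
  assumes "\<And>v y. y \<in> reg_set \<Longrightarrow> u y = ev (F v) y" and x: "x \<in> reg_set"
  shows "dunkl_subst m p u x = ev (psub m p F v) x"
proof -
  have "\<forall>v y. y \<in> reg_set \<longrightarrow> op_monom (\<lambda>i. dunkl m (axis i 1)) \<alpha> u y = ev (op_monom (dunkl_tup m) \<alpha> F v) y" for \<alpha>
    by (rule op_monom_rel[where R = "\<lambda>u F. \<forall>v y. y \<in> reg_set \<longrightarrow> u y = ev (F v) y"])
      (use assms(1) in \<open>auto intro!: dunkl_eq_dunkl_tup\<close>)
  then show ?thesis
    using x by (simp add: dunkl_subst_def psub_def sum_fun_apply tup_apply)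
qed

lemma op_dir_deriv_eq:
  assumes "\<And>y. y \<in> reg_set \<Longrightarrow> u y = ev r y" and x: "x \<in> reg_set"
  shows "op_monom (\<lambda>i. dir_deriv (axis i 1)) \<alpha> u x = ev (op_monom pd \<alpha> r) x"
proof -
  have "\<forall>y. y \<in> reg_set \<longrightarrow> op_monom (\<lambda>i. dir_deriv (axis i 1)) \<alpha> u y = ev (op_monom pd \<alpha> r) y"
    by (rule op_monom_rel[where R = "\<lambda>u r. \<forall>y. y \<in> reg_set \<longrightarrow> u y = ev r y"])
      (use assms(1) in \<open>auto intro!: dir_deriv_eq_pd\<close>)
  with x show ?thesis by simp
qed

lemma op_pdt_apply: "op_monom pdt \<alpha> F v = op_monom pd \<alpha> (F v)"
  by (rule op_monom_rel[where R = "\<lambda>F r. F v = r"]) (auto simp: pdt_def)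

lemma op_pdt_unit: "op_monom pdt (unit_exp i + \<alpha>) F = pdt i (op_monom pdt \<alpha> F)"
  by (rule op_monom_unit) (rule pdt_commute)

lemma op_pd_unit: "op_monom pd (unit_exp i + \<alpha>) r = pd i (op_monom pd \<alpha> r)"
  by (rule op_monom_unit) (rule pd_commute)

lemma act_op_pdt: "bij w \<Longrightarrow> act w (op_monom pdt \<alpha> F) = op_monom pdt (perm_exp w \<alpha>) (act w F)"
  by (induction \<alpha> rule: exp_induct) (simp_all add: op_pdt_unit act_pdt perm_exp_add perm_exp_unit)

subsection \<open>Existence\<close>

text \<open>
  On invariants a reflection acts on a differential operator only through its coefficients and
  symbols, so a product of Dunkl operators can be rewritten as a differential operator; the
  reflection terms have lower order, which gives the leading symbol.
\<close>

lemma op_dunkl_as_diffop: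
  "\<exists>a. (\<forall>\<gamma>. mdeg \<alpha> < mdeg \<gamma> \<longrightarrow> a \<gamma> = 0) \<and>
     (\<forall>\<gamma>. mdeg \<gamma> = mdeg \<alpha> \<longrightarrow> a \<gamma> = (if \<gamma> = \<alpha> then 1 else 0)) \<and>
     (\<forall>F. invariant F \<longrightarrow> op_monom (dunkl_tup m) \<alpha> F =
        (\<Sum>\<gamma>\<in>{\<gamma>. mdeg \<gamma> \<le> mdeg \<alpha>}. cst (a \<gamma>) * op_monom pdt \<gamma> F))"
proof (induction \<alpha> rule: exp_induct)
  case zero
  show ?case
    by (rule exI[of _ "\<lambda>\<gamma>. if \<gamma> = 0 then 1 else 0"]) (auto simp: mdeg_eq_0_iff)
next
  case (add i \<alpha>)
  then obtain a where a0: "\<And>\<gamma>. mdeg \<alpha> < mdeg \<gamma> \<Longrightarrow> a \<gamma> = 0"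
    and a1: "\<And>\<gamma>. mdeg \<gamma> = mdeg \<alpha> \<Longrightarrow> a \<gamma> = (if \<gamma> = \<alpha> then 1 else 0)"
    and a2: "\<And>F. invariant F \<Longrightarrow> op_monom (dunkl_tup m) \<alpha> F =
      (\<Sum>\<gamma>\<in>{\<gamma>. mdeg \<gamma> \<le> mdeg \<alpha>}. cst (a \<gamma>) * op_monom pdt \<gamma> F)" by blast
  let ?B = "{\<gamma> :: 'a \<Rightarrow>\<^sub>0 nat. mdeg \<gamma> \<le> mdeg \<alpha>}"
  let ?C = "{\<gamma> :: 'a \<Rightarrow>\<^sub>0 nat. mdeg \<gamma> \<le> mdeg (unit_exp i + \<alpha>)}"
  \<comment> \<open>The symbols of \<open>\<partial>\<^sub>i\<close> and of the reflections applied to the given operator:\<close>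
  define b where "b = (\<lambda>\<gamma>. if lookup \<gamma> i > 0 then a (\<gamma> - unit_exp i) else 0)"
  define s where "s = (\<lambda>k \<gamma>. ract (tr i k) (a (perm_exp (tr i k) \<gamma>)))"
  define a' where "a' = (\<lambda>\<gamma>. pd i (a \<gamma>) + b \<gamma> + of_nat m * (\<Sum>k\<in>UNIV. rinv i k * (s k \<gamma> - a \<gamma>)))"
  have b_deg: "mdeg \<gamma> = Suc (mdeg (\<gamma> - unit_exp i))" if "lookup \<gamma> i > 0" for \<gamma>
    using arg_cong[OF split_unit_exp[OF that], of mdeg] by (simp add: mdeg_add)
  have s0: "s k \<gamma> = 0" if "mdeg \<alpha> < mdeg \<gamma>" for k \<gamma>
    using that by (simp add: s_def a0 mdeg_perm_exp)
  have BC: "?B \<subseteq> ?C" by (auto simp: mdeg_add)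
  have fin: "finite ?B" "finite ?C" by (rule finite_mdeg_le)+
  show ?case
  proof (intro exI[of _ a'] conjI allI impI)
    fix \<gamma> :: "'a \<Rightarrow>\<^sub>0 nat" assume "mdeg (unit_exp i + \<alpha>) < mdeg \<gamma>"
    then have d: "Suc (mdeg \<alpha>) < mdeg \<gamma>" by (simp add: mdeg_add)
    then have "b \<gamma> = 0" using b_deg[of \<gamma>] a0[of "\<gamma> - unit_exp i"] by (auto simp: b_def)
    with d show "a' \<gamma> = 0" by (simp add: a'_def a0 s0)
  next
    fix \<gamma> :: "'a \<Rightarrow>\<^sub>0 nat" assume "mdeg \<gamma> = mdeg (unit_exp i + \<alpha>)"
    then have d: "mdeg \<gamma> = Suc (mdeg \<alpha>)" by (simp add: mdeg_add)
    have "b \<gamma> = (if \<gamma> = unit_exp i + \<alpha> then 1 else 0)"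
    proof (cases "lookup \<gamma> i > 0")
      case True
      then have "\<gamma> = unit_exp i + \<alpha> \<longleftrightarrow> \<gamma> - unit_exp i = \<alpha>"
        using split_unit_exp[OF True] by (metis add_left_cancel)
      with True d b_deg[OF True] show ?thesis by (simp add: b_def a1)
    next
      case False
      then show ?thesis by (auto simp: b_def lookup_add lookup_unit_exp)
    qed
    with d show "a' \<gamma> = (if \<gamma> = unit_exp i + \<alpha> then 1 else 0)" by (simp add: a'_def a0 s0)
  next
    fix F :: "'a tup" assume F: "invariant F"
    let ?G = "\<Sum>\<gamma>\<in>?B. cst (a \<gamma>) * op_monom pdt \<gamma> F"
    have B_to_C: "(\<Sum>\<gamma>\<in>?B. cst (f \<gamma>) * op_monom pdt \<gamma> F) = (\<Sum>\<gamma>\<in>?C. cst (f \<gamma>) * op_monom pdt \<gamma> F)"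
      if "\<And>\<gamma>. mdeg \<alpha> < mdeg \<gamma> \<Longrightarrow> f \<gamma> = 0" for f
      using fin BC that by (intro sum.mono_neutral_left) auto
    have GC: "?G = (\<Sum>\<gamma>\<in>?C. cst (a \<gamma>) * op_monom pdt \<gamma> F)"
      by (rule B_to_C) (rule a0)
    have p1: "(\<Sum>\<gamma>\<in>?B. cst (a \<gamma>) * op_monom pdt (unit_exp i + \<gamma>) F) = (\<Sum>\<gamma>\<in>?C. cst (b \<gamma>) * op_monom pdt \<gamma> F)"
    proof -
      have "(\<Sum>\<gamma>\<in>?C. cst (b \<gamma>) * op_monom pdt \<gamma> F) = (\<Sum>\<gamma>\<in>{\<gamma>\<in>?C. lookup \<gamma> i > 0}. cst (b \<gamma>) * op_monom pdt \<gamma> F)"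
        using fin by (intro sum.mono_neutral_right) (auto simp: b_def)
      also have "\<dots> = (\<Sum>\<gamma>\<in>?B. cst (a \<gamma>) * op_monom pdt (unit_exp i + \<gamma>) F)"
        by (rule sum.reindex_bij_witness[where i = "\<lambda>\<gamma>. unit_exp i + \<gamma>" and j = "\<lambda>\<gamma>. \<gamma> - unit_exp i"])
          (auto simp: split_unit_exp[symmetric] b_deg mdeg_add lookup_add lookup_unit_exp b_def)
      finally show ?thesis by simp
    qed
    have p2: "pdt i ?G = (\<Sum>\<gamma>\<in>?C. cst (pd i (a \<gamma>) + b \<gamma>) * op_monom pdt \<gamma> F)"
    proof -
      have "pdt i ?G = (\<Sum>\<gamma>\<in>?B. cst (pd i (a \<gamma>)) * op_monom pdt \<gamma> F)
          + (\<Sum>\<gamma>\<in>?B. cst (a \<gamma>) * op_monom pdt (unit_exp i + \<gamma>) F)"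
        by (simp add: pdt_sum pdt_mult pdt_cst op_pdt_unit sum.distrib)
      also have "(\<Sum>\<gamma>\<in>?B. cst (pd i (a \<gamma>)) * op_monom pdt \<gamma> F) = (\<Sum>\<gamma>\<in>?C. cst (pd i (a \<gamma>)) * op_monom pdt \<gamma> F)"
        by (rule B_to_C) (simp add: a0)
      finally show ?thesis unfolding p1 by (simp add: cst_add distrib_right sum.distrib)
    qed
    have p3: "sw i k ?G = (\<Sum>\<gamma>\<in>?C. cst (s k \<gamma>) * op_monom pdt \<gamma> F)" for k
    proof -
      have "sw i k ?G = (\<Sum>\<gamma>\<in>?B. cst (ract (tr i k) (a \<gamma>)) * op_monom pdt (perm_exp (tr i k) \<gamma>) F)"
        using F by (simp add: act_sum act_mult act_cst act_op_pdt invariant_def)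
      also have "\<dots> = (\<Sum>\<gamma>\<in>?B. cst (s k \<gamma>) * op_monom pdt \<gamma> F)"
        by (rule sum.reindex_bij_witness[where i = "perm_exp (tr i k)" and j = "perm_exp (tr i k)"])
          (auto simp: perm_exp_comp s_def mdeg_perm_exp)
      also have "\<dots> = (\<Sum>\<gamma>\<in>?C. cst (s k \<gamma>) * op_monom pdt \<gamma> F)"
        by (rule B_to_C) (rule s0)
      finally show ?thesis .
    qed
    have p4: "ddiff i k ?G = (\<Sum>\<gamma>\<in>?C. cst (rinv i k * (s k \<gamma> - a \<gamma>)) * op_monom pdt \<gamma> F)" for k
      unfolding ddiff_def p3 
      by (subst GC) (simp add: sum_subtractf[symmetric] sum_distrib_left cst_mult cst_diff left_diff_distrib mult.assoc)
    have "op_monom (dunkl_tup m) (unit_exp i + \<alpha>) F = dunkl_tup m i ?G"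
      by (simp add: op_dunkl_unit a2[OF F])
    also have "\<dots> = (\<Sum>\<gamma>\<in>?C. cst (pd i (a \<gamma>) + b \<gamma>) * op_monom pdt \<gamma> F)
        + of_nat m * (\<Sum>k\<in>UNIV. \<Sum>\<gamma>\<in>?C. cst (rinv i k * (s k \<gamma> - a \<gamma>)) * op_monom pdt \<gamma> F)"
      unfolding dunkl_tup_def p2 p4 ..
    also have "\<dots> = (\<Sum>\<gamma>\<in>?C. cst (a' \<gamma>) * op_monom pdt \<gamma> F)"
      unfolding a'_def cst_add[of "_ + _"] cst_mult[of "of_nat m"] cst_sum distrib_right[of "cst (_ + _)"] sum.distrib
      by (subst sum.swap) (simp add: sum_distrib_left sum_distrib_right mult.assoc)
    finally show "op_monom (dunkl_tup m) (unit_exp i + \<alpha>) F = (\<Sum>\<gamma>\<in>?C. cst (a' \<gamma>) * op_monom pdt \<gamma> F)" .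
  qed
qed

lemma psub_as_diffop:
  assumes "homogeneous d p"
  shows "\<exists>a. (\<forall>\<gamma>. d < mdeg \<gamma> \<longrightarrow> a \<gamma> = 0) \<and>
     (\<forall>\<gamma>. mdeg \<gamma> = d \<longrightarrow> a \<gamma> = rconst (lookup p \<gamma>)) \<and>
     (\<forall>F. invariant F \<longrightarrow> psub m p F =
        (\<Sum>\<gamma>\<in>{\<gamma>. mdeg \<gamma> \<le> d}. cst (a \<gamma>) * op_monom pdt \<gamma> F))"
proof -
  let ?P = "\<lambda>\<alpha> a. (\<forall>\<gamma>. mdeg \<alpha> < mdeg \<gamma> \<longrightarrow> a \<gamma> = 0) \<and>
     (\<forall>\<gamma>. mdeg \<gamma> = mdeg \<alpha> \<longrightarrow> a \<gamma> = (if \<gamma> = \<alpha> then 1 else 0)) \<and>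
     (\<forall>F :: 'a tup. invariant F \<longrightarrow> op_monom (dunkl_tup m) \<alpha> F =
        (\<Sum>\<gamma>\<in>{\<gamma>. mdeg \<gamma> \<le> mdeg \<alpha>}. cst (a \<gamma>) * op_monom pdt \<gamma> F))"
  have "\<exists>A. \<forall>\<alpha>. ?P \<alpha> (A \<alpha>)"
    by (rule choice, rule allI, rule op_dunkl_as_diffop)
  then obtain A where A: "\<forall>\<alpha>. ?P \<alpha> (A \<alpha>)" ..
  have A0: "A \<alpha> \<gamma> = 0" if "mdeg \<alpha> < mdeg \<gamma>" for \<alpha> \<gamma>
    using conjunct1[OF spec[OF A, of \<alpha>]] that by simp
  have A1: "A \<alpha> \<gamma> = (if \<gamma> = \<alpha> then 1 else 0)" if "mdeg \<gamma> = mdeg \<alpha>" for \<alpha> \<gamma>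
    using conjunct1[OF conjunct2[OF spec[OF A, of \<alpha>]]] that by simp
  have A2: "op_monom (dunkl_tup m) \<alpha> F = (\<Sum>\<gamma>\<in>{\<gamma>. mdeg \<gamma> \<le> mdeg \<alpha>}. cst (A \<alpha> \<gamma>) * op_monom pdt \<gamma> F)"
    if "invariant F" for \<alpha> F
    using conjunct2[OF conjunct2[OF spec[OF A, of \<alpha>]]] that by simp
  have deg: "mdeg \<alpha> = d" if "\<alpha> \<in> keys p" for \<alpha> using assms that by (auto simp: homogeneous_def)
  define a where "a = (\<lambda>\<gamma>. \<Sum>\<alpha>\<in>keys p. rconst (lookup p \<alpha>) * A \<alpha> \<gamma>)"
  show ?thesis
  proof (intro exI[of _ a] conjI allI impI)
    show "a \<gamma> = 0" if "d < mdeg \<gamma>" for \<gamma>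
      using that by (simp add: a_def A0 deg)
    show "a \<gamma> = rconst (lookup p \<gamma>)" if "mdeg \<gamma> = d" for \<gamma>
    proof -
      have "a \<gamma> = (\<Sum>\<alpha>\<in>keys p. if \<alpha> = \<gamma> then rconst (lookup p \<gamma>) else 0)"
        unfolding a_def using that by (intro sum.cong) (auto simp: A1 deg)
      then show ?thesis by (auto simp: in_keys_iff)
    qed
    fix F :: "'a tup" assume F: "invariant F"
    have "psub m p F = (\<Sum>\<alpha>\<in>keys p. \<Sum>\<gamma>\<in>{\<gamma>. mdeg \<gamma> \<le> d}. cst (rconst (lookup p \<alpha>) * A \<alpha> \<gamma>) * op_monom pdt \<gamma> F)"
      unfolding psub_def by (rule sum.cong[OF refl]) (simp add: A2[OF F] deg sum_distrib_left cst_mult mult.assoc)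
    also have "\<dots> = (\<Sum>\<gamma>\<in>{\<gamma>. mdeg \<gamma> \<le> d}. cst (a \<gamma>) * op_monom pdt \<gamma> F)"
      by (subst sum.swap) (simp add: a_def cst_sum sum_distrib_right)
    finally show "psub m p F = (\<Sum>\<gamma>\<in>{\<gamma>. mdeg \<gamma> \<le> d}. cst (a \<gamma>) * op_monom pdt \<gamma> F)" .
  qed
qed

subsection \<open>Uniqueness\<close>

lemma pd_power: "pd i (u ^ Suc k) = of_nat (Suc k) * u ^ k * pd i u"
  by (induction k) (simp_all add: pd_mult algebra_simps)

text \<open>
  Only the first term of the product rule is needed, modulo one higher power of \<open>l\<close>: at a zero of
  \<open>l\<close> everything vanishes except the first term for \<open>N = |\<gamma>|\<close>.
\<close>

lemma op_pd_power:
  "mdeg \<gamma> \<le> N \<Longrightarrow> \<exists>s. op_monom pd \<gamma> (l ^ N) =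
     of_nat (\<Prod>j<mdeg \<gamma>. N - j) * l ^ (N - mdeg \<gamma>) * mono_at (\<lambda>i. pd i l) \<gamma> + l ^ Suc (N - mdeg \<gamma>) * s"
proof (induction \<gamma> rule: exp_induct)
  case zero
  show ?case by (rule exI[of _ 0]) simp
next
  case (add i \<gamma>)
  let ?M = "mono_at (\<lambda>i. pd i l) \<gamma>"
  define c where "c = (\<Prod>j<mdeg \<gamma>. N - j)"
  have k: "Suc (mdeg \<gamma>) \<le> N" using add.prems by (simp add: mdeg_add)
  then obtain e where e: "N = Suc (mdeg \<gamma> + e)" by (metis add_Suc le_Suc_ex)
  from add k obtain s where s: "op_monom pd \<gamma> (l ^ N) = of_nat c * l ^ Suc e * ?M + l ^ Suc (Suc e) * s"
    using e unfolding c_def by (auto simp: mdeg_add simp del: of_nat_prod)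
  have "op_monom pd (unit_exp i + \<gamma>) (l ^ N) =
      of_nat (c * Suc e) * l ^ e * (pd i l * ?M) +
      l ^ Suc e * (of_nat c * pd i ?M + of_nat (Suc (Suc e)) * pd i l * s + l * pd i s)"
    unfolding op_pd_unit s pd_add pd_mult pd_power pd_of_nat of_nat_mult by (simp add: algebra_simps)
  moreover have "(\<Prod>j<mdeg (unit_exp i + \<gamma>). N - j) = c * Suc e"
    using e by (simp add: mdeg_add c_def)
  moreover have "N - mdeg (unit_exp i + \<gamma>) = e" using e by (simp add: mdeg_add)
  moreover have "mono_at (\<lambda>i. pd i l) (unit_exp i + \<gamma>) = pd i l * ?M" by (simp add: mono_at_add)
  ultimately show ?case by metis
qed

text \<open>
  At a regular point the differentials of the symmetric functions \<open>\<Sum>\<^sub>i g(x\<^sub>i)\<close> are arbitrary, by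
  Lagrange interpolation for \<open>g'\<close>.
\<close>

lemma symmetric_with_gradient:
  fixes x :: "'n::{finite,linorder} cvec"
  assumes x: "x \<in> reg_set"
  shows "\<exists>l. (\<forall>w. bij w \<longrightarrow> ract w l = l) \<and> ev l x = 0 \<and> (\<forall>i. ev (pd i l) x = \<xi> i)"
proof -
  define h where "h = (\<Sum>i\<in>UNIV. smult (\<xi> i / (\<Prod>j\<in>UNIV - {i}. x $ i - x $ j)) (\<Prod>j\<in>UNIV - {i}. [:- x $ j, 1:]))"
  have h: "poly h (x $ k) = \<xi> k" for k
  proof -
    have "poly h (x $ k) = (\<Sum>i\<in>UNIV. if i = k then \<xi> k else 0)"
      unfolding h_def poly_sum
    proof (rule sum.cong[OF refl])
      fix i :: 'n
      have nz: "(\<Prod>j\<in>UNIV - {k}. x $ k - x $ j) \<noteq> 0"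
        using x by (auto simp: reg_set_def)
      have "(\<Prod>j\<in>UNIV - {i}. x $ k - x $ j) = 0" if "i \<noteq> k"
        using that by (intro prod_zero) auto
      then show "poly (smult (\<xi> i / (\<Prod>j\<in>UNIV - {i}. x $ i - x $ j)) (\<Prod>j\<in>UNIV - {i}. [:- x $ j, 1:])) (x $ k)
          = (if i = k then \<xi> k else 0)"
        using nz by (auto simp: poly_prod)
    qed
    then show ?thesis by simp
  qed
  define l0 :: "'n rfun" where "l0 = (\<Sum>r\<le>degree h. rconst (coeff h r / of_nat (Suc r)) * (\<Sum>i\<in>UNIV. rvar i ^ Suc r))"
  have inv0: "ract w l0 = l0" if "bij w" for w
  proof -
    have "(\<Sum>i\<in>UNIV. rvar (w i) ^ Suc r) = (\<Sum>i\<in>UNIV. rvar i ^ Suc r :: 'n rfun)" for r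
      by (rule sum.reindex_bij_betw[OF that])
    then show ?thesis
      unfolding l0_def by (simp add: ract_sum ract_mult ract_power ract_var[OF that] del: power_Suc)
  qed
  have grad0: "ev (pd i l0) x = \<xi> i" for i
  proof -
    have "pd i (\<Sum>j\<in>UNIV. rvar j ^ Suc r) = of_nat (Suc r) * rvar i ^ r" for r
    proof -
      have "pd i (\<Sum>j\<in>UNIV. rvar j ^ Suc r) = (\<Sum>j\<in>UNIV. if i = j then of_nat (Suc r) * rvar i ^ r else 0)"
        unfolding pd_sum by (rule sum.cong[OF refl]) (simp add: pd_power pd_var del: power_Suc)
      then show ?thesis by simp
    qed
    then have "ev (pd i l0) x = (\<Sum>r\<le>degree h. coeff h r * (x $ i) ^ r)"
      using x by (simp add: l0_def pd_sum pd_mult del: power_Suc of_nat_Suc)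
    then show ?thesis using h[of i] by (simp add: poly_altdef)
  qed
  have "ev (l0 - rconst (ev l0 x)) x = 0" using x by simp
  moreover have "ract w (l0 - rconst (ev l0 x)) = l0 - rconst (ev l0 x)" if "bij w" for w
    using inv0[OF that] by (simp add: ract_diff)
  moreover have "ev (pd i (l0 - rconst (ev l0 x))) x = \<xi> i" for i
    using grad0 by (simp add: pd_diff)
  ultimately show ?thesis by blast
qed

text \<open>
  If the order of \<open>\<Sum>\<^sub>\<gamma> c\<^sub>\<gamma> \<partial>\<^sup>\<gamma>\<close> is \<open>N\<close>, then applying it to \<open>l\<^sup>N\<close> for a function \<open>l\<close> that vanishes at
  \<open>x\<close> with differential \<open>\<xi>\<close> gives \<open>N!\<close> times the value of the leading symbol at \<open>\<xi>\<close>.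
\<close>

lemma diffop_zero_on_symmetric:
  fixes x :: "'n::{finite,linorder} cvec"
  assumes x: "x \<in> reg_set" and fin: "finite K"
    and zero: "\<And>r. (\<forall>w. bij w \<longrightarrow> ract w r = r) \<Longrightarrow> (\<Sum>\<gamma>\<in>K. c \<gamma> * ev (op_monom pd \<gamma> r) x) = 0"
    and "\<gamma> \<in> K"
  shows "c \<gamma> = 0"
proof (rule ccontr)
  assume "c \<gamma> \<noteq> 0"
  define S where "S = {\<gamma>\<in>K. c \<gamma> \<noteq> 0}"
  define N where "N = Max (mdeg ` S)"
  have S: "finite S" "S \<noteq> {}" using fin \<open>c \<gamma> \<noteq> 0\<close> \<open>\<gamma> \<in> K\<close> by (auto simp: S_def)
  then have "N \<in> mdeg ` S" unfolding N_def by (intro Max_in) auto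
  then obtain \<beta> where \<beta>: "\<beta> \<in> S" "mdeg \<beta> = N" by blast
  have le: "mdeg \<gamma> \<le> N" if "\<gamma> \<in> S" for \<gamma> using that S by (simp add: N_def)
  define q where "q = (\<Sum>\<gamma>\<in>{\<gamma>\<in>S. mdeg \<gamma> = N}. Poly_Mapping.single \<gamma> (c \<gamma>))"
  define C where "C = (of_nat (\<Prod>j<N. N - j) :: complex)"
  have "C \<noteq> 0" by (auto simp: C_def)
  have "peval q \<xi> = 0" for \<xi> :: "'n cvec"
  proof -
    obtain l where l: "\<forall>w. bij w \<longrightarrow> ract w l = l" "ev l x = 0" "\<forall>i. ev (pd i l) x = \<xi> $ i"
      using symmetric_with_gradient[OF x, of "\<lambda>i. \<xi> $ i"] by blast
    have val: "ev (op_monom pd \<gamma> (l ^ N)) x = (if mdeg \<gamma> = N then C * mono_at (\<lambda>i. \<xi> $ i) \<gamma> else 0)"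
      if \<gamma>: "\<gamma> \<in> S" for \<gamma>
    proof -
      obtain s where "op_monom pd \<gamma> (l ^ N) =
          of_nat (\<Prod>j<mdeg \<gamma>. N - j) * l ^ (N - mdeg \<gamma>) * mono_at (\<lambda>i. pd i l) \<gamma> + l ^ Suc (N - mdeg \<gamma>) * s"
        using op_pd_power[OF le[OF \<gamma>], of l] by blast
      then show ?thesis using x l(2,3) le[OF \<gamma>] by (auto simp: C_def mono_at_def simp del: of_nat_prod)
    qed
    have "0 = (\<Sum>\<gamma>\<in>K. c \<gamma> * ev (op_monom pd \<gamma> (l ^ N)) x)"
      using zero[of "l ^ N"] l(1) by (simp add: ract_power)
    also have "\<dots> = (\<Sum>\<gamma>\<in>S. c \<gamma> * ev (op_monom pd \<gamma> (l ^ N)) x)"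
      using fin by (intro sum.mono_neutral_right) (auto simp: S_def)
    also have "\<dots> = (\<Sum>\<gamma>\<in>S. if mdeg \<gamma> = N then C * (c \<gamma> * mono_at (\<lambda>i. \<xi> $ i) \<gamma>) else 0)"
      by (rule sum.cong) (auto simp: val)
    also have "\<dots> = C * peval q \<xi>"
      using S(1) by (simp add: q_def pev.mev_sum pev.mev_single sum_distrib_left sum.inter_filter[symmetric])
    finally show ?thesis using \<open>C \<noteq> 0\<close> by simp
  qed
  then have "peval q = peval 0" by (auto simp: pev.mev_zero)
  then have "q = 0" using peval_inj by blast
  then have "lookup q \<beta> = 0" by simp
  moreover have "lookup q \<beta> = c \<beta>"
    using \<beta> S(1) by (simp add: q_def lookup_sum lookup_single when_def)
  ultimately show False using \<beta>(1) by (simp add: S_def)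
qed

lemma perm_fun_ev: "bij g \<Longrightarrow> perm_fun g (ev r) x = ev (ract g r) x"
  by (simp add: perm_fun_def perm_vec_def ev_ract inv_inv_eq)

lemma is_calogero_op_unique:
  fixes a b :: "'n::{finite,linorder} diffop"
  assumes a: "is_calogero_op m p a" and b: "is_calogero_op m p b"
  shows "a = b"
proof (rule poly_mapping_eqI, rule ext)
  fix \<gamma> and x :: "'n cvec"
  show "lookup a \<gamma> x = lookup b \<gamma> x"
  proof (cases "x \<in> reg_set")
    case False
    then show ?thesis using a b by (simp add: is_calogero_op_def)
  next
    case x: True
    let ?K = "insert \<gamma> (keys a \<union> keys b)"
    have K: "diffop_apply a' (ev r) x = (\<Sum>\<gamma>\<in>?K. lookup a' \<gamma> x * ev (op_monom pd \<gamma> r) x)"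
      if "a' = a \<or> a' = b" for a' r
      unfolding diffop_apply_def
      using that x by (intro sum.mono_neutral_cong_left)
        (auto simp: in_keys_iff op_dir_deriv_eq[of "ev r" r] tup_apply)
    have "(\<lambda>\<gamma>. lookup a \<gamma> x - lookup b \<gamma> x) \<gamma> = 0"
    proof (rule diffop_zero_on_symmetric[OF x, of ?K])
      fix r :: "'n rfun" assume r: "\<forall>w. bij w \<longrightarrow> ract w r = r"
      have "regular_fun (ev r)" by (auto simp: regular_fun_iff)
      moreover have "\<forall>g y. g permutes UNIV \<and> y \<in> reg_set \<longrightarrow> perm_fun g (ev r) y = ev r y"
        using r by (auto simp: perm_fun_ev permutes_bij)
      ultimately have "diffop_apply a (ev r) x = diffop_apply b (ev r) x"
        using a b x unfolding is_calogero_op_def by metis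
      then show "(\<Sum>\<gamma>\<in>?K. (lookup a \<gamma> x - lookup b \<gamma> x) * ev (op_monom pd \<gamma> r) x) = 0"
        by (simp only: K left_diff_distrib sum_subtractf simp_thms) simp
    qed auto
    then show ?thesis by simp
  qed
qed

text \<open>
  Uniqueness identifies the operator chosen by \<^const>\<open>calogero_op\<close>; the formula then holds for every
  invariant family, not only for the constant families that come from invariant functions.
\<close>

theorem calogero_op_apply:
  fixes p :: "'n::{finite,linorder} mpoly"
  assumes hom: "homogeneous d p" and "p \<noteq> 0" and F: "invariant F"
    and u: "\<And>y. y \<in> reg_set \<Longrightarrow> u y = ev (F id) y" and x: "x \<in> reg_set"
  shows "diffop_apply (calogero_op m p) u x = ev (psub m p F id) x"
proof -
  obtain a where a0: "\<And>\<gamma>. d < mdeg \<gamma> \<Longrightarrow> a \<gamma> = 0"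
    and a1: "\<And>\<gamma>. mdeg \<gamma> = d \<Longrightarrow> a \<gamma> = rconst (lookup p \<gamma>)"
    and a2: "\<And>F :: 'n tup. invariant F \<Longrightarrow> psub m p F = (\<Sum>\<gamma>\<in>{\<gamma>. mdeg \<gamma> \<le> d}. cst (a \<gamma>) * op_monom pdt \<gamma> F)"
    using psub_as_diffop[OF hom, of m] by blast
  define A :: "'n diffop" where "A = Abs_poly_mapping (\<lambda>\<gamma>. ev (a \<gamma>))"
  have A: "lookup A \<gamma> = ev (a \<gamma>)" for \<gamma>
  proof -
    have "{\<gamma>. ev (a \<gamma>) \<noteq> 0} \<subseteq> {\<gamma>. mdeg \<gamma> \<le> d}"
      using a0 by (auto simp: fun_eq_iff tup_apply) (metis ev_zero not_le)
    then have "finite {\<gamma>. ev (a \<gamma>) \<noteq> 0}" using finite_mdeg_le finite_subset by blast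
    then show ?thesis by (simp add: A_def)
  qed
  have apply_A: "diffop_apply A u x = ev (psub m p F v) x"
    if F: "invariant F" and u: "\<And>y. y \<in> reg_set \<Longrightarrow> u y = ev (F v) y" and x: "x \<in> reg_set" for u F v x
  proof -
    have keys: "keys A \<subseteq> {\<gamma>. mdeg \<gamma> \<le> d}"
      using a0 by (auto simp: in_keys_iff A fun_eq_iff tup_apply) (metis ev_zero not_le)
    have "diffop_apply A u x = (\<Sum>\<gamma>\<in>{\<gamma>. mdeg \<gamma> \<le> d}. ev (a \<gamma>) x * ev (op_monom pd \<gamma> (F v)) x)"
      unfolding diffop_apply_def
      using keys by (intro sum.mono_neutral_cong_left finite_mdeg_le)
        (auto simp: in_keys_iff A op_dir_deriv_eq[OF u x] tup_apply)
    also have "\<dots> = ev (psub m p F v) x"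
      using x by (simp add: a2[OF F] sum_fun_apply tup_apply op_pdt_apply)
    finally show ?thesis .
  qed
  have "is_calogero_op m p A"
    unfolding is_calogero_op_def
  proof (intro conjI allI impI ballI)
    show "regular_fun (lookup A \<alpha>)" for \<alpha> by (auto simp: A regular_fun_iff)
    show "lookup A \<alpha> x = 0" if "x \<notin> reg_set" for \<alpha> x using that by (simp add: A)
    show "highest_symbol A p"
      unfolding highest_symbol_def
    proof (intro conjI exI[of _ d] allI impI ballI)
      show "lookup A \<alpha> = 0" if "d < mdeg \<alpha>" for \<alpha>
        using that by (simp add: A a0 fun_eq_iff tup_apply)
    qed (use hom \<open>p \<noteq> 0\<close> in \<open>simp_all add: A a1\<close>)
  next
    fix u :: "'n cvec \<Rightarrow> complex" and x :: "'n cvec"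
    assume "regular_fun u \<and> (\<forall>g x. g permutes UNIV \<and> x \<in> reg_set \<longrightarrow> perm_fun g u x = u x)"
      and x: "x \<in> reg_set"
    then obtain r where r: "\<And>y. y \<in> reg_set \<Longrightarrow> u y = ev r y"
      and inv: "\<And>g y. bij g \<Longrightarrow> y \<in> reg_set \<Longrightarrow> perm_fun g u y = u y"
      unfolding regular_fun_iff by (metis bij_imp_permutes UNIV_I)
    have "ract g r = r" if "bij g" for g
    proof (rule rfun_eqI)
      fix y :: "'n cvec" assume y: "y \<in> reg_set"
      have "ev (ract g r) y = perm_fun g (ev r) y" by (simp add: perm_fun_ev[OF that])
      also have "\<dots> = perm_fun g u y"
        using r[of "\<chi> i. y $ g i"] that y by (simp add: perm_fun_def perm_vec_def inv_inv_eq perm_reg_set)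
      finally show "ev (ract g r) y = ev r y" using inv[OF that y] r[OF y] by simp
    qed
    then have "invariant (cst r)" by (simp add: invariant_def act_cst)
    from apply_A[OF this _ x, of u id] r have "diffop_apply A u x = ev (psub m p (cst r) id) x"
      by (simp add: tup_apply)
    also have "\<dots> = dunkl_subst m p u x"
      by (rule dunkl_subst_eq_psub[symmetric]) (simp_all add: r x tup_apply)
    finally show "diffop_apply A u x = dunkl_subst m p u x" .
  qed
  then have "calogero_op m p = A"
    unfolding calogero_op_def using is_calogero_op_unique by (intro the_equality) auto
  with apply_A[OF F u x] show ?thesis by (simp only:)
qed

section \<open>The lowest degree of harmonic polynomials\<close>

subsection \<open>Symmetric polynomials\<close>

definition symmetric :: "'n::{finite,linorder} mpoly \<Rightarrow> bool" where
  "symmetric p \<longleftrightarrow> (\<forall>w \<alpha>. bij w \<longrightarrow> lookup p (perm_exp w \<alpha>) = lookup p \<alpha>)"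

lemma mono_at_perm:
  assumes "bij w"
  shows "mono_at (\<lambda>i. X (w i)) \<alpha> = mono_at X (perm_exp w \<alpha>)"
proof -
  have "(\<Prod>i\<in>UNIV. X (w i) ^ lookup \<alpha> (inv w (w i))) = (\<Prod>i\<in>UNIV. X i ^ lookup \<alpha> (inv w i))"
    by (rule prod.reindex_bij_betw[OF assms])
  then show ?thesis using assms by (simp add: mono_at_def lookup_perm_exp bij_is_inj)
qed

lemma perm_fun_apply: "bij g \<Longrightarrow> perm_fun g f x = f (\<chi> i. x $ g i)"
  by (simp add: perm_fun_def perm_vec_def inv_inv_eq)

lemma symmetric_of_function:
  assumes "peval p \<in> symmetric_polys" shows "symmetric p"
  unfolding symmetric_def
proof (intro allI impI)
  fix w :: "'a \<Rightarrow> 'a" and \<alpha> assume w: "bij w"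
  define q where "q = (\<Sum>\<beta>\<in>keys p. Poly_Mapping.single (perm_exp w \<beta>) (lookup p \<beta>))"
  have "peval q = perm_fun w (peval p)"
  proof
    fix x
    have "peval p (\<chi> i. x $ w i) = (\<Sum>\<beta>\<in>keys p. lookup p \<beta> * mono_at (\<lambda>i. x $ w i) \<beta>)"
      by (simp add: peval_def mono_at_def)
    then show "peval q x = perm_fun w (peval p) x"
      using mono_at_perm[OF w, of "\<lambda>i. x $ i"]
      by (simp add: q_def pev.mev_sum pev.mev_single perm_fun_apply[OF w])
  qed
  also have "perm_fun w (peval p) = peval p"
    using assms bij_imp_permutes[of w UNIV] w by (auto simp: symmetric_polys_def)
  finally have "q = p" using peval_inj by blast
  moreover have "lookup q (perm_exp w \<alpha>) = lookup p \<alpha>"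
  proof -
    have "perm_exp w \<beta> = perm_exp w \<alpha> \<longleftrightarrow> \<beta> = \<alpha>" for \<beta>
      using perm_exp_inv(2)[OF w] by metis
    then show ?thesis by (simp add: q_def lookup_sum lookup_single when_def in_keys_iff)
  qed
  ultimately show "lookup p (perm_exp w \<alpha>) = lookup p \<alpha>" by simp
qed

lemma function_of_symmetric:
  assumes "symmetric p" shows "peval p \<in> symmetric_polys"
proof -
  have "perm_fun g (peval p) = peval p" if "g permutes UNIV" for g
  proof
    fix x
    have g: "bij g" using that by (rule permutes_bij)
    have "perm_fun g (peval p) x = (\<Sum>\<beta>\<in>keys p. lookup p (perm_exp g \<beta>) * mono_at (\<lambda>i. x $ i) (perm_exp g \<beta>))"
      using assms g by (simp add: perm_fun_apply peval_def mono_at_perm[symmetric] symmetric_def) (simp add: mono_at_def)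
    also have "\<dots> = (\<Sum>\<beta>\<in>keys p. lookup p \<beta> * mono_at (\<lambda>i. x $ i) \<beta>)"
      by (rule sum.reindex_bij_witness[where i = "perm_exp (inv g)" and j = "perm_exp g"])
        (use assms g in \<open>auto simp: perm_exp_inv in_keys_iff symmetric_def bij_imp_bij_inv\<close>)
    finally show "perm_fun g (peval p) x = peval p x" by (simp add: peval_def mono_at_def)
  qed
  then show ?thesis by (auto simp: symmetric_polys_def)
qed

lemma peval_at_zero: "peval p 0 = lookup p 0"
proof -
  have "mono_at (\<lambda>i. 0) \<alpha> = (if \<alpha> = 0 then 1 else 0 :: complex)" for \<alpha> :: "'a \<Rightarrow>\<^sub>0 nat"
    by (induction \<alpha> rule: exp_induct) (auto simp: mono_at_add)
  then show ?thesis
    by (auto simp: peval_def mono_at_def[symmetric] in_keys_iff if_distrib[of "(*) _"] cong: if_cong)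
qed

lemma act_psub:
  assumes "symmetric p" and w: "bij w"
  shows "act w (psub m p F) = psub m p (act w F)"
proof -
  have "act w (psub m p F) = (\<Sum>\<alpha>\<in>keys p. scal (lookup p (perm_exp w \<alpha>)) * op_monom (dunkl_tup m) (perm_exp w \<alpha>) (act w F))"
    using assms by (simp add: psub_def act_sum act_mult act_cst act_op_dunkl symmetric_def)
  also have "\<dots> = psub m p (act w F)"
    unfolding psub_def
    by (rule sum.reindex_bij_witness[where i = "perm_exp (inv w)" and j = "perm_exp w"])
      (use assms in \<open>auto simp: perm_exp_inv in_keys_iff symmetric_def bij_imp_bij_inv\<close>)
  finally show ?thesis .
qed

subsection \<open>The orbit family of a function\<close>

text \<open>
  The value at \<open>v\<close> is the function carried by the \<open>v\<close>-th translate of a fundamental chamber when \<open>r\<close>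
  is prescribed on the chamber itself and extended invariantly; it is \<open>0\<close> at maps \<open>v\<close> that are not
  permutations.
\<close>

definition orb :: "'n::{finite,linorder} rfun \<Rightarrow> 'n tup" where
  "orb r = (\<lambda>v. if bij v then ract v r else 0)"

lemma orb_id [simp]: "orb r id = r"
  by (simp add: orb_def)

lemma bij_inv_comp_iff: "bij w \<Longrightarrow> bij (inv w \<circ> v) \<longleftrightarrow> bij v"
  by (metis bij_comp bij_imp_bij_inv bij_is_surj comp_assoc id_comp surj_iff)

lemma invariant_orb: "invariant (orb r)"
  unfolding invariant_def
proof (intro allI impI ext)
  fix w v :: "'a \<Rightarrow> 'a" assume w: "bij w"
  have "w \<circ> (inv w \<circ> v) = v" using w by (metis bij_is_surj comp_assoc id_comp surj_iff)
  then show "act w (orb r) v = orb r v"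
    using w bij_inv_comp_iff[OF w, of v] by (auto simp: act_def orb_def ract_comp)
qed

lemma orb_zero [simp]: "orb 0 = 0"
  by (simp add: orb_def fun_eq_iff tup_apply)

lemma orb_add: "orb (r + s) = orb r + orb s"
  by (simp add: orb_def fun_eq_iff tup_apply ract_add)

lemma orb_scal: "orb (rconst c * r) = scal c * orb r"
  by (simp add: orb_def fun_eq_iff tup_apply ract_mult)

lemma orb_sum: "orb (sum f A) = (\<Sum>a\<in>A. orb (f a))"
  by (induction A rule: infinite_finite_induct) (simp_all add: orb_add)

lemma orb_eq_0_iff: "orb r = 0 \<longleftrightarrow> r = 0"
  by (metis orb_id orb_zero zero_fun_apply)

definition perm_supported :: "'n::{finite,linorder} tup \<Rightarrow> bool" where
  "perm_supported F \<longleftrightarrow> (\<forall>v. \<not> bij v \<longrightarrow> F v = 0)"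

lemma perm_supported_orb: "perm_supported (orb r)"
  by (simp add: perm_supported_def orb_def)

lemma perm_supported_dunkl_tup:
  assumes "perm_supported F" shows "perm_supported (dunkl_tup m i F)"
  unfolding perm_supported_def
proof (intro allI impI)
  fix v :: "'a \<Rightarrow> 'a" assume v: "\<not> bij v"
  have "sw i k F v = 0" for k
    using v assms bij_inv_comp_iff[of "tr i k" v] by (simp add: act_def perm_supported_def)
  with v assms show "dunkl_tup m i F v = 0"
    by (simp add: perm_supported_def dunkl_tup_def tup_apply sum_fun_apply ddiff_def pdt_def)
qed

lemma perm_supported_psub:
  assumes "perm_supported F" shows "perm_supported (psub m p F)"
proof -
  have "perm_supported (op_monom (dunkl_tup m) \<alpha> F)" for \<alpha>
    by (induction \<alpha> rule: exp_induct) (simp_all add: op_dunkl_unit perm_supported_dunkl_tup assms)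
  then show ?thesis by (simp add: psub_def perm_supported_def sum_fun_apply tup_apply)
qed

lemma invariant_eq_0:
  assumes "invariant F" "perm_supported F" "F id = 0" shows "F = 0"
proof
  fix v
  show "F v = 0 v"
  proof (cases "bij v")
    case True
    then have "F v = act v F v" using assms(1) by (simp add: invariant_def)
    also have "\<dots> = 0" using True assms(3) by (simp add: act_def bij_is_inj)
    finally show ?thesis by (simp add: tup_apply)
  qed (use assms(2) in \<open>simp add: perm_supported_def tup_apply\<close>)
qed

lemma psub_orb_eq_0:
  assumes "symmetric p" "psub m p (orb r) id = 0" shows "psub m p (orb r) = 0"
proof (rule invariant_eq_0)
  show "invariant (psub m p (orb r))"
    using invariant_orb[of r] by (simp add: invariant_def act_psub[OF assms(1)])
  show "perm_supported (psub m p (orb r))"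
    by (rule perm_supported_psub) (rule perm_supported_orb)
qed (rule assms(2))

lemma euler_cst_homogeneous:
  assumes "homogeneous d p" shows "euler (cst (rpoly p)) = of_nat d * cst (rpoly p)"
proof -
  have mono: "euler (cst (mono_at rvar \<alpha>)) = of_nat (mdeg \<alpha>) * cst (mono_at rvar \<alpha>)" for \<alpha> :: "'a \<Rightarrow>\<^sub>0 nat"
  proof (induction \<alpha> rule: exp_induct)
    case zero
    have "euler (1 :: 'a tup) = 0" using euler_of_nat[of 1] by simp
    then show ?case by simp
  next
    case (add i \<alpha>)
    have "euler (xvar i) = xvar i"
    proof -
      have "euler (xvar i) = (\<Sum>j\<in>UNIV. if j = i then xvar i else 0)"
        unfolding euler_def by (rule sum.cong) (auto simp: pdt_cst pd_var)
      then show ?thesis by simp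
    qed
    with add show ?case
      by (simp add: mono_at_add cst_mult euler_mult mdeg_add algebra_simps)
  qed
  have "cst (rpoly p) = (\<Sum>\<alpha>\<in>keys p. scal (lookup p \<alpha>) * cst (mono_at rvar \<alpha>))"
    unfolding rev.mev_def by (rule sym, rule ext) (simp add: sum_fun_apply tup_apply)
  moreover have "euler (\<Sum>\<alpha>\<in>keys p. scal (lookup p \<alpha>) * cst (mono_at rvar \<alpha>))
      = of_nat d * (\<Sum>\<alpha>\<in>keys p. scal (lookup p \<alpha>) * cst (mono_at rvar \<alpha>))"
    unfolding euler_sum sum_distrib_left
    by (rule sum.cong[OF refl]) (use assms in \<open>simp add: euler_scal mono homogeneous_def mult.left_commute\<close>)
  ultimately show ?thesis by simp
qed

lemma euler_orb_homogeneous: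
  assumes "homogeneous d p" shows "euler (orb (rpoly p)) = of_nat d * orb (rpoly p)"
proof
  fix v
  show "euler (orb (rpoly p)) v = (of_nat d * orb (rpoly p)) v"
  proof (cases "bij v")
    case True
    have "euler (orb (rpoly p)) v = euler (act v (cst (rpoly p))) v"
      using True by (simp add: euler_def sum_fun_apply tup_apply pdt_def orb_def act_cst)
    also have "\<dots> = act v (of_nat d * cst (rpoly p)) v"
      by (simp add: euler_act[OF True] euler_cst_homogeneous[OF assms])
    finally show ?thesis using True by (simp add: act_mult act_cst tup_apply orb_def)
  next
    case False
    then show ?thesis by (simp add: euler_def sum_fun_apply tup_apply pdt_def orb_def)
  qed
qed

subsection \<open>Nilpotency of the Dunkl operators\<close>

text \<open>Harmonicity of the family \<open>F\<close>, expressed without a choice of generators.\<close>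

definition killed_by_symmetric :: "nat \<Rightarrow> 'n::{finite,linorder} tup \<Rightarrow> bool" where
  "killed_by_symmetric m F \<longleftrightarrow> (\<forall>p. symmetric p \<and> lookup p 0 = 0 \<longrightarrow> psub m p F = 0)"

text \<open>
  Expanding \<open>0 = \<Prod>\<^sub>j (x\<^sub>i - x\<^sub>j)\<close> shows that \<open>x\<^sub>i\<^sup>n\<close> lies in the ideal generated by the symmetric
  polynomials without constant term.
\<close>

lemma psub_power_eq_0:
  fixes F :: "'n::{finite,linorder} tup"
  assumes "killed_by_symmetric m F"
  shows "psub m (mvar i ^ CARD('n)) F = 0"
proof -
  define e where "e = (\<lambda>k. \<Sum>B\<in>{B. card B = k}. \<Prod>j\<in>B. - mvar j :: 'n mpoly)"
  have e_eval: "peval (e k) x = (\<Sum>B\<in>{B. card B = k}. \<Prod>j\<in>B. - (x $ j))" for k x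
    by (simp add: e_def pev.mev_sum pev.mev_prod pev.mev_uminus pev.mev_var)
  have e_sym: "symmetric (e k)" for k
  proof (rule symmetric_of_function)
    have "perm_fun g (peval (e k)) x = peval (e k) x" if "g permutes UNIV" for g x
    proof -
      have g: "bij g" using that by (rule permutes_bij)
      then have inj: "inj_on g B" for B by (auto simp: bij_def inj_on_def)
      have "perm_fun g (peval (e k)) x = (\<Sum>B\<in>{B. card B = k}. \<Prod>j\<in>g ` B. - (x $ j))"
        by (simp add: perm_fun_apply[OF g] e_eval prod.reindex[OF inj])
      also have "\<dots> = (\<Sum>B\<in>{B. card B = k}. \<Prod>j\<in>B. - (x $ j))"
        by (rule sum.reindex_bij_witness[where i = "\<lambda>B. inv g ` B" and j = "\<lambda>B. g ` B"])
          (use g in \<open>auto simp: image_comp bij_is_inj bij_is_surj surj_iff[THEN iffD1] card_image inj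
             card_image[OF inj_on_subset[OF bij_is_inj[OF bij_imp_bij_inv]]]\<close>)
      finally show ?thesis by (simp add: e_eval)
    qed
    then show "peval (e k) \<in> symmetric_polys" by (auto simp: symmetric_polys_def)
  qed
  have e_const: "lookup (e k) 0 = 0" if "k > 0" for k
    using that by (simp add: peval_at_zero[symmetric] e_eval)
  have z1: "(\<Prod>j\<in>UNIV. mvar i + - mvar j) = (0 :: 'n mpoly)"
    by (rule prod_zero) (auto intro!: bexI[of _ i])
  have z2: "(\<Prod>j\<in>UNIV. mvar i + - mvar j) = (\<Sum>B\<in>UNIV. mvar i ^ (CARD('n) - card B) * (\<Prod>j\<in>B. - mvar j :: 'n mpoly))"
  proof -
    have "(\<Prod>j\<in>UNIV. - mvar j + mvar i) = (\<Sum>B\<in>Pow UNIV. (\<Prod>j\<in>B. - mvar j) * (\<Prod>j\<in>UNIV - B. mvar i :: 'n mpoly))"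
      by (rule prod_add) simp
    then show ?thesis by (simp add: card_Diff_subset add.commute mult.commute)
  qed
  have "0 = (\<Sum>B\<in>UNIV. mvar i ^ (CARD('n) - card B) * (\<Prod>j\<in>B. - mvar j :: 'n mpoly))"
    using z1 unfolding z2 by (rule sym)
  also have "\<dots> = (\<Sum>k\<le>CARD('n). \<Sum>B\<in>{B. card B = k}. mvar i ^ (CARD('n) - card B) * (\<Prod>j\<in>B. - mvar j))"
  proof -
    have "card ` (UNIV :: 'n set set) \<subseteq> {..CARD('n)}" by (auto intro: card_mono)
    then have "(\<Sum>k\<le>CARD('n). \<Sum>B\<in>{B \<in> UNIV. card B = k}. mvar i ^ (CARD('n) - card B) * (\<Prod>j\<in>B. - mvar j))
      = (\<Sum>B\<in>UNIV. mvar i ^ (CARD('n) - card B) * (\<Prod>j\<in>B. - mvar j :: 'n mpoly))"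
      by (intro sum.group) auto
    then show ?thesis by simp
  qed
  also have "\<dots> = (\<Sum>k\<le>CARD('n). mvar i ^ (CARD('n) - k) * e k)"
    by (simp add: e_def sum_distrib_left)
  also have "\<dots> = mvar i ^ CARD('n) * e 0 + (\<Sum>k\<in>{1..CARD('n)}. mvar i ^ (CARD('n) - k) * e k)"
    by (subst sum.remove[of _ 0]) (auto intro!: arg_cong2[where f = "(+)"] sum.cong)
  also have "e 0 = 1"
  proof -
    have "{B :: 'n set. card B = 0} = {{}}" by auto
    then show ?thesis by (simp add: e_def)
  qed
  finally have "0 = mvar i ^ CARD('n) + (\<Sum>k\<in>{1..CARD('n)}. mvar i ^ (CARD('n) - k) * e k)"
    by (simp only: mult_1_right)
  from arg_cong[OF this, of "\<lambda>p. psub m p F"]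
  have "0 = psub m (mvar i ^ CARD('n) + (\<Sum>k\<in>{1..CARD('n)}. mvar i ^ (CARD('n) - k) * e k)) F"
    by (simp only: psub_zero)
  also have "\<dots> = psub m (mvar i ^ CARD('n)) F"
    using assms e_sym e_const
    by (simp add: psub_add psub_sum psub_mult killed_by_symmetric_def)
  finally show ?thesis by simp
qed

lemma op_dunkl_nilpotent:
  fixes F :: "'n::{finite,linorder} tup"
  assumes "killed_by_symmetric m F" and "mdeg \<alpha> \<ge> CARD('n) * CARD('n)"
  shows "op_monom (dunkl_tup m) \<alpha> F = 0"
proof -
  have "\<exists>i. lookup \<alpha> i \<ge> CARD('n)"
  proof (rule ccontr)
    assume "\<nexists>i. lookup \<alpha> i \<ge> CARD('n)"
    then have "mdeg \<alpha> < (\<Sum>i\<in>(UNIV :: 'n set). CARD('n))"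
      unfolding mdeg_def by (intro sum_strict_mono) (auto simp: not_le)
    with assms(2) show False by simp
  qed
  then obtain i where i: "lookup \<alpha> i \<ge> CARD('n)" ..
  let ?\<beta> = "Poly_Mapping.single i (CARD('n))"
  have "mvar i ^ k = Poly_Mapping.single (Poly_Mapping.single i k) (1 :: complex)" for k
    by (induction k) (simp_all add: mult_single unit_exp_def single_add[symmetric])
  then have "op_monom (dunkl_tup m) ?\<beta> F = 0"
    using psub_power_eq_0[OF assms(1), of i] by (simp add: psub_single)
  moreover have "\<alpha> = (\<alpha> - ?\<beta>) + ?\<beta>"
    using i by (intro poly_mapping_eqI) (auto simp: lookup_add lookup_minus lookup_single when_def)
  ultimately show ?thesis by (metis op_dunkl_add op_dunkl_zero_arg)
qed

subsection \<open>The degree bound\<close>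

lemma act_eq_if_swaps:
  assumes "\<And>j k. sw j k F = F" and "bij w" shows "act w F = F"
proof -
  have "w permutes UNIV" using assms(2) by (rule bij_imp_permutes) simp
  then show ?thesis using finite
  proof (induction rule: permutes_induct)
    case id
    show ?case by (rule act_id)
  next
    case (swap a b p)
    have "act (tr a b \<circ> p) F = sw a b (act p F)"
      by (rule act_comp[symmetric]) (use swap in \<open>auto simp: permutes_bij\<close>)
    with swap assms(1) show ?case by (simp only:)
  qed
qed

lemma of_nat_mult_tup_eq_0:
  fixes F :: "'n::{finite,linorder} tup"
  assumes "of_nat k * F = 0" "k > 0" shows "F = 0"
proof -
  have "scal (1 / of_nat k) * (of_nat k * F) = scal (1 / of_nat k * of_nat k) * F"
    by (simp only: scal_mult rconst_of_nat cst_of_nat mult.assoc)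
  with assms show ?thesis by simp
qed

lemma op_dunkl_euler:
  "op_monom (dunkl_tup m) \<alpha> (euler F) =
    euler (op_monom (dunkl_tup m) \<alpha> F) + of_nat (mdeg \<alpha>) * op_monom (dunkl_tup m) \<alpha> F"
proof (induction \<alpha> rule: exp_induct)
  case (add i \<alpha>)
  let ?f = "op_monom (dunkl_tup m) \<alpha> F"
  have nat: "dunkl_tup m i (of_nat k * G) = of_nat k * dunkl_tup m i G" for k and G :: "'a tup"
    using dunkl_tup_scal[of m i "of_nat k" G] by (simp add: rconst_of_nat)
  have "op_monom (dunkl_tup m) (unit_exp i + \<alpha>) (euler F) = dunkl_tup m i (euler ?f) + of_nat (mdeg \<alpha>) * dunkl_tup m i ?f"
    unfolding op_dunkl_unit add by (simp add: dunkl_tup_add nat)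
  then show ?case
    unfolding op_dunkl_unit euler_dunkl_tup by (simp add: mdeg_add algebra_simps)
qed simp

lemma rconst_diff: "rconst (a - b) = rconst a - rconst b" by (rule rfun_eqI) simp

text \<open>
  Let \<open>k\<close> be the largest number of Dunkl operators whose product does not kill \<open>F\<close>. A nonzero
  product \<open>f\<close> of this length is killed by all Dunkl operators and has degree \<open>d - k\<close>, so the Euler
  identity makes it an eigenvector of the Laplacian of the transpositions. The gap leaves
  \<open>d - k \<ge> n m\<close>, where \<open>k = 0\<close> would make \<open>F\<close> constant, or \<open>d = k\<close> and all products of length \<open>k\<close> invariant; in the latter case \<open>f\<close> is an
  average of such products, that is a symmetric polynomial of Dunkl operators, which kills \<open>F\<close>.
\<close>

lemma degree_bound:
  fixes F :: "'n::{finite,linorder} tup"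
  assumes m: "m \<ge> 1" and d: "d \<ge> 1" and F: "invariant F" "F \<noteq> 0"
    and eu: "euler F = of_nat d * F" and kill: "killed_by_symmetric m F"
  shows "CARD('n) * m + 1 \<le> d \<and>
    (d = CARD('n) * m + 1 \<longrightarrow> (\<forall>i j. dunkl_tup m i (dunkl_tup m j F) = 0))"
proof -
  let ?op = "\<lambda>\<alpha>. op_monom (dunkl_tup m) \<alpha> F"
  define S where "S = {k. \<exists>\<alpha>. mdeg \<alpha> = k \<and> ?op \<alpha> \<noteq> 0}"
  have "S \<subseteq> {..CARD('n) * CARD('n)}"
    using op_dunkl_nilpotent[OF kill] by (fastforce simp: S_def)
  then have finS: "finite S" using finite_subset by blast
  have "0 \<in> S" using F(2) by (auto simp: S_def intro!: exI[of _ 0])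
  define k where "k = Max S"
  have "k \<in> S" using finS \<open>0 \<in> S\<close> unfolding k_def by (intro Max_in) auto
  then obtain \<alpha> where \<alpha>: "mdeg \<alpha> = k" "?op \<alpha> \<noteq> 0" by (auto simp: S_def)
  have big: "?op \<beta> = 0" if "mdeg \<beta> > k" for \<beta>
  proof (rule ccontr)
    assume "?op \<beta> \<noteq> 0"
    then have "mdeg \<beta> \<in> S" by (auto simp: S_def)
    then have "mdeg \<beta> \<le> k" unfolding k_def using finS by simp
    with that show False by simp
  qed
  define c where "c = (real d - real k) / real m"
  have eig: "lapl (?op \<beta>) = scal (complex_of_real (2 * c)) * ?op \<beta>" if "mdeg \<beta> = k" for \<beta>
  proof -
    have "dunkl_tup m i (?op \<beta>) = 0" for i
      using big[of "unit_exp i + \<beta>"] that by (simp add: mdeg_add op_dunkl_unit)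
    then have "2 * euler (?op \<beta>) = of_nat m * lapl (?op \<beta>)"
      using sum_xvar_dunkl_tup[of m "?op \<beta>"] by simp
    moreover have "euler (?op \<beta>) = scal (of_nat d - of_nat k) * ?op \<beta>"
    proof -
      have "scal (of_nat d - of_nat k) * ?op \<beta> = of_nat d * ?op \<beta> - of_nat k * ?op \<beta>"
        by (simp add: left_diff_distrib rconst_diff cst_diff rconst_of_nat)
      moreover have "euler (?op \<beta>) = of_nat d * ?op \<beta> - of_nat k * ?op \<beta>"
        using op_dunkl_euler[of m \<beta> F] op_dunkl_scal[of m \<beta> "of_nat d" F]
        unfolding that eu eq_diff_eq rconst_of_nat cst_of_nat by simp
      ultimately show ?thesis by (simp only:)
    qed
    ultimately have "scal (1 / of_nat m) * (of_nat m * lapl (?op \<beta>)) = scal (1 / of_nat m) * (2 * (scal (of_nat d - of_nat k) * ?op \<beta>))"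
      by simp
    moreover have "scal (1 / of_nat m) * (of_nat m * lapl (?op \<beta>)) = scal (1 / of_nat m * of_nat m) * lapl (?op \<beta>)"
      by (simp only: scal_mult rconst_of_nat cst_of_nat mult.assoc)
    moreover have "scal (1 / of_nat m) * (2 * (scal (of_nat d - of_nat k) * ?op \<beta>))
        = scal (1 / of_nat m * of_nat 2 * (of_nat d - of_nat k)) * ?op \<beta>"
      by (simp only: scal_mult rconst_of_nat cst_of_nat mult.assoc) simp
    moreover have "(1 / of_nat m * of_nat 2 * (of_nat d - of_nat k)) = complex_of_real (2 * c)"
      by (simp add: c_def)
    ultimately show ?thesis using m by simp
  qed
  have fin_W: "finite {w :: 'n \<Rightarrow> 'n. bij w}" by simp
  consider "c \<ge> real CARD('n)" | "c = 0" "\<forall>j k. sw j k (?op \<alpha>) = ?op \<alpha>"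
    using lapl_eigenvalue[OF eig[OF \<alpha>(1)]] \<alpha>(2) by blast
  then show ?thesis
  proof cases
    case 1
    have "k \<noteq> 0"
    proof
      assume "k = 0"
      have "dunkl_tup m i F = 0" for i
        using big[of "unit_exp i + 0"] \<open>k = 0\<close> by (simp only: op_dunkl_unit) (simp add: mdeg_add)
      moreover have "dunkl_tup m i F = pdt i F" for i
        using F(1) by (simp add: dunkl_tup_def ddiff_def invariant_def)
      ultimately have "euler F = 0" by (simp add: euler_def)
      with eu have "of_nat d * F = 0" by simp
      from of_nat_mult_tup_eq_0[OF this] d F(2) show False by simp
    qed
    have "real CARD('n) * real m \<le> real d - real k"
      using 1 m by (simp add: c_def pos_le_divide_eq)
    then have le: "CARD('n) * m + k \<le> d"
      by (metis add.commute le_diff_eq of_nat_add of_nat_le_iff of_nat_mult)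
    have "dunkl_tup m i (dunkl_tup m j F) = 0" if "d = CARD('n) * m + 1" for i j
    proof -
      have "k = 1" using le that \<open>k \<noteq> 0\<close> by simp
      then show ?thesis
        using big[of "unit_exp i + (unit_exp j + 0)"] by (simp only: op_dunkl_unit) (simp add: mdeg_add)
    qed
    with le \<open>k \<noteq> 0\<close> show ?thesis by auto
  next
    case 2
    have "k = d" using 2(1) m by (simp add: c_def)
    have inv: "act w (?op \<alpha>) = ?op \<alpha>" if "bij w" for w
      by (rule act_eq_if_swaps[OF _ that]) (rule 2(2)[rule_format])
    \<comment> \<open>The orbit sum of the monomial \<open>x\<^sup>\<alpha>\<close>; it has no constant term because \<open>k = d \<ge> 1\<close>.\<close>
    define q where "q = (\<Sum>w\<in>{w. bij w}. Poly_Mapping.single (perm_exp w \<alpha>) (1 :: complex))"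
    have "symmetric q"
      unfolding symmetric_def
    proof (intro allI impI)
      fix v :: "'n \<Rightarrow> 'n" and \<beta> assume v: "bij v"
      have "lookup q (perm_exp v \<beta>) = (\<Sum>w\<in>{w. bij w}. if perm_exp w \<alpha> = perm_exp v \<beta> then 1 else 0)"
        by (simp add: q_def lookup_sum lookup_single when_def)
      also have "\<dots> = (\<Sum>w\<in>{w. bij w}. if perm_exp (v \<circ> w) \<alpha> = perm_exp v \<beta> then 1 else 0)"
        by (rule sum.reindex_bij_witness[where i = "\<lambda>w. v \<circ> w" and j = "\<lambda>w. inv v \<circ> w"])
          (use v in \<open>auto simp: bij_comp bij_imp_bij_inv comp_assoc[symmetric] surj_iff[THEN iffD1] bij_is_surj bij_is_inj\<close>)
      also have "\<dots> = (\<Sum>w\<in>{w. bij w}. if perm_exp w \<alpha> = \<beta> then 1 else 0)"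
      proof (intro sum.cong refl)
        fix w :: "'n \<Rightarrow> 'n" assume "w \<in> {w. bij w}"
        then have "perm_exp (v \<circ> w) \<alpha> = perm_exp v \<beta> \<longleftrightarrow> perm_exp w \<alpha> = \<beta>"
          using v by (metis mem_Collect_eq perm_exp_comp perm_exp_inv(2))
        then show "(if perm_exp (v \<circ> w) \<alpha> = perm_exp v \<beta> then 1 else 0) = (if perm_exp w \<alpha> = \<beta> then 1 else (0 :: complex))"
          by simp
      qed
      also have "\<dots> = lookup q \<beta>" by (simp add: q_def lookup_sum lookup_single when_def)
      finally show "lookup q (perm_exp v \<beta>) = lookup q \<beta>" .
    qed
    moreover have "lookup q 0 = 0"
    proof -
      have "perm_exp w \<alpha> \<noteq> 0" if "bij w" for w
        using \<alpha>(1) \<open>k = d\<close> d mdeg_perm_exp[OF that, of \<alpha>] by (metis mdeg_zero not_one_le_zero)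
      then show ?thesis by (simp add: q_def lookup_sum lookup_single when_def)
    qed
    ultimately have "psub m q F = 0" using kill by (simp add: killed_by_symmetric_def)
    moreover have "psub m q F = (\<Sum>w\<in>{w. bij w}. act w (?op \<alpha>))"
      using F(1) by (simp add: q_def psub_sum psub_single act_op_dunkl invariant_def)
    ultimately have "of_nat (card {w :: 'n \<Rightarrow> 'n. bij w}) * ?op \<alpha> = 0"
      by (simp add: inv)
    moreover have "card {w :: 'n \<Rightarrow> 'n. bij w} > 0"
      using fin_W by (auto simp: card_gt_0_iff intro!: exI[of _ id])
    ultimately have "?op \<alpha> = 0" by (rule of_nat_mult_tup_eq_0)
    with \<alpha>(2) show ?thesis by simp
  qed
qed

section \<open>The integrals of lowest degree\<close>

subsection \<open>Calculus of polynomials in \<open>t\<close> with coefficients in \<open>\<complex>[x]\<close>\<close>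

lemma mpartial_zero [simp]: "mpartial i 0 = 0"
  by (rule poly_mapping_eqI) (simp add: lookup_mpartial)

text \<open>The product rule is inherited from the rational functions, where it holds for analytic reasons.\<close>

lemma mpartial_mult:
  "mpartial i (p * q) = mpartial i p * q + p * mpartial i (q :: 'n::{finite,linorder} mpoly)"
  by (rule rpoly_inj) (simp add: rev.mev_mult rev.mev_add pd_rpoly[symmetric] pd_mult)

lemma mpartial_uminus: "mpartial i (- p) = - mpartial i p"
  by (rule poly_mapping_eqI) (simp add: lookup_mpartial)

lemma mpartial_diff: "mpartial i (p - q) = mpartial i p - mpartial i q"
  by (rule poly_mapping_eqI) (simp add: lookup_mpartial lookup_minus algebra_simps)

lemma mpartial_sum: "mpartial i (sum f A) = (\<Sum>a\<in>A. mpartial i (f a))"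
  by (induction A rule: infinite_finite_induct) (simp_all add: mpartial_add)

lemma mpartial_const [simp]: "mpartial i (mconst c) = 0"
  by (simp add: mpartial_single)

lemma mpartial_one [simp]: "mpartial i 1 = 0"
  using mpartial_const[of i 1] by simp

lemma mpartial_of_nat [simp]: "mpartial i (of_nat k) = 0"
  using mpartial_const[of i "of_nat k"] by simp

lemma mpartial_var: "mpartial i (mvar j) = (if i = j then 1 else 0)"
  by (simp add: mpartial_single lookup_unit_exp)

definition dpoly :: "'n \<Rightarrow> 'n::{finite,linorder} mpoly poly \<Rightarrow> 'n mpoly poly" where
  "dpoly i = map_poly (mpartial i)"

lemma coeff_dpoly [simp]: "coeff (dpoly i Q) k = mpartial i (coeff Q k)"
  by (simp add: dpoly_def coeff_map_poly)

lemma dpoly_mult: "dpoly i (P * Q) = dpoly i P * Q + P * dpoly i Q"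
  by (rule poly_eqI) (simp add: coeff_mult mpartial_sum mpartial_mult sum.distrib)

lemma dpoly_one [simp]: "dpoly i 1 = 0"
  by (rule poly_eqI) (simp add: coeff_1)

lemma dpoly_power_Suc: "dpoly i (Q ^ Suc k) = of_nat (Suc k) * Q ^ k * dpoly i Q"
  by (induction k) (simp_all add: dpoly_mult algebra_simps)

lemma dpoly_prod_zero: "(\<And>k. k \<in> A \<Longrightarrow> dpoly i (f k) = 0) \<Longrightarrow> dpoly i (prod f A) = 0"
  by (induction A rule: infinite_finite_induct) (simp_all add: dpoly_mult)

definition antideriv :: "'n::{finite,linorder} mpoly poly \<Rightarrow> 'n mpoly poly" where
  "antideriv Q = Abs_poly (\<lambda>k. if k = 0 then 0 else coeff Q (k - 1) * mconst (1 / of_nat k))"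

lemma coeff_antideriv:
  "coeff (antideriv Q) k = (if k = 0 then 0 else coeff Q (k - 1) * mconst (1 / of_nat k))"
proof -
  have "(if i = 0 then 0 else coeff Q (i - 1) * mconst (1 / of_nat i)) = 0" if "i > Suc (degree Q)" for i
    using that by (simp add: coeff_eq_0)
  then show ?thesis unfolding antideriv_def by (subst coeff_Abs_poly[where n = "Suc (degree Q)"]) auto
qed

lemma of_nat_mconst_cancel: "of_nat (Suc k) * (p * mconst (1 / of_nat (Suc k))) = (p :: 'n::{finite,linorder} mpoly)"
proof -
  have "of_nat (Suc k) * mconst (1 / of_nat (Suc k)) = (1 :: 'n mpoly)"
    unfolding single_of_nat[symmetric] mult_single by (simp del: of_nat_Suc)
  then show ?thesis by (metis mult.left_commute mult.right_neutral)
qed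

lemma pderiv_antideriv: "pderiv (antideriv Q) = Q"
  by (rule poly_eqI) (simp add: coeff_pderiv coeff_antideriv of_nat_mconst_cancel del: of_nat_Suc)

lemma antideriv_pderiv: "antideriv (pderiv Q) = Q - [:coeff Q 0:]"
proof (rule poly_eqI)
  fix k show "coeff (antideriv (pderiv Q)) k = coeff (Q - [:coeff Q 0:]) k"
    by (cases k) (simp_all add: coeff_antideriv coeff_pderiv mult.assoc of_nat_mconst_cancel del: of_nat_Suc)
qed

lemma antideriv_add: "antideriv (P + Q) = antideriv P + antideriv Q"
  by (rule poly_eqI) (simp add: coeff_antideriv distrib_right)

lemma antideriv_diff: "antideriv (P - Q) = antideriv P - antideriv Q"
  by (rule poly_eqI) (simp add: coeff_antideriv left_diff_distrib)

lemma antideriv_smult: "antideriv (smult c Q) = smult c (antideriv Q)"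
  by (rule poly_eqI) (simp add: coeff_antideriv mult.assoc)

lemma dpoly_antideriv: "dpoly i (antideriv Q) = antideriv (dpoly i Q)"
  by (rule poly_eqI) (simp add: coeff_antideriv mpartial_mult)

lemma mpartial_poly:
  "mpartial i (poly R (mvar b)) = poly (dpoly i R) (mvar b) + (if i = b then poly (pderiv R) (mvar b) else 0)"
proof (induction R)
  case 0
  show ?case by (simp add: dpoly_def)
next
  case (pCons c R)
  have "dpoly i (pCons c R) = pCons (mpartial i c) (dpoly i R)"
    by (simp add: dpoly_def map_poly_pCons)
  with pCons show ?case
    by (simp add: mpartial_add mpartial_mult mpartial_var pderiv_pCons algebra_simps)
qed

text \<open>The integral of \<open>Q\<close> from \<open>x\<^sub>a\<close> to \<open>x\<^sub>b\<close>.\<close>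

definition intg :: "'n \<Rightarrow> 'n \<Rightarrow> 'n::{finite,linorder} mpoly poly \<Rightarrow> 'n mpoly" where
  "intg a b Q = poly (antideriv Q) (mvar b) - poly (antideriv Q) (mvar a)"

lemma intg_diff: "intg a b (P - Q) = intg a b P - intg a b Q"
  by (simp add: intg_def antideriv_diff)

lemma intg_add: "intg a b (P + Q) = intg a b P + intg a b Q"
  by (simp add: intg_def antideriv_add)

lemma intg_zero [simp]: "intg a b 0 = 0"
  using intg_add[of a b 0 0] by simp

lemma intg_sum: "intg a b (sum f A) = (\<Sum>k\<in>A. intg a b (f k))"
  by (induction A rule: infinite_finite_induct) (simp_all add: intg_add)

lemma intg_smult: "intg a b (smult c Q) = c * intg a b Q"
  by (simp add: intg_def antideriv_smult right_diff_distrib)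

lemma intg_pderiv: "intg a b (pderiv Q) = poly Q (mvar b) - poly Q (mvar a)"
  by (simp add: intg_def antideriv_pderiv)

text \<open>Differentiation under the integral; the assumptions remove the boundary terms.\<close>

lemma mpartial_intg:
  assumes "i = a \<Longrightarrow> poly Q (mvar a) = 0" "i = b \<Longrightarrow> poly Q (mvar b) = 0"
  shows "mpartial i (intg a b Q) = intg a b (dpoly i Q)"
  using assms by (simp add: intg_def mpartial_diff mpartial_poly dpoly_antideriv pderiv_antideriv)

subsection \<open>The master polynomial and its derivatives\<close>

definition lin :: "'n \<Rightarrow> 'n::{finite,linorder} mpoly poly" where
  "lin k = [:- mvar k, 1:]"

definition master :: "nat \<Rightarrow> 'n::{finite,linorder} mpoly poly" where
  "master m = (\<Prod>k\<in>UNIV. lin k ^ m)"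

text \<open>\<open>\<Prod>\<^sub>k (t - x\<^sub>k)\<^sup>m\<close> divided by \<open>t - x\<^sub>i\<close>, and by \<open>(t - x\<^sub>i) (t - x\<^sub>j)\<close>.\<close>

definition master1 :: "nat \<Rightarrow> 'n \<Rightarrow> 'n::{finite,linorder} mpoly poly" where
  "master1 m i = lin i ^ (m - 1) * (\<Prod>k\<in>UNIV - {i}. lin k ^ m)"

definition master2 :: "nat \<Rightarrow> 'n \<Rightarrow> 'n \<Rightarrow> 'n::{finite,linorder} mpoly poly" where
  "master2 m i j = lin i ^ (m - 1) * lin j ^ (m - 1) * (\<Prod>k\<in>UNIV - {i, j}. lin k ^ m)"

lemma poly_lin: "poly (lin k) (mvar b) = mvar b - mvar k"
  by (simp add: lin_def)

lemma dpoly_lin: "dpoly i (lin k) = (if i = k then - 1 else 0)"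
proof -
  have "dpoly i (lin k) = [:- mpartial i (mvar k):]"
    by (simp add: dpoly_def lin_def map_poly_pCons mpartial_uminus)
  then show ?thesis by (simp add: mpartial_var one_pCons)
qed

lemma dpoly_lin_power:
  assumes "m \<ge> 1" shows "dpoly i (lin k ^ m) = (if i = k then - of_nat m * lin k ^ (m - 1) else 0)"
proof -
  have "dpoly i (lin k ^ Suc (m - 1)) = of_nat (Suc (m - 1)) * lin k ^ (m - 1) * dpoly i (lin k)"
    by (rule dpoly_power_Suc)
  with assms show ?thesis by (simp add: dpoly_lin)
qed

lemma lin_power_pred: "m \<ge> 1 \<Longrightarrow> lin k ^ m = lin k * lin k ^ (m - 1)"
  by (cases m) auto

lemma master_split: "master m = lin i ^ m * (\<Prod>k\<in>UNIV - {i}. lin k ^ m)"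
  unfolding master_def by (rule prod.remove) auto

lemma master1_split:
  assumes "i \<noteq> j"
  shows "master1 m i = lin j ^ m * (lin i ^ (m - 1) * (\<Prod>k\<in>UNIV - {i, j}. lin k ^ m))"
proof -
  have "(\<Prod>k\<in>UNIV - {i}. lin k ^ m) = lin j ^ m * (\<Prod>k\<in>UNIV - {i} - {j}. lin k ^ m)"
    using assms by (intro prod.remove) auto
  moreover have "UNIV - {i} - {j} = UNIV - {i, j}" by auto
  ultimately show ?thesis by (simp add: master1_def mult.left_commute)
qed

lemma dpoly_master:
  assumes "m \<ge> 1" shows "dpoly i (master m) = - of_nat m * master1 m i"
proof -
  have "dpoly i (\<Prod>k\<in>UNIV - {i}. lin k ^ m) = 0"
    by (rule dpoly_prod_zero) (simp add: dpoly_lin_power[OF assms])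
  then show ?thesis
    unfolding master_split[of m i] dpoly_mult
    by (simp add: dpoly_lin_power[OF assms] master1_def mult.assoc)
qed

lemma dpoly_master1:
  assumes "m \<ge> 1" "i \<noteq> j" shows "dpoly j (master1 m i) = - of_nat m * master2 m i j"
proof -
  have "dpoly j (lin i ^ (m - 1)) = 0"
    using assms(2) dpoly_power_Suc[of j "lin i" "m - 2"] by (cases "m - 1") (simp_all add: dpoly_lin dpoly_mult dpoly_power_Suc del: power_Suc)
  moreover have "dpoly j (\<Prod>k\<in>UNIV - {i, j}. lin k ^ m) = 0"
    by (rule dpoly_prod_zero) (auto simp: dpoly_lin_power[OF assms(1)])
  ultimately show ?thesis
    unfolding master1_split[OF assms(2)] dpoly_mult
    by (simp add: dpoly_lin_power[OF assms(1)] master2_def mult.assoc mult.left_commute)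
qed

lemma master1_diff:
  assumes "m \<ge> 1" "i \<noteq> j"
  shows "master1 m i - master1 m j = smult (mvar i - mvar j) (master2 m i j)"
proof -
  let ?R = "\<Prod>k\<in>UNIV - {i, j}. lin k ^ m"
  have "master1 m i = lin j * master2 m i j"
    using master1_split[OF assms(2), of m] lin_power_pred[OF assms(1), of j]
    by (simp add: master2_def mult.assoc mult.left_commute)
  moreover have "master1 m j = lin i * master2 m i j"
    using master1_split[OF assms(2)[symmetric], of m] lin_power_pred[OF assms(1), of i]
    by (simp add: master2_def mult.assoc mult.left_commute insert_commute)
  moreover have "lin j - lin i = [:mvar i - mvar j:]"
    by (simp add: lin_def)
  ultimately show ?thesis by (simp add: left_diff_distrib[symmetric])
qed

lemma pderiv_master:
  assumes "m \<ge> 1" shows "pderiv (master m) = of_nat m * (\<Sum>i\<in>UNIV. master1 m i)"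
proof -
  have "pderiv (lin i) = (1 :: 'a mpoly poly)" for i
    by (simp add: lin_def pderiv_pCons one_pCons)
  then have "pderiv (lin i ^ m) = of_nat m * lin i ^ (m - 1)" for i :: 'a
    using assms by (simp add: pderiv_power of_nat_poly)
  then show ?thesis
    unfolding master_def pderiv_prod master1_def
    by (simp add: sum_distrib_left mult.assoc mult.left_commute mult.commute)
qed

lemma poly_master: "m \<ge> 1 \<Longrightarrow> poly (master m) (mvar b) = 0"
  by (simp add: master_split[of m b] poly_lin)

lemma poly_master1: "m \<ge> 1 \<Longrightarrow> b \<noteq> i \<Longrightarrow> poly (master1 m i) (mvar b) = 0"
  by (simp add: master1_split[of i b] poly_lin)

definition phi_poly :: "nat \<Rightarrow> 'n \<Rightarrow> 'n \<Rightarrow> 'n::{finite,linorder} mpoly" where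
  "phi_poly m a b = mconst (- 1 / of_nat m) * intg a b (master m)"

lemma intg_of_nat: "intg a b (of_nat k * Q) = of_nat k * intg a b Q"
proof -
  have "of_nat k * Q = smult (of_nat k) Q" by (simp add: of_nat_poly)
  then show ?thesis by (simp only: intg_smult)
qed

lemma intg_uminus: "intg a b (- Q) = - intg a b Q"
  using intg_diff[of a b 0 Q] by simp

lemma mpartial_phi_poly:
  assumes "m \<ge> 1" shows "mpartial i (phi_poly m a b) = intg a b (master1 m i)"
proof -
  have "mpartial i (phi_poly m a b) = mconst (- 1 / of_nat m) * - (of_nat m * intg a b (master1 m i))"
    by (simp add: phi_poly_def mpartial_mult mpartial_intg poly_master[OF assms] dpoly_master[OF assms]
        intg_of_nat intg_uminus)
  also have "\<dots> = - ((mconst (- 1 / of_nat m) * of_nat m) * intg a b (master1 m i))"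
    by (simp only: mult_minus_right mult.assoc)
  also have "mconst (- 1 / of_nat m) * of_nat m = (- 1 :: 'a mpoly)"
    unfolding single_of_nat[symmetric] mult_single using assms by (simp add: single_uminus)
  finally show ?thesis by simp
qed

text \<open>
  The partial fraction \<open>(x\<^sub>i - x\<^sub>j) / ((t - x\<^sub>i) (t - x\<^sub>j)) = 1 / (t - x\<^sub>i) - 1 / (t - x\<^sub>j)\<close> under the
  integral.
\<close>

lemma mpartial_mpartial_phi_poly:
  assumes "m \<ge> 1" "i \<noteq> j"
  shows "(mvar i - mvar j) * mpartial j (mpartial i (phi_poly m a b))
    = - of_nat m * (mpartial i (phi_poly m a b) - mpartial j (phi_poly m a b))"
proof -
  have "mpartial j (mpartial i (phi_poly m a b)) = intg a b (dpoly j (master1 m i))"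
    unfolding mpartial_phi_poly[OF assms(1)]
    by (rule mpartial_intg) (use assms in \<open>auto intro!: poly_master1\<close>)
  also have "\<dots> = - (of_nat m * intg a b (master2 m i j))"
    by (simp add: dpoly_master1[OF assms] intg_of_nat intg_uminus)
  finally have "(mvar i - mvar j) * mpartial j (mpartial i (phi_poly m a b))
      = - (of_nat m * intg a b (smult (mvar i - mvar j) (master2 m i j)))"
    by (simp add: intg_smult mult.left_commute)
  also have "\<dots> = - (of_nat m * (intg a b (master1 m i) - intg a b (master1 m j)))"
    by (simp only: master1_diff[OF assms, symmetric] intg_diff)
  finally show ?thesis by (simp add: mpartial_phi_poly[OF assms(1)])
qed

lemma sum_mpartial_phi_poly:
  assumes "m \<ge> 1" shows "(\<Sum>i\<in>UNIV. mpartial i (phi_poly m a b)) = 0"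
proof -
  have "of_nat m * (\<Sum>i\<in>UNIV. mpartial i (phi_poly m a b)) = intg a b (pderiv (master m))"
    by (simp add: mpartial_phi_poly[OF assms] pderiv_master[OF assms] intg_of_nat intg_sum)
  also have "\<dots> = 0" by (simp add: intg_pderiv poly_master[OF assms])
  finally show ?thesis using assms by simp
qed

subsection \<open>Flatness: products of two Dunkl operators vanish\<close>

lemma dunkl_tup_orb: "dunkl_tup m i (orb r) = pdt i (orb r)"
  using invariant_orb[of r] by (simp add: dunkl_tup_def ddiff_def invariant_def)

lemma dunkl_dunkl_orb_id:
  "dunkl_tup m j (dunkl_tup m i (orb r)) id =
    pd j (pd i r) + of_nat m * (\<Sum>k\<in>UNIV. rinv j k * (pd (tr j k i) r - pd i r))"
proof -
  have sw: "sw j k (pdt i (orb r)) = pdt (tr j k i) (orb r)" for k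
    using invariant_orb[of r] by (simp add: act_pdt invariant_def)
  have "dunkl_tup m j G id = pd j (G id) + of_nat m * (\<Sum>k\<in>UNIV. rinv j k * (sw j k G id - G id))" for G
    by (simp add: dunkl_tup_def ddiff_def tup_apply sum_fun_apply pdt_def)
  from this[of "pdt i (orb r)"] show ?thesis
    unfolding dunkl_tup_orb sw by (simp add: pdt_def)
qed

lemma dunkl_dunkl_orb_eq_0:
  assumes "\<And>i j. dunkl_tup m j (dunkl_tup m i (orb r)) id = 0"
  shows "dunkl_tup m j (dunkl_tup m i (orb r)) = 0"
proof
  fix v
  show "dunkl_tup m j (dunkl_tup m i (orb r)) v = 0 v"
  proof (cases "bij v")
    case True
    have eq: "dunkl_tup m j (dunkl_tup m i (orb r)) = act v (dunkl_tup m (inv v j) (dunkl_tup m (inv v i) (orb r)))"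
      using True invariant_orb[of r] by (simp add: act_dunkl_tup invariant_def bij_is_surj surj_f_inv_f)
    have "act v (dunkl_tup m (inv v j) (dunkl_tup m (inv v i) (orb r))) v = 0"
      using True assms by (simp add: act_def bij_is_inj)
    with fun_cong[OF eq, of v] show ?thesis by (simp add: tup_apply)
  next
    case False
    have "perm_supported (dunkl_tup m j (dunkl_tup m i (orb r)))"
      by (intro perm_supported_dunkl_tup perm_supported_orb)
    with False show ?thesis by (simp add: perm_supported_def tup_apply)
  qed
qed

lemma sum_dunkl_orb_eq_0:
  assumes "(\<Sum>i\<in>UNIV. pd i r) = 0"
  shows "(\<Sum>i\<in>UNIV. dunkl_tup m i (orb r)) = 0"
proof (rule invariant_eq_0)
  show "invariant (\<Sum>i\<in>UNIV. dunkl_tup m i (orb r))"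
    unfolding invariant_def
  proof (intro allI impI)
    fix w :: "'a \<Rightarrow> 'a" assume w: "bij w"
    then have "act w (\<Sum>i\<in>UNIV. dunkl_tup m i (orb r)) = (\<Sum>i\<in>UNIV. dunkl_tup m (w i) (orb r))"
      using invariant_orb[of r] by (simp add: act_sum act_dunkl_tup invariant_def)
    also have "\<dots> = (\<Sum>i\<in>UNIV. dunkl_tup m i (orb r))"
      by (rule sum.reindex_bij_betw[OF w])
    finally show "act w (\<Sum>i\<in>UNIV. dunkl_tup m i (orb r)) = (\<Sum>i\<in>UNIV. dunkl_tup m i (orb r))" .
  qed
  have "perm_supported (dunkl_tup m i (orb r))" for i
    by (intro perm_supported_dunkl_tup perm_supported_orb)
  then show "perm_supported (\<Sum>i\<in>UNIV. dunkl_tup m i (orb r))"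
    by (simp add: perm_supported_def sum_fun_apply)
  show "(\<Sum>i\<in>UNIV. dunkl_tup m i (orb r)) id = 0"
    using assms unfolding dunkl_tup_orb by (simp add: sum_fun_apply pdt_def)
qed

lemma phi_poly_sum_dunkl:
  assumes "m \<ge> 1" shows "(\<Sum>i\<in>UNIV. dunkl_tup m i (orb (rpoly (phi_poly m a b)))) = 0"
  by (rule sum_dunkl_orb_eq_0)
    (simp add: pd_rpoly rev.mev_sum[symmetric] sum_mpartial_phi_poly[OF assms] rev.mev_zero)

text \<open>
  The differential equations give this for two different operators. The square of an operator is
  reached through the sum of all operators, which annihilates the integral.
\<close>

lemma phi_poly_flat:
  assumes "m \<ge> 1" shows "dunkl_tup m j (dunkl_tup m i (orb (rpoly (phi_poly m a b)))) = 0"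
proof (rule dunkl_dunkl_orb_eq_0)
  fix i j
  let ?r = "rpoly (phi_poly m a b)" and ?F = "orb (rpoly (phi_poly m a b))"
  have off: "dunkl_tup m j (dunkl_tup m i ?F) id = 0" if "i \<noteq> j" for i j
  proof -
    have "(\<Sum>k\<in>UNIV. rinv j k * (pd (tr j k i) ?r - pd i ?r)) = (\<Sum>k\<in>UNIV. if k = i then rinv j i * (pd j ?r - pd i ?r) else 0)"
      by (rule sum.cong) (use that in \<open>auto simp: Transposition.transpose_def\<close>)
    then have 1: "dunkl_tup m j (dunkl_tup m i ?F) id = pd j (pd i ?r) + of_nat m * (rinv j i * (pd j ?r - pd i ?r))"
      by (simp add: dunkl_dunkl_orb_id)
    have "(rvar i - rvar j) * pd j (pd i ?r) = - of_nat m * (pd i ?r - pd j ?r)"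
      using arg_cong[OF mpartial_mpartial_phi_poly[OF assms that, of a b], of rpoly]
      by (simp add: pd_rpoly rev.mev_mult rev.mev_diff rev.mev_uminus rev.mev_var
          rev.mev_const[of "of_nat m", simplified] rconst_of_nat)
    then have "rinv i j * (rvar i - rvar j) * pd j (pd i ?r) = rinv i j * (- of_nat m * (pd i ?r - pd j ?r))"
      by (simp only: mult.assoc)
    then have "pd j (pd i ?r) = rinv i j * (- of_nat m * (pd i ?r - pd j ?r))"
      by (simp only: rinv_cancel[OF that] mult_1_left)
    with 1 show ?thesis by (simp add: rinv_swap[of j i] algebra_simps)
  qed
  show "dunkl_tup m j (dunkl_tup m i ?F) id = 0"
  proof (cases "i = j")
    case True
    have lin: "dunkl_tup m j (sum f A) = (\<Sum>k\<in>A. dunkl_tup m j (f k))" for f :: "'a \<Rightarrow> 'a tup" and A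
      by (induction A rule: infinite_finite_induct) (simp_all add: dunkl_tup_add)
    have "0 = dunkl_tup m j (\<Sum>k\<in>UNIV. dunkl_tup m k ?F) id"
      by (simp add: phi_poly_sum_dunkl[OF assms] tup_apply)
    also have "\<dots> = (\<Sum>k\<in>UNIV. dunkl_tup m j (dunkl_tup m k ?F) id)"
      by (simp add: lin sum_fun_apply)
    also have "\<dots> = (\<Sum>k\<in>UNIV. if k = j then dunkl_tup m j (dunkl_tup m j ?F) id else 0)"
      by (rule sum.cong) (auto simp: off)
    finally show ?thesis using True by simp
  qed (rule off)
qed

text \<open>
  If all products of two Dunkl operators kill the family of \<open>p\<close>, then the derivatives of \<open>p\<close> span a
  module over the regular functions that is closed under differentiation; so if they vanish at one
  point, then all derivatives of positive order do.
\<close>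

lemma flat_gradient_inj:
  fixes p :: "'n::{finite,linorder} mpoly"
  assumes flat: "\<And>i j. dunkl_tup m j (dunkl_tup m i (orb (rpoly p))) = 0"
    and x: "x \<in> reg_set" and grad: "\<And>i. peval (mpartial i p) x = 0"
    and hom: "homogeneous d p" "d \<ge> 1"
  shows "p = 0"
proof -
  let ?r = "rpoly p"
  define M where "M = {q. \<exists>c. rpoly q = (\<Sum>k\<in>UNIV. c k * pd k ?r)}"
  have span: "rpoly q \<in> range (\<lambda>c. \<Sum>k\<in>UNIV. c k * pd k ?r) \<longleftrightarrow> q \<in> M" for q
    by (auto simp: M_def)
  define Sp where "Sp = range (\<lambda>c. \<Sum>k\<in>UNIV. c k * pd k ?r)"
  have Sp_gen: "pd k ?r \<in> Sp" for k
    unfolding Sp_def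
    by (rule range_eqI[of _ _ "\<lambda>l. if l = k then 1 else 0"]) (simp add: if_distrib[of "\<lambda>y. y * _"] cong: if_cong)
  have Sp_zero: "0 \<in> Sp" unfolding Sp_def by (rule range_eqI[of _ _ "\<lambda>l. 0"]) simp
  have Sp_add: "u + v \<in> Sp" if uv: "u \<in> Sp" "v \<in> Sp" for u v
  proof -
    obtain b c where "u = (\<Sum>k\<in>UNIV. b k * pd k ?r)" "v = (\<Sum>k\<in>UNIV. c k * pd k ?r)"
      using uv unfolding Sp_def by blast
    then have "u + v = (\<Sum>k\<in>UNIV. (b k + c k) * pd k ?r)" by (simp add: distrib_right sum.distrib)
    then show ?thesis unfolding Sp_def by (rule range_eqI[of _ _ "\<lambda>k. b k + c k"])
  qed
  have Sp_mult: "u * v \<in> Sp" if v: "v \<in> Sp" for u v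
  proof -
    obtain c where "v = (\<Sum>k\<in>UNIV. c k * pd k ?r)" using v unfolding Sp_def by blast
    then have "u * v = (\<Sum>k\<in>UNIV. (u * c k) * pd k ?r)" by (simp add: sum_distrib_left mult.assoc)
    then show ?thesis unfolding Sp_def by (rule range_eqI[of _ _ "\<lambda>k. u * c k"])
  qed
  have Sp_sum: "sum f A \<in> Sp" if "\<And>k. k \<in> A \<Longrightarrow> f k \<in> Sp" for f and A :: "'n set"
    using that by (induction A rule: infinite_finite_induct) (auto intro: Sp_zero Sp_add)
  have pd_gen: "pd i (pd k ?r) \<in> Sp" for i k
  proof -
    have "pd i (pd k ?r) + of_nat m * (\<Sum>l\<in>UNIV. rinv i l * (pd (tr i l k) ?r - pd k ?r)) = 0"
      using dunkl_dunkl_orb_id[of m i k ?r] flat[of i k] by (simp add: tup_apply)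
    then have "pd i (pd k ?r) = (- of_nat m) * (\<Sum>l\<in>UNIV. rinv i l * (pd (tr i l k) ?r + (- 1) * pd k ?r))"
      by (simp add: eq_neg_iff_add_eq_0)
    moreover have "(- of_nat m) * (\<Sum>l\<in>UNIV. rinv i l * (pd (tr i l k) ?r + (- 1) * pd k ?r)) \<in> Sp"
      by (intro Sp_mult Sp_sum Sp_add Sp_gen)
    ultimately show ?thesis by simp
  qed
  have pd_Sp: "pd i u \<in> Sp" if u: "u \<in> Sp" for i u
  proof -
    obtain c where "u = (\<Sum>k\<in>UNIV. c k * pd k ?r)" using u unfolding Sp_def by blast
    then have "pd i u = (\<Sum>k\<in>UNIV. pd i (c k) * pd k ?r + c k * pd i (pd k ?r))"
      by (simp add: pd_sum pd_mult)
    also have "\<dots> \<in> Sp" by (intro Sp_sum Sp_add Sp_mult Sp_gen pd_gen)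
    finally show ?thesis .
  qed
  have M: "q \<in> M \<longleftrightarrow> rpoly q \<in> Sp" for q using span[of q] by (simp add: Sp_def)
  have "mpartial i p = 0" for i
  proof (rule zero_if_derivatives_vanish[where M = M and x = x])
    show "mpartial i p \<in> M" using Sp_gen[of i] by (simp add: M pd_rpoly)
    fix q assume q: "q \<in> M"
    show "mpartial j q \<in> M" for j
      using pd_Sp[of "rpoly q" j] q by (simp add: M pd_rpoly)
    obtain c where "rpoly q = (\<Sum>k\<in>UNIV. c k * pd k ?r)" using q by (auto simp: M_def)
    then have "ev (rpoly q) x = (\<Sum>k\<in>UNIV. ev (c k) x * peval (mpartial k p) x)"
      using x by (simp add: pd_rpoly ev_rpoly)
    then show "peval q x = 0" using x by (simp add: ev_rpoly grad)
  qed
  then have const: "p = mconst (lookup p 0)" by (rule mpartial_all_zero_imp_const)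
  moreover have "0 \<notin> keys p"
    using hom by (auto simp: homogeneous_def)
  then have "lookup p 0 = 0" by (simp add: in_keys_iff)
  ultimately show ?thesis by (metis single_zero)
qed

subsection \<open>Homogeneity\<close>

lemma homogeneous_zero [simp]: "homogeneous d 0"
  by (simp add: homogeneous_def)

lemma homogeneous_add: "homogeneous d p \<Longrightarrow> homogeneous d q \<Longrightarrow> homogeneous d (p + q)"
  unfolding homogeneous_def using keys_add[of p q] by blast

lemma homogeneous_uminus: "homogeneous d p \<Longrightarrow> homogeneous d (- p)"
  by (simp add: homogeneous_def in_keys_iff)

lemma homogeneous_sum: "(\<And>a. a \<in> A \<Longrightarrow> homogeneous d (f a)) \<Longrightarrow> homogeneous d (sum f A)"
  by (induction A rule: infinite_finite_induct) (auto intro: homogeneous_add)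

lemma homogeneous_mult: "homogeneous d p \<Longrightarrow> homogeneous e q \<Longrightarrow> homogeneous (d + e) (p * q)"
  unfolding homogeneous_def using keys_mult[of p q] by (fastforce simp: mdeg_add)

lemma homogeneous_const [simp]: "homogeneous 0 (mconst c)"
  by (simp add: homogeneous_def)

lemma homogeneous_one [simp]: "homogeneous 0 1"
  using homogeneous_const[of 1] by simp

lemma homogeneous_var: "homogeneous 1 (mvar i)"
  by (simp add: homogeneous_def)

lemma homogeneous_var_power: "homogeneous k (mvar i ^ k)"
  using homogeneous_mult[OF homogeneous_var] by (induction k) fastforce+

text \<open>Homogeneity of total degree \<open>D\<close> in \<open>t\<close> and \<open>x\<close> together.\<close>

definition bihom :: "nat \<Rightarrow> 'n::{finite,linorder} mpoly poly \<Rightarrow> bool" where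
  "bihom D Q \<longleftrightarrow> (\<forall>r. (r \<le> D \<longrightarrow> homogeneous (D - r) (coeff Q r)) \<and> (D < r \<longrightarrow> coeff Q r = 0))"

lemma bihom_mult:
  assumes P: "bihom D P" and Q: "bihom E Q" shows "bihom (D + E) (P * Q)"
  unfolding bihom_def
proof (intro allI conjI impI)
  fix r assume "r \<le> D + E"
  show "homogeneous (D + E - r) (coeff (P * Q) r)"
    unfolding coeff_mult
  proof (rule homogeneous_sum)
    fix i assume i: "i \<in> {..r}"
    show "homogeneous (D + E - r) (coeff P i * coeff Q (r - i))"
    proof (cases "i \<le> D \<and> r - i \<le> E")
      case True
      then have "homogeneous ((D - i) + (E - (r - i))) (coeff P i * coeff Q (r - i))"
        using P Q by (intro homogeneous_mult) (auto simp: bihom_def)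
      moreover have "(D - i) + (E - (r - i)) = D + E - r" using True i by auto
      ultimately show ?thesis by simp
    next
      case False
      then have "coeff P i = 0 \<or> coeff Q (r - i) = 0" using P Q by (auto simp: bihom_def)
      then show ?thesis by auto
    qed
  qed
next
  fix r assume "D + E < r"
  then have "coeff P i * coeff Q (r - i) = 0" if "i \<le> r" for i
    using P Q that by (cases "D < i") (auto simp: bihom_def)
  then show "coeff (P * Q) r = 0" unfolding coeff_mult by (intro sum.neutral) auto
qed

lemma bihom_lin: "bihom 1 (lin k)"
proof -
  have "coeff (lin k) r = (if r = 0 then - mvar k else if r = 1 then 1 else 0)" for r
    by (auto simp: lin_def coeff_pCons split: nat.splits)
  then show ?thesis
    using homogeneous_var homogeneous_uminus by (auto simp: bihom_def)
qed

lemma bihom_one: "bihom 0 1"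
  by (auto simp: bihom_def coeff_1)

lemma bihom_master: "bihom (CARD('n) * m) (master m :: 'n::{finite,linorder} mpoly poly)"
proof -
  have pow: "bihom m (lin k ^ m :: 'n mpoly poly)" for k
  proof (induction m)
    case (Suc m)
    from bihom_mult[OF bihom_lin this] show ?case by simp
  qed (simp add: bihom_one)
  have "bihom (card A * m) (\<Prod>k\<in>A. lin k ^ m :: 'n mpoly poly)" for A
  proof (induction A rule: infinite_finite_induct)
    case (insert k A)
    from bihom_mult[OF pow insert(3)] insert(1,2) show ?case by simp
  qed (simp_all add: bihom_one)
  then show ?thesis by (simp add: master_def)
qed

lemma intg_altdef:
  assumes "\<And>r. r > D \<Longrightarrow> coeff Q r = 0"
  shows "intg a b Q = (\<Sum>r\<le>D. coeff Q r * mconst (1 / of_nat (Suc r)) * (mvar b ^ Suc r - mvar a ^ Suc r))"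
proof -
  have "poly (antideriv Q) y = (\<Sum>r\<le>D. coeff Q r * mconst (1 / of_nat (Suc r)) * y ^ Suc r)" for y
  proof -
    have "degree (antideriv Q) \<le> Suc D"
      by (rule degree_le) (use assms in \<open>auto simp: coeff_antideriv\<close>)
    then have "poly (antideriv Q) y = (\<Sum>r\<le>Suc D. coeff (antideriv Q) r * y ^ r)"
      unfolding poly_altdef by (intro sum.mono_neutral_left) (auto simp: coeff_eq_0)
    then show ?thesis
      by (simp only: sum.atMost_Suc_shift) (simp add: coeff_antideriv del: power_Suc of_nat_Suc)
  qed
  then show ?thesis by (simp add: intg_def sum_subtractf[symmetric] right_diff_distrib del: power_Suc of_nat_Suc)
qed

lemma homogeneous_phi_poly: "homogeneous (CARD('n) * m + 1) (phi_poly m a b :: 'n::{finite,linorder} mpoly)"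
proof -
  let ?D = "CARD('n) * m"
  have b: "bihom ?D (master m :: 'n mpoly poly)" by (rule bihom_master)
  have "homogeneous (?D + 1) (coeff (master m) r * mconst (1 / of_nat (Suc r)) * (mvar b ^ Suc r - mvar a ^ Suc r))"
    if r: "r \<le> ?D" for r
  proof -
    have "homogeneous (Suc r) (mvar b ^ Suc r - mvar a ^ Suc r :: 'n mpoly)"
      using homogeneous_add[OF homogeneous_var_power homogeneous_uminus[OF homogeneous_var_power]]
      by (metis diff_conv_add_uminus)
    moreover have "homogeneous (?D - r + 0) (coeff (master m) r * mconst (1 / of_nat (Suc r)) :: 'n mpoly)"
      using b r by (intro homogeneous_mult) (auto simp: bihom_def)
    ultimately have "homogeneous (?D - r + 0 + Suc r) (coeff (master m) r * mconst (1 / of_nat (Suc r)) * (mvar b ^ Suc r - mvar a ^ Suc r))"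
      by (rule homogeneous_mult[rotated])
    with r show ?thesis by simp
  qed
  then have "homogeneous (?D + 1) (intg a b (master m))"
    using b by (subst intg_altdef[of ?D]) (auto simp: bihom_def intro!: homogeneous_sum)
  from homogeneous_mult[OF homogeneous_const this] show ?thesis by (simp add: phi_poly_def)
qed

subsection \<open>Evaluation\<close>

definition cmaster :: "nat \<Rightarrow> 'n::{finite,linorder} cvec \<Rightarrow> complex poly" where
  "cmaster m x = (\<Prod>k\<in>UNIV. [:- x $ k, 1:] ^ m)"

text \<open>The primitive of \<open>P\<close> that vanishes at \<open>0\<close>.\<close>

definition cprim :: "complex poly \<Rightarrow> complex \<Rightarrow> complex" where
  "cprim P t = (\<Sum>r\<le>degree P. coeff P r / of_nat (Suc r) * t ^ Suc r)"

lemma cprim_deriv: "(cprim P has_field_derivative poly P t) (at t)"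
proof -
  have "((\<lambda>t. coeff P r / of_nat (Suc r) * t ^ Suc r) has_field_derivative coeff P r * t ^ r) (at t)" for r
    by (rule derivative_eq_intros refl)+ (simp del: of_nat_Suc)
  then have "((\<lambda>t. \<Sum>r\<le>degree P. coeff P r / of_nat (Suc r) * t ^ Suc r) has_field_derivative
      (\<Sum>r\<le>degree P. coeff P r * t ^ r)) (at t)"
    by (rule DERIV_sum)
  then show ?thesis unfolding cprim_def poly_altdef .
qed

lemma peval_phi_poly:
  "peval (phi_poly m a b) x = - (cprim (cmaster m x) (x $ b) - cprim (cmaster m x) (x $ a)) / of_nat m"
proof -
  let ?f = "map_poly (\<lambda>p. peval p x)"
  have cf: "coeff (?f Q) r = peval (coeff Q r) x" for Q r
    by (simp add: coeff_map_poly pev.mev_zero)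
  have f_mult: "?f (P * Q) = ?f P * ?f Q" for P Q
    by (rule poly_eqI) (simp add: cf coeff_mult pev.mev_sum pev.mev_mult)
  have f_one: "?f 1 = 1"
    by (rule poly_eqI) (simp add: cf coeff_1 pev.mev_one pev.mev_zero)
  have f_power: "?f (P ^ k) = ?f P ^ k" for P k
    by (induction k) (simp_all add: f_mult f_one)
  have f_prod: "?f (prod g A) = (\<Prod>k\<in>A. ?f (g k))" for g and A :: "'a set"
    by (induction A rule: infinite_finite_induct) (simp_all add: f_mult f_one)
  have f_lin: "?f (lin k) = [:- x $ k, 1:]" for k
    by (simp add: lin_def map_poly_pCons pev.mev_zero pev.mev_uminus pev.mev_var pev.mev_one)
  have f_master: "?f (master m) = cmaster m x"
    by (simp add: master_def cmaster_def f_prod f_power f_lin)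
  define D where "D = degree (master m :: 'a mpoly poly)"
  have D: "coeff (master m :: 'a mpoly poly) r = 0" if "r > D" for r
    using that by (simp add: D_def coeff_eq_0)
  have dle: "degree (cmaster m x) \<le> D"
    by (rule degree_le) (simp add: f_master[symmetric] cf D pev.mev_zero)
  have cp: "cprim (cmaster m x) t = (\<Sum>r\<le>D. coeff (cmaster m x) r / of_nat (Suc r) * t ^ Suc r)" for t
    unfolding cprim_def using dle by (intro sum.mono_neutral_left) (auto simp: coeff_eq_0)
  have "peval (intg a b (master m)) x = cprim (cmaster m x) (x $ b) - cprim (cmaster m x) (x $ a)"
    unfolding cp sum_subtractf[symmetric]
    by (subst intg_altdef[where D = D], erule D, unfold pev.mev_sum, rule sum.cong[OF refl])
      (simp add: pev.mev_mult pev.mev_diff pev.mev_power pev.mev_var pev.mev_const f_master[symmetric] cf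
        right_diff_distrib del: power_Suc of_nat_Suc)
  then show ?thesis by (simp add: phi_poly_def pev.mev_mult pev.mev_const diff_divide_distrib)
qed

text \<open>
  Since \<open>x\<^sub>i / (t - x\<^sub>i) = t / (t - x\<^sub>i) - 1\<close>, the integrand is \<open>t P'(t) / m - n P(t)\<close> with
  \<open>P(t) = \<Prod>\<^sub>k (t - x\<^sub>k)\<^sup>m\<close>. Integrating \<open>t P'(t)\<close> by parts leaves \<open>- (1 + n m) / m\<close> times the
  integral of \<open>P\<close>.
\<close>

lemma phi_eq_phi_poly:
  fixes j :: "'n::{finite,linorder}"
  assumes "m \<ge> 1"
  shows "phi m j = peval (phi_poly m (Min UNIV) j)"
proof
  fix x :: "'n cvec"
  let ?P = "cmaster m x" and ?a = "x $ Min UNIV" and ?b = "x $ j"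
  define f where "f = (\<lambda>t. (\<Sum>i\<in>UNIV. x $ i / (t - x $ i)) * (\<Prod>k\<in>UNIV. (t - x $ k) ^ m))"
  \<comment> \<open>\<open>f\<close> and the polynomial \<open>g\<close> differ only at the finitely many points \<open>t = x\<^sub>i\<close>.\<close>
  define g where "g = (\<lambda>t. t * poly (pderiv ?P) t / of_nat m - of_nat CARD('n) * poly ?P t)"
  define G where "G = (\<lambda>t. t * poly ?P t / of_nat m - (1 + of_nat CARD('n) * of_nat m) / of_nat m * cprim ?P t)"
  have m0: "(of_nat m :: complex) \<noteq> 0" using assms by simp
  have P: "poly ?P t = (\<Prod>k\<in>UNIV. (t - x $ k) ^ m)" for t
    by (simp add: cmaster_def poly_prod)
  have P0: "poly ?P (x $ k) = 0" for k
    using assms by (auto simp: P)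
  have fg: "f t = g t" if t: "t \<notin> range (($) x)" for t
  proof -
    have nz: "t - x $ i \<noteq> 0" for i using t by auto
    have dP: "poly (pderiv ?P) t = of_nat m * (\<Sum>i\<in>UNIV. poly ?P t / (t - x $ i))"
    proof -
      have "poly (pderiv ?P) t = (\<Sum>i\<in>UNIV. (\<Prod>k\<in>UNIV - {i}. (t - x $ k) ^ m) * (of_nat m * (t - x $ i) ^ (m - 1)))"
        by (simp add: cmaster_def pderiv_prod poly_sum poly_prod pderiv_power pderiv_pCons mult.left_commute)
      also have "\<dots> = (\<Sum>i\<in>UNIV. of_nat m * (poly ?P t / (t - x $ i)))"
      proof (rule sum.cong[OF refl])
        fix i
        have "poly ?P t = (t - x $ i) ^ m * (\<Prod>k\<in>UNIV - {i}. (t - x $ k) ^ m)"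
          unfolding P by (rule prod.remove) auto
        moreover have "(t - x $ i) ^ m = (t - x $ i) * (t - x $ i) ^ (m - 1)"
          using assms by (cases m) auto
        ultimately show "(\<Prod>k\<in>UNIV - {i}. (t - x $ k) ^ m) * (of_nat m * (t - x $ i) ^ (m - 1)) = of_nat m * (poly ?P t / (t - x $ i))"
          using nz[of i] by simp
      qed
      finally show ?thesis by (simp add: sum_distrib_left)
    qed
    have "f t = (\<Sum>i\<in>UNIV. x $ i / (t - x $ i) * poly ?P t)"
      by (simp add: f_def P sum_distrib_right)
    also have "\<dots> = (\<Sum>i\<in>UNIV. t * (poly ?P t / (t - x $ i)) - poly ?P t)"
    proof (rule sum.cong[OF refl])
      fix i
      show "x $ i / (t - x $ i) * poly ?P t = t * (poly ?P t / (t - x $ i)) - poly ?P t"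
        using nz[of i] by (simp add: field_simps)
    qed
    also have "\<dots> = t * (\<Sum>i\<in>UNIV. poly ?P t / (t - x $ i)) - of_nat CARD('n) * poly ?P t"
      by (simp add: sum_subtractf sum_distrib_left)
    also have "\<dots> = g t" using m0 by (simp add: g_def dP)
    finally show ?thesis .
  qed
  have dG: "(G has_field_derivative g t) (at t)" for t
  proof -
    have "((\<lambda>t. t * poly ?P t / of_nat m - (1 + of_nat CARD('n) * of_nat m) / of_nat m * cprim ?P t)
      has_field_derivative (1 * poly ?P t + poly (pderiv ?P) t * t) / of_nat m
         - (1 + of_nat CARD('n) * of_nat m) / of_nat m * poly ?P t) (at t)"
      by (intro DERIV_diff DERIV_cdivide DERIV_mult DERIV_ident poly_DERIV DERIV_cmult cprim_deriv)
    moreover have "(1 * poly ?P t + poly (pderiv ?P) t * t) / of_nat m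
         - (1 + of_nat CARD('n) * of_nat m) / of_nat m * poly ?P t = g t"
      using m0 by (simp add: g_def field_simps)
    ultimately show ?thesis by (simp add: G_def)
  qed
  have "(f has_contour_integral (G ?b - G ?a)) (linepath ?a ?b)"
  proof (cases "?a = ?b")
    case True
    then show ?thesis using has_contour_integral_trivial[of f ?a] by simp
  next
    case False
    have gi: "(g has_contour_integral (G ?b - G ?a)) (linepath ?a ?b)"
      using contour_integral_primitive[of UNIV G g "linepath ?a ?b"] dG by simp
    have "finite (linepath ?a ?b -` range (($) x) \<inter> {0..1})"
      using inj_on_linepath[OF False] by (intro finite_vimage_IntI) auto
    moreover have "f (linepath ?a ?b s) * (?b - ?a) = g (linepath ?a ?b s) * (?b - ?a)"
      if "s \<in> {0..1} - (linepath ?a ?b -` range (($) x) \<inter> {0..1})" for s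
      using that fg[of "linepath ?a ?b s"] by auto
    ultimately show ?thesis
      using gi unfolding has_contour_integral_linepath by (rule has_integral_spike_finite)
  qed
  then have "contour_integral (linepath ?a ?b) f = G ?b - G ?a"
    by (rule contour_integral_unique)
  also have "\<dots> = - ((1 + of_nat CARD('n) * of_nat m) / of_nat m * (cprim ?P ?b - cprim ?P ?a))"
    by (simp add: G_def P0 algebra_simps)
  finally have "phi m j x = - ((cprim ?P ?b - cprim ?P ?a) / of_nat m) *
      ((1 + of_nat CARD('n) * of_nat m) / (1 + of_nat CARD('n) * of_nat m))"
    unfolding phi_def f_def[symmetric] by simp
  moreover have "(1 + of_nat CARD('n) * of_nat m :: complex) \<noteq> 0"
    by (metis of_nat_0 of_nat_1 of_nat_add of_nat_eq_iff of_nat_mult add_eq_0_iff_both_eq_0 one_neq_zero)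
  ultimately show "phi m j x = peval (phi_poly m (Min UNIV) j) x"
    by (simp add: peval_phi_poly diff_divide_distrib)
qed

section \<open>Harmonic polynomials in terms of Dunkl operators\<close>

lemma mdeg_le_total_deg: "\<alpha> \<in> keys p \<Longrightarrow> mdeg \<alpha> \<le> total_deg p"
  by (simp add: total_deg_def)

lemma total_deg_homogeneous:
  assumes "homogeneous d p" "p \<noteq> 0" shows "total_deg p = d"
proof -
  obtain \<alpha> where "\<alpha> \<in> keys p" using assms(2) by (metis all_not_in_conv keys_eq_empty)
  then have "mdeg ` keys p = {d}" using assms(1) by (auto simp: homogeneous_def)
  then show ?thesis by (simp add: total_deg_def)
qed

definition hom_part :: "nat \<Rightarrow> 'n::finite mpoly \<Rightarrow> 'n mpoly" where
  "hom_part e p = (\<Sum>\<alpha>\<in>{\<alpha>\<in>keys p. mdeg \<alpha> = e}. Poly_Mapping.single \<alpha> (lookup p \<alpha>))"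

lemma homogeneous_hom_part: "homogeneous e (hom_part e p)"
  unfolding hom_part_def by (rule homogeneous_sum) (simp add: homogeneous_def)

lemma sum_hom_part: "(\<Sum>e\<le>total_deg p. hom_part e p) = p"
proof -
  have "(\<Sum>e\<le>total_deg p. hom_part e p) = (\<Sum>\<alpha>\<in>keys p. Poly_Mapping.single \<alpha> (lookup p \<alpha>))"
    unfolding hom_part_def by (rule sum.group) (auto intro: mdeg_le_total_deg)
  then show ?thesis using mpoly_sum_singles[of p] by simp
qed

lemma hom_part_total_deg_nonzero:
  assumes "total_deg p > 0" shows "hom_part (total_deg p) p \<noteq> 0"
proof -
  have "total_deg p \<in> insert 0 (mdeg ` keys p)"
    unfolding total_deg_def by (rule Max_in) auto
  with assms obtain \<alpha> where \<alpha>: "\<alpha> \<in> keys p" "mdeg \<alpha> = total_deg p" by auto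
  then have "lookup (hom_part (total_deg p) p) \<alpha> = lookup p \<alpha>"
    by (simp add: hom_part_def lookup_sum lookup_single when_def)
  with \<alpha>(1) show ?thesis by (auto simp: in_keys_iff)
qed

lemma scal_mult_eq_0:
  fixes F :: "'n::{finite,linorder} tup"
  assumes "scal c * F = 0" "c \<noteq> 0" shows "F = 0"
proof -
  have "scal (1 / c) * (scal c * F) = scal (1 / c * c) * F"
    by (simp only: scal_mult mult.assoc)
  with assms show ?thesis by simp
qed

lemma psub_euler:
  assumes "homogeneous d p"
  shows "psub m p (euler F) = euler (psub m p F) + of_nat d * psub m p F"
proof -
  have "psub m p (euler F) = (\<Sum>\<alpha>\<in>keys p. scal (lookup p \<alpha>) * euler (op_monom (dunkl_tup m) \<alpha> F)
      + of_nat d * (scal (lookup p \<alpha>) * op_monom (dunkl_tup m) \<alpha> F))"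
    unfolding psub_def
    by (rule sum.cong[OF refl]) (use assms in \<open>simp add: op_dunkl_euler homogeneous_def distrib_left mult.left_commute\<close>)
  then show ?thesis
    by (simp add: psub_def euler_sum euler_scal sum.distrib sum_distrib_left)
qed

locale symmetric_generators =
  fixes \<sigma> :: "'n::{finite,linorder} \<Rightarrow> 'n mpoly"
  assumes homog: "\<And>i. \<exists>d. homogeneous d (\<sigma> i)" and free: "free_generators \<sigma>"
begin

lemma gen_symmetric: "symmetric (\<sigma> i)"
  using free by (intro symmetric_of_function) (simp add: free_generators_def)

lemma gen_independent:
  assumes "\<And>x. peval q (\<chi> i. peval (\<sigma> i) x) = 0" shows "q = 0"
proof -
  have "(\<lambda>x. peval q (\<chi> i. peval (\<sigma> i) x)) = (\<lambda>x. 0)" using assms by (rule ext)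
  with free show ?thesis unfolding free_generators_def by blast
qed

lemma gen_nonzero: "\<sigma> i \<noteq> 0"
proof
  assume "\<sigma> i = 0"
  then have "mvar i = (0 :: 'n mpoly)"
    by (intro gen_independent) (simp add: pev.mev_var pev.mev_zero)
  then have "lookup (mvar i :: 'n mpoly) (unit_exp i) = 0" by simp
  then show False by simp
qed

text \<open>A generator of degree \<open>0\<close> would be constant and thus satisfy a linear relation.\<close>

lemma gen_degree: "\<exists>d. d \<ge> 1 \<and> homogeneous d (\<sigma> i)"
proof -
  obtain d where d: "homogeneous d (\<sigma> i)" using homog by blast
  have "d \<noteq> 0"
  proof
    assume "d = 0"
    then have k: "\<alpha> = 0" if "\<alpha> \<in> keys (\<sigma> i)" for \<alpha>
      using d that by (simp add: homogeneous_def mdeg_eq_0_iff)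
    have "\<sigma> i = mconst (lookup (\<sigma> i) 0)"
      by (rule poly_mapping_eqI) (metis in_keys_iff k lookup_single_eq lookup_single_not_eq)
    then have "mvar i - mconst (lookup (\<sigma> i) 0) = (0 :: 'n mpoly)"
      by (intro gen_independent) (simp add: pev.mev_var pev.mev_diff pev.mev_const, metis pev.mev_const right_minus_eq)
    then have "lookup (mvar i - mconst (lookup (\<sigma> i) 0)) (unit_exp i) = (0 :: complex)" by simp
    moreover have "unit_exp i \<noteq> 0" using unit_exp_add_neq_0[of i 0] by simp
    ultimately show False by (simp add: lookup_minus lookup_single_not_eq)
  qed
  with d show ?thesis by (intro exI[of _ d]) simp
qed

lemma gen_const: "lookup (\<sigma> i) 0 = 0"
proof -
  obtain d where "d \<ge> 1" "homogeneous d (\<sigma> i)" using gen_degree by blast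
  then have "0 \<notin> keys (\<sigma> i)" by (auto simp: homogeneous_def)
  then show ?thesis by (simp add: in_keys_iff)
qed

text \<open>
  A symmetric polynomial without constant term is a polynomial without constant term in the
  generators, because these have positive degree.
\<close>

lemma killed_by_symmetricI:
  assumes kill: "\<And>i. psub m (\<sigma> i) F = 0"
  shows "killed_by_symmetric m F"
  unfolding killed_by_symmetric_def
proof (intro allI impI)
  interpret comp: ring_eval mconst \<sigma>
    by unfold_locales (simp_all add: single_add mult_single)
  fix p :: "'n mpoly" assume p: "symmetric p \<and> lookup p 0 = 0"
  then have "peval p \<in> symmetric_polys" by (intro function_of_symmetric) simp
  moreover have "\<forall>f\<in>symmetric_polys. \<exists>q. f = (\<lambda>x. peval q (\<chi> i. peval (\<sigma> i) x))"
    by (rule conjunct1[OF conjunct2[OF free[unfolded free_generators_def]]])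
  ultimately have "\<exists>q. peval p = (\<lambda>x. peval q (\<chi> i. peval (\<sigma> i) x))" by (rule bspec[rotated])
  then obtain q where q: "peval p = (\<lambda>x. peval q (\<chi> i. peval (\<sigma> i) x))" ..
  have "peval (comp.mev q) x = peval q (\<chi> i. peval (\<sigma> i) x)" for x
  proof -
    have "peval (mono_at \<sigma> \<beta>) x = mono_at (\<lambda>i. peval (\<sigma> i) x) \<beta>" for \<beta>
      by (simp add: mono_at_def pev.mev_prod pev.mev_power)
    then show ?thesis
      by (simp add: comp.mev_def pev.mev_sum pev.mev_mult pev.mev_const) (simp add: peval_def mono_at_def)
  qed
  then have "peval (comp.mev q) = peval p" unfolding q by (rule ext)
  then have pq: "p = comp.mev q" using peval_inj by metis
  have "(\<chi> i. peval (\<sigma> i) 0) = (0 :: 'n cvec)"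
    by (simp add: vec_eq_iff peval_at_zero gen_const)
  then have q0: "lookup q 0 = 0"
    using fun_cong[OF q, of 0] p by (simp add: peval_at_zero)
  have "psub m (mconst (lookup q \<beta>) * mono_at \<sigma> \<beta>) F = 0" if "\<beta> \<in> keys q" for \<beta>
  proof -
    have "\<beta> \<noteq> 0" using that q0 by (auto simp: in_keys_iff)
    then have "\<exists>i. lookup \<beta> i > 0" by (metis gr0I lookup_zero poly_mapping_eqI)
    then obtain i where i: "lookup \<beta> i > 0" ..
    have "mono_at \<sigma> \<beta> = mono_at \<sigma> (\<beta> - unit_exp i) * \<sigma> i"
      using mono_at_add[of \<sigma> "unit_exp i" "\<beta> - unit_exp i"] split_unit_exp[OF i] by (simp add: mult.commute)
    then show ?thesis by (simp add: mult.assoc[symmetric] psub_mult kill)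
  qed
  then show "psub m p F = 0"
    unfolding pq comp.mev_def psub_sum by (intro sum.neutral) auto
qed

text \<open>
  \<^const>\<open>calogero_op\<close> only sees the entry at the identity, but \<open>\<sigma>\<^sub>i(D)\<close> of the invariant family is
  again invariant and so is determined by that entry.
\<close>

lemma harmonic_iff:
  "peval p \<in> harmonic_polys m \<sigma> \<longleftrightarrow> (\<forall>i. psub m (\<sigma> i) (orb (rpoly p)) = 0)"
proof -
  have apply_eq: "diffop_apply (calogero_op m (\<sigma> i)) (peval p) x = ev (psub m (\<sigma> i) (orb (rpoly p)) id) x"
    if "x \<in> reg_set" for i x
  proof -
    obtain d where "homogeneous d (\<sigma> i)" using homog by blast
    then show ?thesis
      by (rule calogero_op_apply[OF _ gen_nonzero invariant_orb]) (simp_all add: ev_rpoly that)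
  qed
  have "(\<forall>x\<in>reg_set. diffop_apply (calogero_op m (\<sigma> i)) (peval p) x = 0) \<longleftrightarrow> psub m (\<sigma> i) (orb (rpoly p)) = 0" for i
  proof
    assume "\<forall>x\<in>reg_set. diffop_apply (calogero_op m (\<sigma> i)) (peval p) x = 0"
    then have "psub m (\<sigma> i) (orb (rpoly p)) id = 0"
      by (intro rfun_eqI) (simp add: apply_eq)
    then show "psub m (\<sigma> i) (orb (rpoly p)) = 0" by (rule psub_orb_eq_0[OF gen_symmetric])
  qed (simp add: apply_eq tup_apply)
  then show ?thesis by (simp add: harmonic_polys_def)
qed

lemma harmonic_killed: "peval p \<in> harmonic_polys m \<sigma> \<Longrightarrow> killed_by_symmetric m (orb (rpoly p))"
  unfolding harmonic_iff by (intro killed_by_symmetricI) blast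

lemma harmonic_add:
  "peval p \<in> harmonic_polys m \<sigma> \<Longrightarrow> peval q \<in> harmonic_polys m \<sigma> \<Longrightarrow> peval (p + q) \<in> harmonic_polys m \<sigma>"
  by (simp add: harmonic_iff rev.mev_add orb_add psub_plus)

lemma harmonic_mconst_mult:
  "peval p \<in> harmonic_polys m \<sigma> \<Longrightarrow> peval (mconst c * p) \<in> harmonic_polys m \<sigma>"
  by (simp add: harmonic_iff rev.mev_mult rev.mev_const orb_scal psub_scal)

lemma harmonic_zero: "peval 0 \<in> harmonic_polys m \<sigma>"
  by (simp add: harmonic_iff rev.mev_zero)

lemma harmonic_sum:
  "(\<And>a. a \<in> A \<Longrightarrow> peval (f a) \<in> harmonic_polys m \<sigma>) \<Longrightarrow> peval (sum f A) \<in> harmonic_polys m \<sigma>"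
  by (induction A rule: infinite_finite_induct) (auto intro: harmonic_zero harmonic_add)

lemma harmonic_diff:
  assumes "peval p \<in> harmonic_polys m \<sigma>" "peval q \<in> harmonic_polys m \<sigma>"
  shows "peval (p - q) \<in> harmonic_polys m \<sigma>"
proof -
  have "p - q = p + mconst (- 1) * q" by (simp add: single_uminus)
  then show ?thesis using assms by (simp only:) (intro harmonic_add harmonic_mconst_mult)
qed

lemma const_harmonic: "(\<lambda>x. c) \<in> harmonic_polys m \<sigma>"
proof -
  let ?F = "orb (rpoly (mconst c)) :: 'n tup"
  have "dunkl_tup m i ?F = 0" for i
    unfolding dunkl_tup_orb
    by (simp add: pdt_def orb_def rev.mev_const fun_eq_iff tup_apply)
  then have one: "op_monom (dunkl_tup m) (\<alpha> + unit_exp i) ?F = 0" for \<alpha> i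
    using op_dunkl_unit[of m i 0 ?F] by (simp add: op_dunkl_add)
  have "psub m (\<sigma> i) ?F = 0" for i
    unfolding psub_def
  proof (rule sum.neutral, rule ballI)
    fix \<alpha> assume "\<alpha> \<in> keys (\<sigma> i)"
    then have "\<alpha> \<noteq> 0" using gen_const[of i] by (auto simp: in_keys_iff)
    then have "\<exists>j. lookup \<alpha> j > 0" by (metis gr0I lookup_zero poly_mapping_eqI)
    then obtain j where "lookup \<alpha> j > 0" ..
    from split_unit_exp[OF this] obtain \<beta> where "\<alpha> = \<beta> + unit_exp j" by (metis add.commute)
    then show "scal (lookup (\<sigma> i) \<alpha>) * op_monom (dunkl_tup m) \<alpha> ?F = 0" by (simp add: one)
  qed
  then have "peval (mconst c) \<in> harmonic_polys m \<sigma>" by (simp add: harmonic_iff)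
  moreover have "(\<lambda>x. c) = peval (mconst c :: 'n mpoly)" by (rule ext) (simp add: pev.mev_const)
  ultimately show ?thesis by (simp only:)
qed

text \<open>
  The Euler operator preserves harmonicity, and \<open>\<Prod>\<^sub>j\<^sub><\<^sub>D (E - j)\<close> maps a polynomial of degree \<open>D\<close> to
  \<open>D!\<close> times its top homogeneous part.
\<close>

lemma top_part_harmonic:
  assumes "peval p \<in> harmonic_polys m \<sigma>"
  shows "peval (hom_part (total_deg p) p) \<in> harmonic_polys m \<sigma>"
proof -
  define D where "D = total_deg p"
  define F where "F = (\<lambda>e. orb (rpoly (hom_part e p)))"
  \<comment> \<open>The eigenvalue of \<open>\<Prod>\<^sub>j\<^sub><\<^sub>k (E - j)\<close> in degree \<open>e\<close>:\<close>
  define c where "c = (\<lambda>k e. \<Prod>j<k. complex_of_nat e - of_nat j)"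
  have "psub m (\<sigma> i) (\<Sum>e\<le>D. scal (c k e) * F e) = 0" for k i
  proof (induction k)
    case 0
    have "(\<Sum>e\<le>D. scal (c 0 e) * F e) = orb (rpoly p)"
      unfolding D_def by (subst (2) sum_hom_part[symmetric]) (simp add: c_def F_def rev.mev_sum orb_sum)
    then show ?case using assms by (simp add: harmonic_iff)
  next
    case (Suc k)
    let ?G = "\<Sum>e\<le>D. scal (c k e) * F e"
    obtain d where d: "homogeneous d (\<sigma> i)" using homog by blast
    have "euler ?G + scal (- of_nat k) * ?G = (\<Sum>e\<le>D. scal (c (Suc k) e) * F e)"
      unfolding euler_sum sum_distrib_left sum.distrib[symmetric]
    proof (rule sum.cong[OF refl])
      fix e
      have "euler (F e) = scal (of_nat e) * F e"
        using euler_orb_homogeneous[OF homogeneous_hom_part, of e p] by (simp add: F_def rconst_of_nat)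
      then have "euler (scal (c k e) * F e) + scal (- of_nat k) * (scal (c k e) * F e)
          = scal (c k e * of_nat e + - of_nat k * c k e) * F e"
        by (simp only: euler_scal scal_add scal_mult distrib_right mult.assoc)
      then show "euler (scal (c k e) * F e) + scal (- of_nat k) * (scal (c k e) * F e) = scal (c (Suc k) e) * F e"
        by (simp add: c_def algebra_simps)
    qed
    moreover have "psub m (\<sigma> i) (euler ?G + scal (- of_nat k) * ?G) = 0"
      by (simp only: psub_plus psub_scal psub_euler[OF d] Suc) simp
    ultimately show ?case by simp
  qed
  moreover have "(\<Sum>e\<le>D. scal (c D e) * F e) = scal (c D D) * F D"
  proof -
    have "c D e = 0" if "e < D" for e
      unfolding c_def using that by (intro prod_zero) auto
    then have "(\<Sum>e\<le>D. scal (c D e) * F e) = (\<Sum>e\<le>D. if e = D then scal (c D D) * F D else 0)"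
      by (intro sum.cong) auto
    then show ?thesis by simp
  qed
  ultimately have "scal (c D D) * psub m (\<sigma> i) (F D) = 0" for i
    by (metis psub_scal)
  moreover have "c D D \<noteq> 0" by (simp add: c_def)
  ultimately have "psub m (\<sigma> i) (F D) = 0" for i using scal_mult_eq_0 by blast
  then show ?thesis by (simp add: harmonic_iff F_def D_def)
qed

lemma homogeneous_harmonic_bound:
  assumes m: "m \<ge> 1" and p: "peval p \<in> harmonic_polys m \<sigma>" "p \<noteq> 0" and d: "homogeneous d p" "d \<ge> 1"
  shows "CARD('n) * m + 1 \<le> d \<and>
    (d = CARD('n) * m + 1 \<longrightarrow> (\<forall>i j. dunkl_tup m i (dunkl_tup m j (orb (rpoly p))) = 0))"
proof (rule degree_bound[OF m d(2) invariant_orb])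
  show "orb (rpoly p) \<noteq> 0"
    using p(2) rpoly_inj[of p 0] by (auto simp: orb_eq_0_iff rev.mev_zero)
qed (auto intro: euler_orb_homogeneous d(1) harmonic_killed p(1))

lemma harmonic_degree_bound:
  assumes "m \<ge> 1" "peval p \<in> harmonic_polys m \<sigma>" "total_deg p > 0"
  shows "CARD('n) * m + 1 \<le> total_deg p"
  using homogeneous_harmonic_bound[OF assms(1) top_part_harmonic[OF assms(2)]
      hom_part_total_deg_nonzero[OF assms(3)] homogeneous_hom_part] assms(3) by simp

lemma harmonic_flat:
  assumes "m \<ge> 1" "peval p \<in> harmonic_polys m \<sigma>" "homogeneous (CARD('n) * m + 1) p"
  shows "dunkl_tup m i (dunkl_tup m j (orb (rpoly p))) = 0"
  using homogeneous_harmonic_bound[OF assms(1,2) _ assms(3)] by (cases "p = 0") (auto simp: rev.mev_zero)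

text \<open>Here the symmetric polynomial is \<open>\<Sum>\<^sub>i x\<^sub>i\<close>.\<close>

lemma harmonic_translation:
  assumes "peval p \<in> harmonic_polys m \<sigma>" shows "(\<Sum>i\<in>UNIV. mpartial i p) = 0"
proof -
  define e :: "'n mpoly" where "e = (\<Sum>i\<in>UNIV. mvar i)"
  have "lookup e \<alpha> = (\<Sum>i\<in>UNIV. if unit_exp i = \<alpha> then 1 else 0)" for \<alpha>
    by (simp add: e_def lookup_sum lookup_single when_def)
  then have "symmetric e"
    unfolding symmetric_def
  proof (intro allI impI)
    fix w :: "'n \<Rightarrow> 'n" and \<alpha> assume l: "\<And>\<alpha>. lookup e \<alpha> = (\<Sum>i\<in>UNIV. if unit_exp i = \<alpha> then 1 else 0)" and w: "bij w"
    have "lookup e (perm_exp w \<alpha>) = (\<Sum>i\<in>UNIV. if unit_exp (w i) = perm_exp w \<alpha> then 1 else 0)"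
      unfolding l by (rule sum.reindex_bij_betw[OF w, symmetric])
    also have "\<dots> = lookup e \<alpha>"
      unfolding l
    proof (rule sum.cong[OF refl])
      fix i
      have "unit_exp (w i) = perm_exp w \<alpha> \<longleftrightarrow> unit_exp i = \<alpha>"
        using w perm_exp_inv(2)[OF w] perm_exp_unit[OF w, of i] by metis
      then show "(if unit_exp (w i) = perm_exp w \<alpha> then 1 else 0) = (if unit_exp i = \<alpha> then 1 else (0 :: complex))"
        by simp
    qed
    finally show "lookup e (perm_exp w \<alpha>) = lookup e \<alpha>" .
  qed
  moreover have "lookup e 0 = 0"
    using unit_exp_add_neq_0[of "_ :: 'n" 0] by (simp add: e_def lookup_sum lookup_single when_def)
  ultimately have "psub m e (orb (rpoly p)) = 0"
    using harmonic_killed[OF assms] by (simp add: killed_by_symmetric_def)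
  moreover have "psub m (mvar i) G = dunkl_tup m i G" for i and G :: "'n tup"
    using op_dunkl_unit[of m i 0 G] by (simp add: psub_single)
  ultimately have "(\<Sum>i\<in>UNIV. pdt i (orb (rpoly p))) id = (0 :: 'n tup) id"
    by (simp add: e_def psub_sum dunkl_tup_orb)
  then have "rpoly (\<Sum>i\<in>UNIV. mpartial i p) = rpoly 0"
    by (simp add: sum_fun_apply pdt_def pd_rpoly rev.mev_sum rev.mev_zero tup_apply)
  then show ?thesis by (rule rpoly_inj)
qed

text \<open>
  Generators of degree at least \<open>2\<close> involve products of two Dunkl operators, and a generator of
  degree \<open>1\<close> is a multiple of \<open>\<Sum>\<^sub>i x\<^sub>i\<close>.
\<close>

lemma phi_poly_harmonic:
  assumes m: "m \<ge> 1" shows "peval (phi_poly m a b) \<in> harmonic_polys m \<sigma>"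
  unfolding harmonic_iff
proof
  fix i
  let ?F = "orb (rpoly (phi_poly m a b))"
  obtain d where d: "d \<ge> 1" "homogeneous d (\<sigma> i)" using gen_degree by blast
  show "psub m (\<sigma> i) ?F = 0"
  proof (cases "d = 1")
    case False
    have two: "op_monom (dunkl_tup m) (\<alpha> + (unit_exp j + unit_exp k)) ?F = 0" for \<alpha> j k
      using op_dunkl_unit[of m j 0] op_dunkl_unit[of m k 0 ?F]
      by (simp add: op_dunkl_add phi_poly_flat[OF m])
    show ?thesis
      unfolding psub_def
    proof (rule sum.neutral, rule ballI)
      fix \<alpha> assume "\<alpha> \<in> keys (\<sigma> i)"
      then have deg: "mdeg \<alpha> \<ge> 2" using d False by (simp add: homogeneous_def)
      have pos: "\<exists>j \<beta>. \<gamma> = unit_exp j + \<beta>" if "mdeg \<gamma> > 0" for \<gamma> :: "'n \<Rightarrow>\<^sub>0 nat"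
        using that by (induction \<gamma> rule: exp_induct) auto
      obtain j \<beta> where j: "\<alpha> = unit_exp j + \<beta>" using pos[of \<alpha>] deg by auto
      then have "mdeg \<beta> > 0" using deg by (simp add: mdeg_add)
      then obtain k \<gamma> where k: "\<beta> = unit_exp k + \<gamma>" using pos by blast
      have "\<alpha> = \<gamma> + (unit_exp j + unit_exp k)" using j k by (simp add: ac_simps)
      then show "scal (lookup (\<sigma> i) \<alpha>) * op_monom (dunkl_tup m) \<alpha> ?F = 0" by (simp add: two)
    qed
  next
    case True
    obtain c where c: "\<And>j. lookup (\<sigma> i) (unit_exp j) = c"
    proof -
      have "lookup (\<sigma> i) (unit_exp j) = lookup (\<sigma> i) (unit_exp i)" for j
        using gen_symmetric[of i] perm_exp_unit[of "tr i j" i] unfolding symmetric_def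
        by (metis bij_transpose transpose_apply_first)
      then show thesis using that by blast
    qed
    have "\<sigma> i = (\<Sum>j\<in>UNIV. Poly_Mapping.single (unit_exp j) c)"
    proof (rule poly_mapping_eqI)
      fix \<alpha>
      show "lookup (\<sigma> i) \<alpha> = lookup (\<Sum>j\<in>UNIV. Poly_Mapping.single (unit_exp j) c) \<alpha>"
      proof (cases "\<exists>k. \<alpha> = unit_exp k")
        case k: True
        then obtain k where "\<alpha> = unit_exp k" ..
        moreover have "unit_exp j = unit_exp k \<longleftrightarrow> j = k" for j :: 'n
          by (metis lookup_unit_exp zero_neq_one)
        ultimately show ?thesis using c by (simp add: lookup_sum lookup_single when_def)
      next
        case k: False
        have "\<alpha> \<notin> keys (\<sigma> i)"
        proof
          assume "\<alpha> \<in> keys (\<sigma> i)"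
          then have "mdeg \<alpha> = 1" using d True by (simp add: homogeneous_def)
          then have "\<exists>k. \<alpha> = unit_exp k"
            by (induction \<alpha> rule: exp_induct) (auto simp: mdeg_add mdeg_eq_0_iff)
          with k show False by blast
        qed
        moreover have "unit_exp j \<noteq> \<alpha>" for j using k by auto
        ultimately show ?thesis by (simp add: lookup_sum lookup_single when_def in_keys_iff)
      qed
    qed
    then have "psub m (\<sigma> i) ?F = scal c * (\<Sum>j\<in>UNIV. dunkl_tup m j ?F)"
      using op_dunkl_unit[of m _ 0 ?F] by (simp add: psub_sum psub_single sum_distrib_left)
    then show ?thesis by (simp add: phi_poly_sum_dunkl[OF m])
  qed
qed

end

section \<open>The parametrisation by the reflection representation\<close>

definition zero_sum :: "'n::finite cvec set" where
  "zero_sum = {x. (\<Sum>i\<in>UNIV. x $ i) = 0}"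

definition psi_poly :: "nat \<Rightarrow> 'n::{finite,linorder} cvec \<Rightarrow> 'n mpoly" where
  "psi_poly m c = (\<Sum>j\<in>UNIV. mconst (c $ j) * phi_poly m (Min UNIV) j)"

definition psi :: "nat \<Rightarrow> 'n::{finite,linorder} cvec \<Rightarrow> 'n cvec \<Rightarrow> complex" where
  "psi m c = peval (psi_poly m c)"

lemma psi_eq_sum: "psi m c x = (\<Sum>j\<in>UNIV. c $ j * peval (phi_poly m (Min UNIV) j) x)"
  by (simp add: psi_def psi_poly_def pev.mev_sum pev.mev_mult pev.mev_const)

lemma homogeneous_psi_poly: "homogeneous (CARD('n) * m + 1) (psi_poly m (c :: 'n::{finite,linorder} cvec))"
  unfolding psi_poly_def
  by (intro homogeneous_sum) (metis add_0 homogeneous_const homogeneous_mult homogeneous_phi_poly)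

lemma psi_add: "psi m (c + d) = psi m c + psi m d"
  by (rule ext) (simp add: psi_eq_sum distrib_right sum.distrib plus_fun_apply)

lemma psi_scale: "psi m (a *s c) = fscale a (psi m c)"
  by (rule ext) (simp add: psi_eq_sum fscale_def sum_distrib_left mult.assoc)

lemma psi_zero: "psi m 0 = 0"
  by (rule ext) (simp add: psi_eq_sum zero_fun_apply)

text \<open>On vectors with sum \<open>0\<close> the common lower end of integration drops out.\<close>

lemma psi_zero_sum:
  assumes "c \<in> zero_sum"
  shows "psi m c x = - (\<Sum>j\<in>UNIV. c $ j * cprim (cmaster m x) (x $ j)) / of_nat m"
proof -
  let ?K = "\<lambda>j. cprim (cmaster m x) (x $ j)"
  have "psi m c x = (\<Sum>j\<in>UNIV. - (c $ j * ?K j / of_nat m) + c $ j * (?K (Min UNIV) / of_nat m))"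
    unfolding psi_eq_sum peval_phi_poly
    by (rule sum.cong[OF refl]) (simp add: diff_divide_distrib right_diff_distrib)
  also have "\<dots> = - (\<Sum>j\<in>UNIV. c $ j * ?K j / of_nat m) + (\<Sum>j\<in>UNIV. c $ j) * (?K (Min UNIV) / of_nat m)"
    unfolding sum.distrib sum_negf sum_distrib_right ..
  finally show ?thesis using assms by (simp add: zero_sum_def sum_divide_distrib)
qed

lemma perm_vec_zero_sum:
  assumes "bij g" shows "perm_vec g c \<in> zero_sum \<longleftrightarrow> c \<in> zero_sum"
proof -
  have "(\<Sum>i\<in>UNIV. c $ inv g i) = (\<Sum>i\<in>UNIV. c $ i)"
    by (rule sum.reindex_bij_betw) (simp add: assms bij_imp_bij_inv)
  then show ?thesis by (simp add: zero_sum_def perm_vec_def)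
qed

lemma psi_equivariant:
  fixes c :: "'n::{finite,linorder} cvec"
  assumes g: "bij g" and c: "c \<in> zero_sum"
  shows "perm_fun g (psi m c) = psi m (perm_vec g c)"
proof
  fix x :: "'n cvec"
  have "(\<Prod>k\<in>UNIV. [:- x $ g k, 1:] ^ m) = (\<Prod>k\<in>UNIV. [:- x $ k, 1:] ^ m)"
    by (rule prod.reindex_bij_betw[OF g])
  then have master: "cmaster m (\<chi> i. x $ g i) = cmaster m x" by (simp add: cmaster_def)
  have "(\<Sum>j\<in>UNIV. c $ j * cprim (cmaster m x) (x $ g j)) = (\<Sum>j\<in>UNIV. c $ inv g (g j) * cprim (cmaster m x) (x $ g j))"
    using g by (simp add: bij_is_inj)
  also have "\<dots> = (\<Sum>j\<in>UNIV. c $ inv g j * cprim (cmaster m x) (x $ j))"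
    by (rule sum.reindex_bij_betw[OF g])
  finally show "perm_fun g (psi m c) x = psi m (perm_vec g c) x"
    using g c by (simp add: perm_fun_apply psi_zero_sum perm_vec_zero_sum master) (simp add: perm_vec_def)
qed

text \<open>At the \<open>j\<close>-th unit vector the integrand is \<open>t\<^bsup>m(n-1)\<^esup> (t - 1)\<^sup>m\<close>, which has constant sign between \<open>0\<close> and \<open>1\<close>.\<close>

lemma cprim_unit_vector:
  fixes j :: "'n::{finite,linorder}" and m :: nat
  defines "P \<equiv> cmaster m (axis j 1 :: 'n cvec)"
  shows "cprim P 1 \<noteq> cprim P 0"
proof -
  define h where "h = (\<lambda>t :: real. (- 1) ^ m * Re (cprim P (complex_of_real t)))"
  have P: "poly P (complex_of_real t) = complex_of_real ((t - 1) ^ m * (\<Prod>k\<in>UNIV - {j}. t ^ m))" for t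
  proof -
    have "poly P (complex_of_real t) = (\<Prod>k\<in>UNIV. (complex_of_real t - axis j 1 $ k) ^ m)"
      by (simp add: P_def cmaster_def poly_prod)
    also have "\<dots> = (complex_of_real t - axis j 1 $ j) ^ m * (\<Prod>k\<in>UNIV - {j}. (complex_of_real t - axis j 1 $ k) ^ m)"
      by (rule prod.remove) auto
    also have "(\<Prod>k\<in>UNIV - {j}. (complex_of_real t - axis j 1 $ k) ^ m) = (\<Prod>k\<in>UNIV - {j}. complex_of_real t ^ m)"
      by (rule prod.cong) (auto simp: axis_def)
    finally show ?thesis by (simp add: axis_def)
  qed
  have dh: "(h has_real_derivative ((1 - t) ^ m * (\<Prod>k\<in>UNIV - {j}. t ^ m))) (at t)" for t
  proof -
    have "((\<lambda>t. cprim P (complex_of_real t)) has_vector_derivative poly P (complex_of_real t)) (at t)"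
      by (rule has_vector_derivative_real_field) (rule cprim_deriv)
    then have "((\<lambda>t. Re (cprim P (complex_of_real t))) has_real_derivative Re (poly P (complex_of_real t))) (at t)"
      by (rule has_field_derivative_Re)
    then have "(h has_real_derivative ((- 1) ^ m * Re (poly P (complex_of_real t)))) (at t)"
      unfolding h_def by (rule DERIV_cmult)
    moreover have "(- 1) ^ m * Re (poly P (complex_of_real t)) = (1 - t) ^ m * (\<Prod>k\<in>UNIV - {j}. t ^ m)"
      unfolding P Re_complex_of_real by (simp add: power_mult_distrib[symmetric] mult.assoc[symmetric])
    ultimately show ?thesis by simp
  qed
  have "h 0 < h 1"
  proof (rule DERIV_pos_imp_increasing_open[where f = h and a = 0 and b = 1])
    fix t :: real assume "0 < t" "t < 1"
    then have "(1 - t) ^ m * (\<Prod>k\<in>UNIV - {j}. t ^ m) > 0"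
      by (intro mult_pos_pos prod_pos) auto
    with dh show "\<exists>y. (h has_real_derivative y) (at t) \<and> 0 < y" by blast
  next
    show "continuous_on {0..1} h"
      using dh by (intro continuous_at_imp_continuous_on ballI DERIV_isCont) blast
  qed simp
  then show ?thesis by (auto simp: h_def)
qed

lemma psi_eq_0_imp:
  assumes m: "m \<ge> 1" and "psi m c = 0" and j: "j \<noteq> Min UNIV"
  shows "c $ j = 0"
proof -
  let ?x = "axis j 1 :: 'a cvec"
  let ?K = "cprim (cmaster m ?x)"
  have "psi m c ?x = (\<Sum>l\<in>UNIV. if l = j then c $ j * (- (?K 1 - ?K 0) / of_nat m) else 0)"
    unfolding psi_eq_sum peval_phi_poly using j by (intro sum.cong) (auto simp: axis_def)
  then have "c $ j * (- (?K 1 - ?K 0) / of_nat m) = 0" using assms(2) by (simp add: zero_fun_apply)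
  then show ?thesis using cprim_unit_vector[where m = m and j = j] m by simp
qed

lemma psi_inj:
  assumes m: "m \<ge> 1" and "c \<in> zero_sum" "psi m c = 0" shows "c = 0"
proof -
  have "c $ j = 0" if "j \<noteq> Min UNIV" for j using psi_eq_0_imp[OF m assms(3) that] .
  moreover from this have "(\<Sum>i\<in>UNIV. c $ i) = c $ Min UNIV"
    by (subst sum.remove[of _ "Min UNIV"]) auto
  ultimately show ?thesis using assms(2) by (metis (mono_tags) mem_Collect_eq vec_eq_iff zero_index zero_sum_def)
qed

lemma psi_inj_on: "m \<ge> 1 \<Longrightarrow> inj_on (psi m) zero_sum"
proof (rule inj_onI)
  fix c d :: "'a cvec" assume m: "m \<ge> 1" and cd: "c \<in> zero_sum" "d \<in> zero_sum" "psi m c = psi m d"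
  have "psi m (c + (- 1) *s d) = 0"
    unfolding psi_add psi_scale cd(3) by (rule ext) (simp add: fscale_def tup_apply)
  moreover have "c + (- 1) *s d \<in> zero_sum"
    using cd(1,2) by (simp add: zero_sum_def sum_subtractf)
  ultimately have "c + (- 1) *s d = 0" using psi_inj[OF m] by blast
  then show "c = d" by (simp add: vec_eq_iff)
qed

lemma subspace_zero_sum: "vec.subspace (zero_sum :: 'n::finite cvec set)"
  unfolding vec.subspace_def zero_sum_def
  by (simp add: sum.distrib sum_distrib_left[symmetric])

lemma axis_diff_zero_sum: "axis i 1 - axis j 1 \<in> (zero_sum :: 'n::finite cvec set)"
  by (simp add: zero_sum_def sum_subtractf axis_def)

text \<open>
  A nonzero vector \<open>c\<close> with sum \<open>0\<close> has two different coordinates, and \<open>c - s\<^sub>i\<^sub>j c\<close> is then a multiple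
  of \<open>e\<^sub>i - e\<^sub>j\<close>; its translates span everything.
\<close>

lemma zero_sum_simple:
  fixes U :: "'n::finite cvec set"
  assumes sub: "vec.subspace U" and perm: "\<And>g c. bij g \<Longrightarrow> c \<in> U \<Longrightarrow> perm_vec g c \<in> U"
    and c: "c \<in> U" "c \<in> zero_sum" "c \<noteq> 0"
  shows "zero_sum \<subseteq> U"
proof -
  have "\<exists>i j. c $ i \<noteq> c $ j"
  proof (rule ccontr)
    assume "\<nexists>i j. c $ i \<noteq> c $ j"
    then have eq: "c $ i = c $ j" for i j by blast
    have "c $ i = 0" for i
    proof -
      have "(\<Sum>j\<in>UNIV. c $ j) = (\<Sum>j\<in>(UNIV :: 'n set). c $ i)" by (rule sum.cong) (rule refl, rule eq)
      then show ?thesis using c(2) by (simp add: zero_sum_def)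
    qed
    then show False using c(3) by (simp add: vec_eq_iff)
  qed
  then obtain i j where ij: "c $ i \<noteq> c $ j" by blast
  then have "i \<noteq> j" by auto
  define u where "u = c $ i - c $ j"
  define z :: "'n cvec" where "z = axis i 1 - axis j 1"
  have "u \<noteq> 0" using ij by (simp add: u_def)
  have "c - perm_vec (tr i j) c = u *s z"
    unfolding u_def z_def using \<open>i \<noteq> j\<close> by (auto simp: vec_eq_iff perm_vec_def axis_def Transposition.transpose_def)
  moreover have "c - perm_vec (tr i j) c \<in> U"
    using sub c(1) perm[of "tr i j" c] by (intro vec.subspace_diff) auto
  ultimately have "u *s z \<in> U" by simp
  from vec.subspace_scale[OF sub this, of "1 / u"] have ax: "axis i 1 - axis j 1 \<in> U"
    using \<open>u \<noteq> 0\<close> unfolding z_def[symmetric] by simp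
  have gen: "axis k 1 - axis l 1 \<in> U" if "k \<noteq> l" for k l
  proof -
    \<comment> \<open>A permutation that maps \<open>i\<close> to \<open>k\<close> and \<open>j\<close> to \<open>l\<close>:\<close>
    define g where "g = tr (tr i k j) l \<circ> tr i k"
    have g: "bij g" by (simp add: g_def bij_comp)
    have "tr i k j \<noteq> k" using \<open>i \<noteq> j\<close> by (auto simp: Transposition.transpose_def)
    then have gi: "g i = k" "g j = l" using that by (auto simp: g_def)
    have "perm_vec g (axis i 1 - axis j 1) = axis (g i) 1 - axis (g j) 1"
    proof -
      have "axis a 1 $ inv g b = (axis (g a) 1 $ b :: complex)" for a b
      proof -
        have "inv g b = a \<longleftrightarrow> b = g a" using bij_inv_eq_iff[OF g, of a b] by metis
        then show ?thesis by (simp add: axis_def)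
      qed
      then show ?thesis by (simp add: vec_eq_iff perm_vec_def)
    qed
    then show ?thesis using perm[OF g ax] gi by simp
  qed
  show ?thesis
  proof
    fix d :: "'n cvec" assume d: "d \<in> zero_sum"
    have "d = (\<Sum>k\<in>UNIV. d $ k *s (axis k 1 - axis i 1))"
    proof -
      have "(\<Sum>k\<in>UNIV. d $ k *s (axis k 1 - axis i 1)) = (\<Sum>k\<in>UNIV. d $ k *s axis k 1) - (\<Sum>k\<in>UNIV. d $ k) *s axis i 1"
        by (simp add: vec_eq_iff right_diff_distrib sum_subtractf sum_distrib_right)
      moreover have "(\<Sum>k\<in>UNIV. d $ k *s axis k 1) = d" by (simp add: basis_expansion)
      ultimately show ?thesis using d by (simp add: zero_sum_def)
    qed
    moreover have "axis k 1 - axis i 1 \<in> U" for k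
      using gen[of k i] vec.subspace_0[OF sub] by (cases "k = i") auto
    then have "(\<Sum>k\<in>UNIV. d $ k *s (axis k 1 - axis i 1)) \<in> U"
      by (intro vec.subspace_sum[OF sub] vec.subspace_scale[OF sub])
    ultimately show "d \<in> U" by (simp only:)
  qed
qed

context symmetric_generators
begin

lemma psi_poly_harmonic: "m \<ge> 1 \<Longrightarrow> peval (psi_poly m c) \<in> harmonic_polys m \<sigma>"
  unfolding psi_poly_def by (intro harmonic_sum harmonic_mconst_mult phi_poly_harmonic)

text \<open>
  The gradient at a regular point is injective on the harmonic polynomials of degree \<open>n m + 1\<close> and
  has coordinate sum \<open>0\<close>; the span of the integrals already fills this \<open>(n - 1)\<close>-dimensional space of
  gradients.
\<close>

lemma harmonic_eq_psi:
  assumes m: "m \<ge> 1" and p: "peval p \<in> harmonic_polys m \<sigma>" "homogeneous (CARD('n) * m + 1) p"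
  shows "\<exists>c\<in>zero_sum. p = psi_poly m c"
proof -
  obtain x :: "'n cvec" where x: "x \<in> reg_set" using ex_reg_set by blast
  \<comment> \<open>The matrix sends \<open>c\<close> to the gradient at \<open>x\<close> of the combination of integrals with coefficients \<open>c\<close>.\<close>
  define A :: "('n cvec, 'n) vec" where "A = (\<chi> i j. peval (mpartial i (phi_poly m (Min UNIV) j)) x)"
  have A: "A *v c = (\<chi> i. peval (mpartial i (psi_poly m c)) x)" for c
    by (simp add: A_def matrix_vector_mult_def psi_poly_def mpartial_sum mpartial_mult pev.mev_sum
        pev.mev_mult pev.mev_const vec_eq_iff mult.commute)
  have grad_inj: "q = 0" if "peval q \<in> harmonic_polys m \<sigma>" "homogeneous (CARD('n) * m + 1) q"
    "\<And>i. peval (mpartial i q) x = 0" for q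
    by (rule flat_gradient_inj[OF harmonic_flat[OF m that(1,2)] x that(3,2)]) simp
  have grad_sum: "(\<chi> i. peval (mpartial i q) x) \<in> zero_sum" if "peval q \<in> harmonic_polys m \<sigma>" for q
    using harmonic_translation[OF that] by (simp add: zero_sum_def pev.mev_sum[symmetric] pev.mev_zero)
  have inj: "inj_on ((*v) A) zero_sum"
  proof (rule inj_onI)
    fix c d :: "'n cvec" assume cd: "c \<in> zero_sum" "d \<in> zero_sum" "A *v c = A *v d"
    let ?e = "c - d"
    have "A *v ?e = 0" using cd(3) by (simp add: matrix_vector_mult_diff_distrib)
    then have "psi_poly m ?e = 0"
      by (intro grad_inj psi_poly_harmonic[OF m] homogeneous_psi_poly) (simp add: A vec_eq_iff)
    then have "psi m ?e = 0" by (simp add: psi_def pev.mev_zero fun_eq_iff zero_fun_apply)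
    moreover have "?e \<in> zero_sum" using cd(1,2) vec.subspace_diff[OF subspace_zero_sum] by blast
    ultimately have "?e = 0" using psi_inj[OF m] by blast
    then show "c = d" by simp
  qed
  have sub: "(*v) A ` zero_sum \<subseteq> zero_sum"
    using grad_sum[OF psi_poly_harmonic[OF m]] by (auto simp: A)
  have span: "vec.span (zero_sum :: 'n cvec set) = zero_sum"
    using subspace_zero_sum vec.span_eq_iff by blast
  have "(*v) A ` zero_sum = zero_sum"
  proof (rule vec.subspace_dim_equal[OF _ subspace_zero_sum sub])
    show "vec.subspace ((*v) A ` zero_sum)"
      by (rule vec.subspace_image) (rule subspace_zero_sum)
    show "vec.dim (zero_sum :: 'n cvec set) \<le> vec.dim ((*v) A ` zero_sum)"
      using vec.dim_image_eq[OF matrix_vector_mul_linear_gen, of A zero_sum] inj span by simp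
  qed
  then obtain c where c: "c \<in> zero_sum" "A *v c = (\<chi> i. peval (mpartial i p) x)"
    using grad_sum[OF p(1)] by (metis imageE)
  have "p - psi_poly m c = 0"
  proof (rule grad_inj)
    show "peval (p - psi_poly m c) \<in> harmonic_polys m \<sigma>"
      by (intro harmonic_diff p(1) psi_poly_harmonic[OF m])
    show "homogeneous (CARD('n) * m + 1) (p - psi_poly m c)"
      using homogeneous_add[OF p(2) homogeneous_uminus[OF homogeneous_psi_poly]] by simp
    show "peval (mpartial i (p - psi_poly m c)) x = 0" for i
      using c(2) by (simp add: A vec_eq_iff mpartial_diff pev.mev_diff)
  qed
  with c(1) show ?thesis by auto
qed

lemma harmonic_polys_deg_eq:
  assumes "m \<ge> 1" shows "harmonic_polys_deg m \<sigma> (CARD('n) * m + 1) = psi m ` zero_sum"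
proof
  show "harmonic_polys_deg m \<sigma> (CARD('n) * m + 1) \<subseteq> psi m ` zero_sum"
    using harmonic_eq_psi[OF assms] by (fastforce simp: harmonic_polys_deg_def psi_def)
  show "psi m ` zero_sum \<subseteq> harmonic_polys_deg m \<sigma> (CARD('n) * m + 1)"
    using psi_poly_harmonic[OF assms] homogeneous_psi_poly
    by (fastforce simp: harmonic_polys_deg_def psi_def)
qed

end

lemma subspace_psi_image:
  assumes U: "vec.subspace U" shows "fun_vs.subspace (psi m ` U)"
  unfolding fun_vs.subspace_def
proof (intro conjI ballI allI)
  show "0 \<in> psi m ` U" using vec.subspace_0[OF U] psi_zero by (metis image_eqI)
  fix f assume "f \<in> psi m ` U"
  then obtain c where c: "c \<in> U" "f = psi m c" by blast
  show "f + h \<in> psi m ` U" if "h \<in> psi m ` U" for h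
    using that c vec.subspace_add[OF U] by (auto simp: psi_add[symmetric])
  show "fscale a f \<in> psi m ` U" for a
    using c vec.subspace_scale[OF U] by (auto simp: psi_scale[symmetric])
qed

lemma perm_fun_psi_image:
  assumes "bij g" "f \<in> psi m ` zero_sum" shows "perm_fun g f \<in> psi m ` zero_sum"
  using assms perm_vec_zero_sum[OF assms(1)] by (auto simp: psi_equivariant)

lemma submodule_psi: "Sn_submodule fscale perm_fun (psi m ` zero_sum)"
  unfolding Sn_submodule_def
proof (intro conjI allI impI ballI)
  show "fun_vs.subspace (psi m ` (zero_sum :: 'a cvec set))" by (rule subspace_psi_image[OF subspace_zero_sum])
  show "perm_fun g f \<in> psi m ` zero_sum" if "g permutes UNIV" "f \<in> psi m ` zero_sum" for g f
    by (rule perm_fun_psi_image[OF permutes_bij[OF that(1)] that(2)])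
qed

lemma submodule_zero_sum: "Sn_submodule (*s) perm_vec (zero_sum :: 'n::finite cvec set)"
  unfolding Sn_submodule_def
  using subspace_zero_sum by (auto simp: permutes_bij perm_vec_zero_sum)

lemma ex_psi_nonzero:
  assumes n: "CARD('n::{finite,linorder}) \<ge> 2" and m: "m \<ge> 1"
  shows "\<exists>c\<in>(zero_sum :: 'n cvec set). psi m c \<noteq> 0"
proof -
  have "\<not> is_singleton (UNIV :: 'n set)" using n by (auto simp: is_singleton_altdef)
  then obtain i j :: 'n where "i \<noteq> j" by (metis UNIV_I empty_not_UNIV is_singletonI')
  then have "axis i 1 - axis j 1 \<noteq> (0 :: 'n cvec)" by (auto simp: vec_eq_iff axis_def intro!: exI[of _ i])
  then have "psi m (axis i 1 - axis j 1 :: 'n cvec) \<noteq> 0" using psi_inj[OF m axis_diff_zero_sum] by blast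
  with axis_diff_zero_sum show ?thesis by (rule rev_bexI)
qed

lemma simple_psi:
  fixes m :: nat
  assumes n: "CARD('n::{finite,linorder}) \<ge> 2" and m: "m \<ge> 1"
  shows "simple_Sn_module fscale perm_fun (psi m ` (zero_sum :: 'n cvec set))"
  unfolding simple_Sn_module_def
proof (intro conjI allI impI)
  show "Sn_submodule fscale perm_fun (psi m ` (zero_sum :: 'n cvec set))" by (rule submodule_psi)
  show "psi m ` (zero_sum :: 'n cvec set) \<noteq> {0}"
    using ex_psi_nonzero[where 'n = 'n, OF n m] by blast
next
  fix W assume W: "W \<subseteq> psi m ` (zero_sum :: 'n cvec set) \<and> Sn_submodule fscale perm_fun W"
  then have sub: "fun_vs.subspace W" and perm: "\<And>g f. bij g \<Longrightarrow> f \<in> W \<Longrightarrow> perm_fun g f \<in> W"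
    unfolding Sn_submodule_def using bij_imp_permutes[of _ UNIV] by auto
  define U where "U = {c \<in> zero_sum. psi m c \<in> W}"
  show "W = {0} \<or> W = psi m ` zero_sum"
  proof (cases "W \<subseteq> {0}")
    case True
    then show ?thesis using fun_vs.subspace_0[OF sub] by blast
  next
    case False
    then obtain f where f: "f \<in> W" "f \<noteq> 0" by blast
    then obtain c where c: "c \<in> zero_sum" "f = psi m c" using W by blast
    have "zero_sum \<subseteq> U"
    proof (rule zero_sum_simple)
      show "vec.subspace U"
        unfolding vec.subspace_def
        using subspace_zero_sum fun_vs.subspace_0[OF sub] fun_vs.subspace_add[OF sub] fun_vs.subspace_scale[OF sub]
        by (auto simp: U_def psi_zero psi_add psi_scale vec.subspace_def)
      show "perm_vec g d \<in> U" if "bij g" "d \<in> U" for g d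
        using that perm[of g "psi m d"] by (simp add: U_def perm_vec_zero_sum psi_equivariant)
      show "c \<in> U" using c f(1) by (simp add: U_def)
      show "c \<in> zero_sum" by (rule c(1))
      show "c \<noteq> 0" using c f(2) psi_zero by blast
    qed
    then show ?thesis using W by (auto simp: U_def)
  qed
qed

lemma isomorphic_psi:
  assumes m: "m \<ge> 1"
  shows "Sn_isomorphic fscale perm_fun (psi m ` zero_sum) (*s) perm_vec (zero_sum :: 'n::{finite,linorder} cvec set)"
  unfolding Sn_isomorphic_def
proof (intro conjI exI)
  let ?T = "inv_into zero_sum (psi m) :: _ \<Rightarrow> 'n cvec"
  note inj = psi_inj_on[OF m]
  have T: "?T (psi m c) = c" if "c \<in> zero_sum" for c by (rule inv_into_f_f[OF inj that])
  show "Sn_submodule fscale perm_fun (psi m ` (zero_sum :: 'n cvec set))" by (rule submodule_psi)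
  show "Sn_submodule (*s) perm_vec (zero_sum :: 'n cvec set)" by (rule submodule_zero_sum)
  show "bij_betw ?T (psi m ` zero_sum) zero_sum"
    by (rule bij_betw_inv_into) (simp add: bij_betw_def inj)
  show "\<forall>u\<in>psi m ` zero_sum. \<forall>v\<in>psi m ` zero_sum. ?T (u + v) = ?T u + ?T v"
  proof (intro ballI)
    fix u v assume "u \<in> psi m ` (zero_sum :: 'n cvec set)" "v \<in> psi m ` (zero_sum :: 'n cvec set)"
    then obtain c d :: "'n cvec" where "c \<in> zero_sum" "u = psi m c" "d \<in> zero_sum" "v = psi m d" by blast
    moreover from this have "c + d \<in> zero_sum" by (intro vec.subspace_add[OF subspace_zero_sum])
    ultimately show "?T (u + v) = ?T u + ?T v" by (simp add: psi_add[symmetric] T)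
  qed
  show "\<forall>a. \<forall>v\<in>psi m ` zero_sum. ?T (fscale a v) = a *s ?T v"
  proof (intro allI ballI)
    fix a v assume "v \<in> psi m ` (zero_sum :: 'n cvec set)"
    then obtain d :: "'n cvec" where "d \<in> zero_sum" "v = psi m d" by blast
    moreover from this have "a *s d \<in> zero_sum" by (intro vec.subspace_scale[OF subspace_zero_sum])
    ultimately show "?T (fscale a v) = a *s ?T v" by (simp add: psi_scale[symmetric] T)
  qed
  show "\<forall>g. g permutes UNIV \<longrightarrow> (\<forall>v\<in>psi m ` zero_sum. ?T (perm_fun g v) = perm_vec g (?T v))"
    by (auto simp: permutes_bij psi_equivariant perm_vec_zero_sum T)
qed

lemma psi_span:
  "fun_vs.span ((\<lambda>j. peval (phi_poly m (Min UNIV) j)) ` (UNIV - {Min UNIV}))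
    = psi m ` (zero_sum :: 'n::{finite,linorder} cvec set)"
proof
  let ?a = "Min UNIV :: 'n" and ?\<phi> = "\<lambda>j :: 'n. peval (phi_poly m (Min UNIV) j)"
  have \<phi>0: "?\<phi> ?a = 0" by (rule ext) (simp add: peval_phi_poly zero_fun_apply)
  show "fun_vs.span (?\<phi> ` (UNIV - {?a})) \<subseteq> psi m ` zero_sum"
  proof (rule fun_vs.span_minimal)
    show "fun_vs.subspace (psi m ` (zero_sum :: 'n cvec set))" by (rule subspace_psi_image[OF subspace_zero_sum])
    show "?\<phi> ` (UNIV - {?a}) \<subseteq> psi m ` zero_sum"
    proof
      fix f assume "f \<in> ?\<phi> ` (UNIV - {?a})"
      then obtain j where j: "f = ?\<phi> j" "j \<noteq> ?a" by blast
      have "psi m (axis j 1 - axis ?a 1) = ?\<phi> j"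
      proof
        fix x
        have "psi m (axis j 1 - axis ?a 1) x = (\<Sum>l\<in>UNIV. if l = j then ?\<phi> j x else 0)"
          unfolding psi_eq_sum using j(2) fun_cong[OF \<phi>0, of x]
          by (intro sum.cong) (auto simp: axis_def zero_fun_apply)
        then show "psi m (axis j 1 - axis ?a 1) x = ?\<phi> j x" by simp
      qed
      then show "f \<in> psi m ` zero_sum" using j(1) axis_diff_zero_sum by (metis image_eqI)
    qed
  qed
  show "psi m ` zero_sum \<subseteq> fun_vs.span (?\<phi> ` (UNIV - {?a}))"
  proof
    fix f assume "f \<in> psi m ` (zero_sum :: 'n cvec set)"
    then obtain c :: "'n cvec" where f: "f = psi m c" by blast
    have "f = (\<Sum>j\<in>UNIV - {?a}. fscale (c $ j) (?\<phi> j))"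
    proof
      fix x
      have "f x = (\<Sum>j\<in>UNIV - {?a}. c $ j * ?\<phi> j x)"
        unfolding f psi_eq_sum using fun_cong[OF \<phi>0, of x]
        by (intro sum.mono_neutral_right) (auto simp: zero_fun_apply)
      then show "f x = (\<Sum>j\<in>UNIV - {?a}. fscale (c $ j) (?\<phi> j)) x"
        by (simp add: sum_fun_apply fscale_def)
    qed
    also have "\<dots> \<in> fun_vs.span (?\<phi> ` (UNIV - {?a}))"
      by (intro fun_vs.span_sum fun_vs.span_scale fun_vs.span_base) auto
    finally show "f \<in> fun_vs.span (?\<phi> ` (UNIV - {?a}))" .
  qed
qed

lemma phi_poly_inj_on:
  assumes m: "m \<ge> 1"
  shows "inj_on (\<lambda>j :: 'n::{finite,linorder}. peval (phi_poly m (Min UNIV) j)) (UNIV - {Min UNIV})"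
proof (rule inj_onI, rule ccontr)
  let ?\<phi> = "\<lambda>j :: 'n. peval (phi_poly m (Min UNIV) j)"
  fix j k assume jk: "j \<in> UNIV - {Min UNIV}" "?\<phi> j = ?\<phi> k" "j \<noteq> k"
  have "psi m (axis j 1 - axis k 1) = 0"
  proof
    fix x
    have "psi m (axis j 1 - axis k 1) x = (\<Sum>l\<in>UNIV. (if l = j then ?\<phi> j x else 0) - (if l = k then ?\<phi> k x else 0))"
      unfolding psi_eq_sum by (intro sum.cong) (auto simp: axis_def)
    then show "psi m (axis j 1 - axis k 1) x = 0 x" using jk(2) by (simp add: sum_subtractf zero_fun_apply)
  qed
  then have "(axis j 1 - axis k 1 :: 'n cvec) $ j = 0" using psi_eq_0_imp[OF m] jk(1) by blast
  with jk(3) show False by (simp add: axis_def)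
qed

lemma phi_poly_independent:
  assumes m: "m \<ge> 1"
  shows "fun_vs.independent ((\<lambda>j :: 'n::{finite,linorder}. peval (phi_poly m (Min UNIV) j)) ` (UNIV - {Min UNIV}))"
proof
  let ?\<phi> = "\<lambda>j :: 'n. peval (phi_poly m (Min UNIV) j)"
  assume "fun_vs.dependent (?\<phi> ` (UNIV - {Min UNIV}))"
  then obtain u where u: "\<exists>v\<in>?\<phi> ` (UNIV - {Min UNIV}). u v \<noteq> 0"
    "(\<Sum>v\<in>?\<phi> ` (UNIV - {Min UNIV}). fscale (u v) v) = 0"
    by (subst (asm) fun_vs.dependent_finite) auto
  define c :: "'n cvec" where "c = (\<chi> j. if j = Min UNIV then 0 else u (?\<phi> j))"
  have "psi m c = 0"
  proof
    fix x
    have "psi m c x = (\<Sum>j\<in>UNIV - {Min UNIV}. u (?\<phi> j) * ?\<phi> j x)"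
      unfolding psi_eq_sum by (rule sum.mono_neutral_cong_right) (auto simp: c_def)
    also have "\<dots> = (\<Sum>v\<in>?\<phi> ` (UNIV - {Min UNIV}). u v * v x)"
      by (simp add: sum.reindex[OF phi_poly_inj_on[OF m]])
    also have "\<dots> = (\<Sum>v\<in>?\<phi> ` (UNIV - {Min UNIV}). fscale (u v) v) x"
      by (simp add: sum_fun_apply fscale_def)
    finally show "psi m c x = 0 x" by (simp only: u(2))
  qed
  then have "c $ j = 0" if "j \<noteq> Min UNIV" for j using psi_eq_0_imp[OF m] that by blast
  then show False using u(1) by (auto simp: c_def)
qed

theorem mainTheorem5:
  fixes \<sigma> :: "'n::{finite,linorder} \<Rightarrow> 'n mpoly" and m :: nat
  assumes n2: "CARD('n) \<ge> 2"
    and m1: "m \<ge> 1"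
    and homog: "\<And>i. \<exists>d. homogeneous d (\<sigma> i)"
    and free: "free_generators \<sigma>"
  shows "(\<forall>c. (\<lambda>x. c) \<in> harmonic_polys m \<sigma>)
    \<and> (\<exists>p. peval p \<in> harmonic_polys m \<sigma> \<and> total_deg p = CARD('n) * m + 1)
    \<and> (\<forall>p. peval p \<in> harmonic_polys m \<sigma> \<and> total_deg p > 0 \<longrightarrow> CARD('n) * m + 1 \<le> total_deg p)
    \<and> fun_vs.dim (harmonic_polys_deg m \<sigma> (CARD('n) * m + 1)) = CARD('n) - 1
    \<and> simple_Sn_module fscale perm_fun (harmonic_polys_deg m \<sigma> (CARD('n) * m + 1))
    \<and> Sn_isomorphic fscale perm_fun (harmonic_polys_deg m \<sigma> (CARD('n) * m + 1))
        (*s) perm_vec {x :: 'n cvec. (\<Sum>i\<in>UNIV. x $ i) = 0}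
    \<and> inj_on (phi m) (UNIV - {Min UNIV :: 'n})
    \<and> fun_vs.independent (phi m ` (UNIV - {Min UNIV :: 'n}))
    \<and> fun_vs.span (phi m ` (UNIV - {Min UNIV :: 'n})) = harmonic_polys_deg m \<sigma> (CARD('n) * m + 1)"
proof -
  interpret symmetric_generators \<sigma>
    using homog free by unfold_locales
  let ?H = "harmonic_polys_deg m \<sigma> (CARD('n) * m + 1)"
  have H: "?H = psi m ` zero_sum" by (rule harmonic_polys_deg_eq[OF m1])
  have phi: "phi m = (\<lambda>j :: 'n. peval (phi_poly m (Min UNIV) j))"
    by (rule ext) (rule phi_eq_phi_poly[OF m1])
  let ?B = "phi m ` (UNIV - {Min UNIV :: 'n})"
  have inj: "inj_on (phi m) (UNIV - {Min UNIV :: 'n})"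
    unfolding phi by (rule phi_poly_inj_on[OF m1])
  have indep: "fun_vs.independent ?B"
    unfolding phi by (rule phi_poly_independent[OF m1])
  have span: "fun_vs.span ?B = ?H"
    unfolding phi H by (rule psi_span)
  have "fun_vs.span ?B = fun_vs.span ?H"
    unfolding span[symmetric] by (simp only: fun_vs.span_span)
  then have "fun_vs.dim ?H = card ?B" by (rule fun_vs.dim_eq_card[OF _ indep])
  also have "\<dots> = CARD('n) - 1" using inj by (simp add: card_image card_Diff_subset)
  finally have dim: "fun_vs.dim ?H = CARD('n) - 1" .
  have exists_p: "\<exists>p. peval p \<in> harmonic_polys m \<sigma> \<and> total_deg p = CARD('n) * m + 1"
  proof -
    obtain c :: "'n cvec" where "psi m c \<noteq> 0" using ex_psi_nonzero[where 'n = 'n, OF n2 m1] by blast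
    then have "psi_poly m c \<noteq> 0" by (auto simp: psi_def pev.mev_zero fun_eq_iff zero_fun_apply)
    then show ?thesis
      using psi_poly_harmonic[OF m1] total_deg_homogeneous[OF homogeneous_psi_poly] by blast
  qed
  show ?thesis
    using const_harmonic exists_p harmonic_degree_bound[OF m1] dim simple_psi[OF n2 m1]
      isomorphic_psi[OF m1, where 'n = 'n] inj indep span
    unfolding H zero_sum_def by blast
qed

end
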